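(* Let $\Bbbk$ be an algebraically closed field, let $A=\Bbbk\mathcal{Q}/\mathcal{I}$ be a string almost gentle algebra (SAG-algebra), let $\mathcal{C}_1,\ldots,\mathcal{C}_t$ be the perfect forbidden cycles on $(\mathcal{Q},\mathcal{I})$, and let $\mathcal{R}_{\mathrm{p}}\subseteq\mathcal{Q}_1$ be the set of all arrows on all perfect forbidden cycles. Then the $\mathcal{R}_{\mathrm{p}}$-endomorphism algebra $A_{\mathcal{R}_{\mathrm{p}}}=\mathrm{End}_A\big(A\oplus\bigoplus_{\alpha\in\mathcal{R}_{\mathrm{p}}}\alpha A\big)$ is isomorphic to the Cohen-Macaulay Auslander algebra $A^{\mathrm{CMA}}$ of $A$.
   Context: Conventions. A quiver is $\mathcal{Q}=(\mathcal{Q}_0,\mathcal{Q}_1,\mathfrak{s},\mathfrak{t})$ with vertex set $\mathcal{Q}_0$, arrow set $\mathcal{Q}_1$, and source and target maps $\mathfrak{s},\mathfrak{t}$. If $\mathfrak{t}(a)=\mathfrak{s}(b)$, the composition "first $a$, then $b$" is written $ab$. All algebras are finite-dimensional over $\Bbbk$; modules are finitely generated right modules. For an arrow $\alpha$, $\alpha A$ is the right ideal of $A$ generated by $\alpha$. SAG-algebra. $A=\Bbbk\mathcal{Q}/\mathcal{I}$ (finite-dimensional) is an SAG-algebra if: every vertex is the source of at most two arrows and the target of at most two arrows; for each arrow $\alpha$ there is at most one arrow $\beta$ with $\mathfrak{s}(\beta)=\mathfrak{t}(\alpha)$ and $\alpha\beta\notin\mathcal{I}$; for each arrow $\alpha$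 there is at most one arrow $\gamma$ with $\mathfrak{t}(\gamma)=\mathfrak{s}(\alpha)$ and $\gamma\alpha\notin\mathcal{I}$; and $\mathcal{I}$ is generated by paths of length two. Cycles. A cycle of length $n$ on $n$ vertices $v_1,\ldots,v_n\in\mathcal{Q}_0$ is a sequence of $n$ edges $\overline{c}_1,\ldots,\overline{c}_n$ of the underlying graph of $\mathcal{Q}$ ($\overline{c}_i$ being the arrow $c_i$ with its orientation forgotten) such that the vertices can be arranged in a cyclic sequence in such a way that two vertices $v_i$ and $v_{i+1}$ (indices modulo $n$) are adjacent, connected by the arrow $c_i$, if they are consecutive in the sequence, and are nonadjacent otherwise. An oriented cycle is a cycle $\mathcal{C}=c_1\cdots c_n$ with $\mathfrak{t}(c_i)=\mathfrak{s}(c_{i+1})$ for $1\le i<n$ and $\mathfrak{t}(c_n)=\mathfrak{s}(c_1)$. A forbidden cycle is an oriented cycle $\mathcal{C}=c_1\cdots c_n$ such that $c_1c_2,\ldots,c_{n-1}c_n,c_nc_1\in\mathcal{I}$. Perfect forbidden cycles. A forbidden cycle $\mathcal{C}=c_1\cdots c_l$ (indices modulo $l$, the source of $c_i$ being denoted $i$) is perfect if: for any vertex $i$ on $\mathcal{C}$ and any arrow $\alpha\neq c_{i-1}$ ending at $i$, one has $\alpha c_i\notin\mathcal{I}$; and for any vertex $i$ on $\mathcal{C}$ and any arrow $\beta\neq c_i$ starting at $i$, one has $c_{i-1}\beta\notin\mathcal{I}$. Cohen-Macaulay Auslander algebra. A module $G$ is Gorenstein-projective if it is isomorphic to the image of a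 differential in an exact complex of finitely generated projective $A$-modules (indexed by $\mathbb{Z}$) that remains exact under $\mathrm{Hom}_A(-,A)$. An SAG-algebra has only finitely many indecomposable Gorenstein-projective modules up to isomorphism. One sets $A^{\mathrm{CMA}}=\mathrm{End}_A\big(\bigoplus_{G}G\big)$, where $G$ runs over representatives of all isomorphism classes of indecomposable Gorenstein-projective $A$-modules (including the projective ones).
   Formalization: A cycle is taken to be a cyclic sequence of distinct arrows in which vertices may repeat and chords are allowed; with distinct vertices, or with nonconsecutive vertices required nonadjacent, as in the stated definition, the claim fails for some gentle algebras. *)

theory Defs
  imports "HOL-Computational_Algebra.Polynomial" "Graph_Theory.Arc_Walk"
    "HOL-Algebra.QuotRing" "HOL-Algebra.Module"
begin

section \<open>Path algebras and bound quiver algebras\<close>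

text \<open>
  A quiver is a \<open>pre_digraph\<close> (loops and parallel arrows are allowed); \<open>tail\<close> is the source
  map and \<open>head\<close> the target map.  A path is a pair of its starting vertex and its list of
  arrows, so that \<open>(v, [])\<close> is the trivial path at \<open>v\<close>.  The scalars form a type of class
  \<open>field\<close>, and algebras are records of type \<open>module\<close>, carrying both a multiplication and a
  scalar multiplication.
\<close>

type_synonym ('v, 'e) qpath = "'v \<times> 'e list"

definition qpaths :: "('v, 'e) pre_digraph \<Rightarrow> ('v, 'e) qpath set" where
  "qpaths Q = {(u, p). \<exists>v. pre_digraph.awalk Q u p v}"

definition path_vec :: "('v, 'e) qpath \<Rightarrow> ('v, 'e) qpath \<Rightarrow> 'k::field" where
  "path_vec p = (\<lambda>q. if q = p then 1 else 0)"

text \<open>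
  The elements are the finitely supported functions on paths.  The coefficient of a product at
  a path is the sum over all ways to cut that path into a first and a second part, so
  \<open>path_vec p\<close> times \<open>path_vec q\<close> is the path ``first \<open>p\<close>, then \<open>q\<close>''.
\<close>

definition path_algebra :: "('v, 'e) pre_digraph \<Rightarrow> ('k::field, ('v, 'e) qpath \<Rightarrow> 'k) module" where
  "path_algebra Q =
    \<lparr>carrier = {f. finite {p. f p \<noteq> 0} \<and> {p. f p \<noteq> 0} \<subseteq> qpaths Q},
     monoid.mult = (\<lambda>f g (u, p). \<Sum>i\<le>length p.
        f (u, take i p) * g (pre_digraph.awlast Q u (take i p), drop i p)),
     one = (\<lambda>(u, p). if u \<in> verts Q \<and> p = [] then 1 else 0),
     zero = (\<lambda>_. 0),
     add = (\<lambda>f g p. f p + g p),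
     smult = (\<lambda>c f p. c * f p)\<rparr>"

definition quotient_algebra :: "('k, 'a) module \<Rightarrow> 'a set \<Rightarrow> ('k, 'a set) module" where
  "quotient_algebra R I = ring.extend (R Quot I)
     (module.fields (\<lambda>c X. \<Union>x\<in>X. I +>\<^bsub>R\<^esub> (c \<odot>\<^bsub>R\<^esub> x)))"

definition finite_dimensional :: "('k, 'a) module \<Rightarrow> bool" where
  "finite_dimensional A \<longleftrightarrow> (\<exists>B. finite B \<and> B \<subseteq> carrier A \<and>
     (\<forall>x\<in>carrier A. \<exists>c. x = (\<Oplus>\<^bsub>A\<^esub>b\<in>B. c b \<odot>\<^bsub>A\<^esub> b)))"

abbreviation bound_quiver_algebra ::
  "('v, 'e) pre_digraph \<Rightarrow> (('v, 'e) qpath \<Rightarrow> 'k::field) set \<Rightarrow>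
     ('k, (('v, 'e) qpath \<Rightarrow> 'k) set) module" where
  "bound_quiver_algebra Q I \<equiv> quotient_algebra (path_algebra Q) I"

definition arrow_vec :: "('v, 'e) pre_digraph \<Rightarrow> 'e \<Rightarrow> ('v, 'e) qpath \<Rightarrow> 'k::field" where
  "arrow_vec Q a = path_vec (tail Q a, [a])"

definition arrow_class ::
  "('v, 'e) pre_digraph \<Rightarrow> (('v, 'e) qpath \<Rightarrow> 'k::field) set \<Rightarrow> 'e \<Rightarrow>
     (('v, 'e) qpath \<Rightarrow> 'k) set" where
  "arrow_class Q I a = I +>\<^bsub>path_algebra Q\<^esub> arrow_vec Q a"

text \<open>\<open>ab \<in> I\<close> for arrows \<open>a\<close> and \<open>b\<close>.\<close>

definition comp_in ::
  "('v, 'e) pre_digraph \<Rightarrow> (('v, 'e) qpath \<Rightarrow> 'k::field) set \<Rightarrow> 'e \<Rightarrow> 'e \<Rightarrow> bool" where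
  "comp_in Q I a b \<longleftrightarrow> arrow_vec Q a \<otimes>\<^bsub>path_algebra Q\<^esub> arrow_vec Q b \<in> I"

locale sag_algebra = fin_digraph Q
  for Q :: "('v, 'e) pre_digraph" +
  fixes I :: "(('v, 'e) qpath \<Rightarrow> 'k::field) set"
  assumes out_degree_le: "v \<in> verts Q \<Longrightarrow> out_degree Q v \<le> 2"
    and in_degree_le: "v \<in> verts Q \<Longrightarrow> in_degree Q v \<le> 2"
    and at_most_one_after:
      "\<lbrakk>a \<in> arcs Q; b \<in> arcs Q; b' \<in> arcs Q; tail Q b = head Q a; tail Q b' = head Q a;
        \<not> comp_in Q I a b; \<not> comp_in Q I a b'\<rbrakk> \<Longrightarrow> b = b'"
    and at_most_one_before:
      "\<lbrakk>a \<in> arcs Q; c \<in> arcs Q; c' \<in> arcs Q; head Q c = tail Q a; head Q c' = tail Q a;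
        \<not> comp_in Q I c a; \<not> comp_in Q I c' a\<rbrakk> \<Longrightarrow> c = c'"
    and quadratic_monomial:
      "\<exists>Z \<subseteq> {p \<in> qpaths Q. length (snd p) = 2}. I = Idl\<^bsub>path_algebra Q\<^esub> (path_vec ` Z)"
    and finite_dimensional: "finite_dimensional (bound_quiver_algebra Q I)"


section \<open>Perfect forbidden cycles\<close>

text \<open>
  A cycle is a nonempty cyclic sequence of pairwise distinct arrows; its vertices form the
  indexed family of the sources of these arrows.  Adjacency is understood inside the cycle:
  the quiver may have further arrows between these vertices, and vertices at different
  positions may coincide (otherwise the nonprojective Gorenstein-projective modules of some gentle
  algebras would be missed).  Loops are cycles of length one.  The conditions on a perfect cycle
  are imposed at every position of the sequence.
\<close>

definition oriented_cycle :: "('v, 'e) pre_digraph \<Rightarrow> 'e list \<Rightarrow> bool" where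
  "oriented_cycle Q c \<longleftrightarrow> c \<noteq> [] \<and> set c \<subseteq> arcs Q \<and> distinct c \<and>
     (\<forall>i<length c. head Q (c ! i) = tail Q (c ! (Suc i mod length c)))"

definition forbidden_cycle ::
  "('v, 'e) pre_digraph \<Rightarrow> (('v, 'e) qpath \<Rightarrow> 'k::field) set \<Rightarrow> 'e list \<Rightarrow> bool" where
  "forbidden_cycle Q I c \<longleftrightarrow> oriented_cycle Q c \<and>
     (\<forall>i<length c. comp_in Q I (c ! i) (c ! (Suc i mod length c)))"

definition perfect_forbidden_cycle ::
  "('v, 'e) pre_digraph \<Rightarrow> (('v, 'e) qpath \<Rightarrow> 'k::field) set \<Rightarrow> 'e list \<Rightarrow> bool" where
  "perfect_forbidden_cycle Q I c \<longleftrightarrow> forbidden_cycle Q I c \<and>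
     (\<forall>i<length c. let prev = c ! i; next = c ! (Suc i mod length c) in
        (\<forall>a\<in>arcs Q. head Q a = tail Q next \<and> a \<noteq> prev \<longrightarrow> \<not> comp_in Q I a next) \<and>
        (\<forall>b\<in>arcs Q. tail Q b = tail Q next \<and> b \<noteq> next \<longrightarrow> \<not> comp_in Q I prev b))"

definition perfect_arrows ::
  "('v, 'e) pre_digraph \<Rightarrow> (('v, 'e) qpath \<Rightarrow> 'k::field) set \<Rightarrow> 'e set" where
  "perfect_arrows Q I = (\<Union>c\<in>{c. perfect_forbidden_cycle Q I c}. set c)"


section \<open>Right modules over a noncommutative ring\<close>

text \<open>As for the record \<open>module\<close>, the fields \<open>mult\<close> and \<open>one\<close> of a right module are junk.\<close>

record ('a, 'm) rmodule = "'m ring" +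
  ract :: "'m \<Rightarrow> 'a \<Rightarrow> 'm"  (infixl \<open>\<lhd>\<index>\<close> 70)

locale right_module = A?: ring A + M?: abelian_group M
  for A :: "('a, 'b) ring_scheme" (structure) and M :: "('a, 'm, 'c) rmodule_scheme" (structure) +
  assumes ract_closed: "\<lbrakk>m \<in> carrier M; a \<in> carrier A\<rbrakk> \<Longrightarrow> m \<lhd>\<^bsub>M\<^esub> a \<in> carrier M"
    and ract_one: "m \<in> carrier M \<Longrightarrow> m \<lhd>\<^bsub>M\<^esub> \<one>\<^bsub>A\<^esub> = m"
    and ract_mult: "\<lbrakk>m \<in> carrier M; a \<in> carrier A; b \<in> carrier A\<rbrakk> \<Longrightarrow>
          m \<lhd>\<^bsub>M\<^esub> (a \<otimes>\<^bsub>A\<^esub> b) = (m \<lhd>\<^bsub>M\<^esub> a) \<lhd>\<^bsub>M\<^esub> b"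
    and ract_add_left: "\<lbrakk>m \<in> carrier M; n \<in> carrier M; a \<in> carrier A\<rbrakk> \<Longrightarrow>
          (m \<oplus>\<^bsub>M\<^esub> n) \<lhd>\<^bsub>M\<^esub> a = (m \<lhd>\<^bsub>M\<^esub> a) \<oplus>\<^bsub>M\<^esub> (n \<lhd>\<^bsub>M\<^esub> a)"
    and ract_add_right: "\<lbrakk>m \<in> carrier M; a \<in> carrier A; b \<in> carrier A\<rbrakk> \<Longrightarrow>
          m \<lhd>\<^bsub>M\<^esub> (a \<oplus>\<^bsub>A\<^esub> b) = (m \<lhd>\<^bsub>M\<^esub> a) \<oplus>\<^bsub>M\<^esub> (m \<lhd>\<^bsub>M\<^esub> b)"

definition rhom :: "('a, 'b) ring_scheme \<Rightarrow> ('a, 'm) rmodule \<Rightarrow> ('a, 'n) rmodule \<Rightarrow> ('m \<Rightarrow> 'n) set" where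
  "rhom A M N = {f \<in> carrier M \<rightarrow>\<^sub>E carrier N.
     (\<forall>x\<in>carrier M. \<forall>y\<in>carrier M. f (x \<oplus>\<^bsub>M\<^esub> y) = f x \<oplus>\<^bsub>N\<^esub> f y) \<and>
     (\<forall>x\<in>carrier M. \<forall>a\<in>carrier A. f (x \<lhd>\<^bsub>M\<^esub> a) = f x \<lhd>\<^bsub>N\<^esub> a)}"

definition rmod_iso :: "('a, 'b) ring_scheme \<Rightarrow> ('a, 'm) rmodule \<Rightarrow> ('a, 'n) rmodule \<Rightarrow> bool" where
  "rmod_iso A M N \<longleftrightarrow> (\<exists>f\<in>rhom A M N. bij_betw f (carrier M) (carrier N))"

definition regular_module :: "('a, 'b) ring_scheme \<Rightarrow> ('a, 'a) rmodule" where
  "regular_module A = \<lparr>carrier = carrier A, monoid.mult = monoid.mult A, one = one A, zero = zero A, add = add A,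
     ract = monoid.mult A\<rparr>"

definition principal_right_ideal :: "('a, 'b) ring_scheme \<Rightarrow> 'a \<Rightarrow> ('a, 'a) rmodule" where
  "principal_right_ideal A x = (regular_module A)\<lparr>carrier := {x \<otimes>\<^bsub>A\<^esub> a | a. a \<in> carrier A}\<rparr>"

definition direct_sum :: "'i set \<Rightarrow> ('i \<Rightarrow> ('a, 'm) rmodule) \<Rightarrow> ('a, 'i \<Rightarrow> 'm) rmodule" where
  "direct_sum J M =
    \<lparr>carrier = {x \<in> (\<Pi>\<^sub>E i\<in>J. carrier (M i)). finite {i \<in> J. x i \<noteq> \<zero>\<^bsub>M i\<^esub>}},
     monoid.mult = undefined, one = undefined,
     zero = (\<lambda>i\<in>J. \<zero>\<^bsub>M i\<^esub>),
     add = (\<lambda>x y. \<lambda>i\<in>J. x i \<oplus>\<^bsub>M i\<^esub> y i),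
     ract = (\<lambda>x a. \<lambda>i\<in>J. x i \<lhd>\<^bsub>M i\<^esub> a)\<rparr>"

definition right_submodule :: "('a, 'b) ring_scheme \<Rightarrow> ('a, 'm) rmodule \<Rightarrow> 'm set \<Rightarrow> bool" where
  "right_submodule A M U \<longleftrightarrow> additive_subgroup U M \<and>
     (\<forall>u\<in>U. \<forall>a\<in>carrier A. u \<lhd>\<^bsub>M\<^esub> a \<in> U)"

definition internal_direct_sum ::
  "('a, 'b) ring_scheme \<Rightarrow> ('a, 'm) rmodule \<Rightarrow> 'm set \<Rightarrow> 'm set \<Rightarrow> bool" where
  "internal_direct_sum A M U W \<longleftrightarrow> right_submodule A M U \<and> right_submodule A M W \<and>
     U <+>\<^bsub>M\<^esub> W = carrier M \<and> U \<inter> W = {\<zero>\<^bsub>M\<^esub>}"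

definition indecomposable :: "('a, 'b) ring_scheme \<Rightarrow> ('a, 'm) rmodule \<Rightarrow> bool" where
  "indecomposable A M \<longleftrightarrow> right_module A M \<and> carrier M \<noteq> {\<zero>\<^bsub>M\<^esub>} \<and>
     (\<forall>U W. internal_direct_sum A M U W \<longrightarrow> U = {\<zero>\<^bsub>M\<^esub>} \<or> W = {\<zero>\<^bsub>M\<^esub>})"

text \<open>Isomorphic to a direct summand of a free module of finite rank.\<close>

definition fg_projective :: "('a, 'b) ring_scheme \<Rightarrow> ('a, 'm) rmodule \<Rightarrow> bool" where
  "fg_projective A P \<longleftrightarrow> right_module A P \<and>
     (\<exists>(n::nat) U W. let F = direct_sum {..<n} (\<lambda>_. regular_module A) in
        internal_direct_sum A F U W \<and> rmod_iso A P (F\<lparr>carrier := U\<rparr>))"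


section \<open>Gorenstein-projective modules\<close>

text \<open>
  An exact complex of finitely generated projective modules with differentials
  \<open>d i : P i \<rightarrow> P (i + 1)\<close> whose image under \<open>Hom\<^sub>A(-, A)\<close> is exact as well.
\<close>

definition totally_exact ::
  "('a, 'b) ring_scheme \<Rightarrow> (int \<Rightarrow> ('a, 'm) rmodule) \<Rightarrow> (int \<Rightarrow> 'm \<Rightarrow> 'm) \<Rightarrow> bool" where
  "totally_exact A P d \<longleftrightarrow>
     (\<forall>i. fg_projective A (P i)) \<and>
     (\<forall>i. d i \<in> rhom A (P i) (P (i + 1))) \<and>
     (\<forall>i. d i ` carrier (P i) = {x \<in> carrier (P (i + 1)). d (i + 1) x = \<zero>\<^bsub>P (i + 1 + 1)\<^esub>}) \<and>
     (\<forall>i. (\<lambda>g. compose (carrier (P (i + 1))) g (d (i + 1))) `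
              rhom A (P (i + 1 + 1)) (regular_module A) =
          {f \<in> rhom A (P (i + 1)) (regular_module A). \<forall>x\<in>carrier (P i). f (d i x) = \<zero>\<^bsub>A\<^esub>})"

text \<open>
  Every finitely generated projective module is isomorphic to a submodule of some \<open>A\<^sup>n\<close>, whose
  elements have type \<open>nat \<Rightarrow> 'a\<close>.  So it is no restriction to take the modules of the complex
  with elements of this type; and, as an image of a differential lies in such a module, every
  Gorenstein-projective module is isomorphic to one whose elements have this type.
\<close>

definition gorenstein_projective :: "('a, 'b) ring_scheme \<Rightarrow> ('a, 'm) rmodule \<Rightarrow> bool" where
  "gorenstein_projective A G \<longleftrightarrow> right_module A G \<and>
     (\<exists>(P :: int \<Rightarrow> ('a, nat \<Rightarrow> 'a) rmodule) d i. totally_exact A P d \<and>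
        rmod_iso A G ((P (i + 1))\<lparr>carrier := d i ` carrier (P i)\<rparr>))"

definition indec_GP :: "('a, 'b) ring_scheme \<Rightarrow> ('a, nat \<Rightarrow> 'a) rmodule set" where
  "indec_GP A = {G. indecomposable A G \<and> gorenstein_projective A G}"

text \<open>\<open>\<G>\<close> contains exactly one module from each isomorphism class.\<close>

definition indec_GP_representatives ::
  "('a, 'b) ring_scheme \<Rightarrow> ('a, nat \<Rightarrow> 'a) rmodule set \<Rightarrow> bool" where
  "indec_GP_representatives A \<G> \<longleftrightarrow> \<G> \<subseteq> indec_GP A \<and>
     (\<forall>M\<in>indec_GP A. \<exists>!G. G \<in> \<G> \<and> rmod_iso A M G)"


section \<open>Endomorphism algebras\<close>

text \<open>The scalar \<open>c\<close> acts on a module as the element \<open>c \<odot> \<one>\<close> of the algebra.\<close>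

definition End_algebra :: "('k, 'a) module \<Rightarrow> ('a, 'm) rmodule \<Rightarrow> ('k, 'm \<Rightarrow> 'm) module" where
  "End_algebra A M =
    \<lparr>carrier = rhom A M M,
     monoid.mult = (\<lambda>f g. compose (carrier M) f g),
     one = (\<lambda>x\<in>carrier M. x),
     zero = (\<lambda>x\<in>carrier M. \<zero>\<^bsub>M\<^esub>),
     add = (\<lambda>f g. \<lambda>x\<in>carrier M. f x \<oplus>\<^bsub>M\<^esub> g x),
     smult = (\<lambda>c f. \<lambda>x\<in>carrier M. f x \<lhd>\<^bsub>M\<^esub> (c \<odot>\<^bsub>A\<^esub> \<one>\<^bsub>A\<^esub>))\<rparr>"

definition algebra_iso :: "('k, 'a) module \<Rightarrow> ('k, 'b) module \<Rightarrow> bool" where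
  "algebra_iso A B \<longleftrightarrow> (\<exists>\<phi>\<in>ring_iso A B.
     \<forall>c. \<forall>x\<in>carrier A. \<phi> (c \<odot>\<^bsub>A\<^esub> x) = c \<odot>\<^bsub>B\<^esub> \<phi> x)"

text \<open>
  \<open>A \<oplus> \<Oplus>\<^sub>\<alpha> \<alpha>A\<close> over the arrows \<open>\<alpha>\<close> in \<open>R\<close>: the index \<open>None\<close> stands for the summand \<open>A\<close>.
\<close>

definition arrow_endo_algebra ::
  "('v, 'e) pre_digraph \<Rightarrow> (('v, 'e) qpath \<Rightarrow> 'k::field) set \<Rightarrow> 'e set \<Rightarrow>
     ('k, ('e option \<Rightarrow> (('v, 'e) qpath \<Rightarrow> 'k) set) \<Rightarrow> ('e option \<Rightarrow> (('v, 'e) qpath \<Rightarrow> 'k) set)) module" where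
  "arrow_endo_algebra Q I R = (let A = bound_quiver_algebra Q I in
     End_algebra A (direct_sum (insert None (Some ` R))
       (case_option (regular_module A) (\<lambda>\<alpha>. principal_right_ideal A (arrow_class Q I \<alpha>)))))"

definition CM_Auslander_algebra ::
  "('k, 'a) module \<Rightarrow> ('a, nat \<Rightarrow> 'a) rmodule set \<Rightarrow>
     ('k, (('a, nat \<Rightarrow> 'a) rmodule \<Rightarrow> nat \<Rightarrow> 'a) \<Rightarrow> (('a, nat \<Rightarrow> 'a) rmodule \<Rightarrow> nat \<Rightarrow> 'a)) module" where
  "CM_Auslander_algebra A \<G> = End_algebra A (direct_sum \<G> (\<lambda>G. G))"


section \<open>Basic facts\<close>

text \<open>
  The structures above are rings and modules, so that in particular the ideals in question are
  ideals of a ring, and systems of representatives exist.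
\<close>


lemma qpaths_iff: "(u,p) \<in> qpaths Q \<longleftrightarrow> pre_digraph.awalk Q u p (pre_digraph.awlast Q u p)"
proof -
  have *: "pre_digraph.cas Q u p v \<Longrightarrow> pre_digraph.awlast Q u p = v" for v
    by (induction p arbitrary: u) (auto simp: pre_digraph.cas.simps pre_digraph.awalk_verts.simps pre_digraph.awalk_verts_non_Nil split: if_splits)
  show ?thesis
    unfolding qpaths_def pre_digraph.awalk_def using * by auto
qed

lemma awlast_take_drop:
  "pre_digraph.awlast Q (pre_digraph.awlast Q u (take j p)) (take k (drop j p))
     = pre_digraph.awlast Q u (take (j + k) p)"
  by (simp add: pre_digraph.awalk_verts_conv take_add)

lemma qpaths_join:
  assumes "(u, take i p) \<in> qpaths Q" "(pre_digraph.awlast Q u (take i p), drop i p) \<in> qpaths Q"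
  shows "(u, p) \<in> qpaths Q"
proof -
  have "pre_digraph.cas Q u (take i p @ drop i p) (pre_digraph.awlast Q (pre_digraph.awlast Q u (take i p)) (drop i p))"
    using assms unfolding qpaths_iff pre_digraph.awalk_def pre_digraph.cas_append_iff by auto
  moreover have "set (take i p @ drop i p) \<subseteq> arcs Q"
    using assms unfolding qpaths_iff pre_digraph.awalk_def set_append by blast
  ultimately show ?thesis
    using assms(1) unfolding qpaths_def pre_digraph.awalk_def by auto
qed

lemma path_algebra_carrierI:
  "finite {p. f p \<noteq> 0} \<Longrightarrow> (\<And>p. f p \<noteq> 0 \<Longrightarrow> p \<in> qpaths Q) \<Longrightarrow> f \<in> carrier (path_algebra Q)"
  by (auto simp: path_algebra_def)

lemma path_algebra_mult_closed:
  fixes f g :: "('v, 'e) qpath \<Rightarrow> 'k::field"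
  assumes f: "f \<in> carrier (path_algebra Q)" and g: "g \<in> carrier (path_algebra Q)"
  shows "f \<otimes>\<^bsub>path_algebra Q\<^esub> g \<in> carrier (path_algebra Q)"
proof -
  let ?h = "f \<otimes>\<^bsub>path_algebra Q\<^esub> g"
  have fin: "finite {p. f p \<noteq> 0}" "finite {p. g p \<noteq> 0}"
    and sub: "\<And>p. f p \<noteq> 0 \<Longrightarrow> p \<in> qpaths Q" "\<And>p. g p \<noteq> 0 \<Longrightarrow> p \<in> qpaths Q"
    using f g by (auto simp: path_algebra_def)
  have key: "\<exists>i\<le>length p. f (u, take i p) \<noteq> 0 \<and> g (pre_digraph.awlast Q u (take i p), drop i p) \<noteq> 0"
    if "?h (u, p) \<noteq> 0" for u p
  proof -
    from that have "(\<Sum>i\<le>length p. f (u, take i p) * g (pre_digraph.awlast Q u (take i p), drop i p)) \<noteq> 0"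
      by (simp add: path_algebra_def)
    then obtain i where "i \<in> {..length p}" "f (u, take i p) * g (pre_digraph.awlast Q u (take i p), drop i p) \<noteq> 0"
      by (rule sum.not_neutral_contains_not_neutral)
    then show ?thesis by auto
  qed
  have "{p. ?h p \<noteq> 0} \<subseteq> (\<lambda>((u,q),(w,r)). (u, q @ r)) ` ({p. f p \<noteq> 0} \<times> {p. g p \<noteq> 0})"
  proof clarify
    fix u p assume "?h (u, p) \<noteq> 0"
    from key[OF this] obtain i where i: "f (u, take i p) \<noteq> 0" "g (pre_digraph.awlast Q u (take i p), drop i p) \<noteq> 0" by blast
    show "(u,p) \<in> (\<lambda>((u,q),(w,r)). (u, q @ r)) ` ({p. f p \<noteq> 0} \<times> {p. g p \<noteq> 0})"
      by (rule image_eqI[of _ _ "((u, take i p), (pre_digraph.awlast Q u (take i p), drop i p))"]) (use i in auto)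
  qed
  then have "finite {p. ?h p \<noteq> 0}"
    by (rule finite_subset) (use fin in auto)
  moreover have "p \<in> qpaths Q" if "?h p \<noteq> 0" for p
  proof (cases p)
    case (Pair u q)
    with that key[of u q] obtain i where "f (u, take i q) \<noteq> 0"
      "g (pre_digraph.awlast Q u (take i q), drop i q) \<noteq> 0" by blast
    with Pair sub show ?thesis by (blast intro: qpaths_join)
  qed
  ultimately show ?thesis by (rule path_algebra_carrierI)
qed

lemma path_algebra_mult_assoc:
  fixes f g h :: "('v, 'e) qpath \<Rightarrow> 'k::field"
  shows "(f \<otimes>\<^bsub>path_algebra Q\<^esub> g) \<otimes>\<^bsub>path_algebra Q\<^esub> h = f \<otimes>\<^bsub>path_algebra Q\<^esub> (g \<otimes>\<^bsub>path_algebra Q\<^esub> h)"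
proof (rule ext, clarify)
  fix u :: 'v and p :: "'e list"
  let ?n = "length p"
  let ?w = "\<lambda>j. pre_digraph.awlast Q u (take j p)"
  let ?T = "\<lambda>i j. f (u, take j p) * g (?w j, drop j (take i p)) * h (?w i, drop i p)"
  have "((f \<otimes>\<^bsub>path_algebra Q\<^esub> g) \<otimes>\<^bsub>path_algebra Q\<^esub> h) (u, p) = (\<Sum>i\<le>?n. \<Sum>j\<le>i. ?T i j)"
    by (auto simp: path_algebra_def sum_distrib_right min_def intro!: sum.cong)
  also have "\<dots> = (\<Sum>(i,j)\<in>(SIGMA i:{..?n}. {..i}). ?T i j)"
    by (simp add: sum.Sigma)
  also have "\<dots> = (\<Sum>(j,k)\<in>(SIGMA j:{..?n}. {..?n - j}). ?T (j + k) j)"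
    by (rule sum.reindex_bij_witness[of _ "\<lambda>(j,k). (j+k, j)" "\<lambda>(i,j). (j, i - j)"]) auto
  also have "\<dots> = (\<Sum>j\<le>?n. \<Sum>k\<le>?n - j. ?T (j + k) j)"
    by (simp add: sum.Sigma)
  also have "\<dots> = (f \<otimes>\<^bsub>path_algebra Q\<^esub> (g \<otimes>\<^bsub>path_algebra Q\<^esub> h)) (u, p)"
    by (auto simp: path_algebra_def sum_distrib_left awlast_take_drop drop_take mult.assoc add.commute intro!: sum.cong)
  finally show "((f \<otimes>\<^bsub>path_algebra Q\<^esub> g) \<otimes>\<^bsub>path_algebra Q\<^esub> h) (u, p) =
    (f \<otimes>\<^bsub>path_algebra Q\<^esub> (g \<otimes>\<^bsub>path_algebra Q\<^esub> h)) (u, p)" .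
qed

lemma (in fin_digraph) path_algebra_ring: "ring (path_algebra G :: ('k::field, _) module)"
proof (rule ringI)
  let ?K = "path_algebra G :: ('k, _) module"
  show "abelian_group ?K"
  proof (rule abelian_groupI)
    fix x y assume x: "x \<in> carrier ?K" and y: "y \<in> carrier ?K"
    have "{p. x p + y p \<noteq> 0} \<subseteq> {p. x p \<noteq> 0} \<union> {p. y p \<noteq> 0}" by auto
    with x y show "x \<oplus>\<^bsub>?K\<^esub> y \<in> carrier ?K"
      by (auto simp: path_algebra_def elim: finite_subset)
  next
    fix x assume x: "x \<in> carrier ?K"
    show "\<exists>y\<in>carrier ?K. y \<oplus>\<^bsub>?K\<^esub> x = \<zero>\<^bsub>?K\<^esub>"
      by (rule bexI[of _ "\<lambda>p. - x p"]) (use x in \<open>auto simp: path_algebra_def\<close>)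
  qed (auto simp: path_algebra_def algebra_simps)
  have one: "\<one>\<^bsub>?K\<^esub> \<in> carrier ?K"
  proof (rule path_algebra_carrierI)
    have "{p. \<one>\<^bsub>?K\<^esub> p \<noteq> 0} \<subseteq> (\<lambda>u. (u, [])) ` verts G"
      by (auto simp: path_algebra_def split: if_splits)
    then show "finite {p. \<one>\<^bsub>?K\<^esub> p \<noteq> 0}" by (rule finite_subset) auto
    fix p assume "\<one>\<^bsub>?K\<^esub> p \<noteq> 0"
    then show "p \<in> qpaths G"
      by (auto simp: path_algebra_def qpaths_iff awalk_def split: if_splits prod.splits)
  qed
  show "Group.monoid ?K"
  proof (rule monoidI)
    fix x assume x: "x \<in> carrier ?K"
    have supp: "u \<in> verts G \<and> awlast u p \<in> verts G" if "x (u,p) \<noteq> 0" for u p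
    proof -
      have "(u,p) \<in> qpaths G" using x that by (auto simp: path_algebra_def)
      then show ?thesis unfolding qpaths_iff by (auto simp: awalk_def intro: awlast_in_verts[unfolded awalk_def])
    qed
    show "\<one>\<^bsub>?K\<^esub> \<otimes>\<^bsub>?K\<^esub> x = x"
    proof (rule ext, clarify)
      fix u p
      have "(\<one>\<^bsub>?K\<^esub> \<otimes>\<^bsub>?K\<^esub> x) (u,p) = (\<Sum>i\<le>length p. if i = 0 then (if u \<in> verts G then x (u,p) else 0) else 0)"
      proof -
        have "(\<one>\<^bsub>?K\<^esub> \<otimes>\<^bsub>?K\<^esub> x) (u,p) = (\<Sum>i\<le>length p.
            (if u \<in> verts G \<and> take i p = [] then 1 else 0) * x (awlast u (take i p), drop i p))"
          by (simp add: path_algebra_def)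
        also have "\<dots> = (\<Sum>i\<le>length p. if i = 0 then (if u \<in> verts G then x (u,p) else 0) else 0)"
          by (intro sum.cong) auto
        finally show ?thesis .
      qed
      also have "\<dots> = x (u,p)" using supp by (auto)
      finally show "(\<one>\<^bsub>?K\<^esub> \<otimes>\<^bsub>?K\<^esub> x) (u,p) = x (u,p)" .
    qed
    show "x \<otimes>\<^bsub>?K\<^esub> \<one>\<^bsub>?K\<^esub> = x"
    proof (rule ext, clarify)
      fix u p
      have "(x \<otimes>\<^bsub>?K\<^esub> \<one>\<^bsub>?K\<^esub>) (u,p) = (\<Sum>i\<le>length p. if i = length p then (if awlast u p \<in> verts G then x (u,p) else 0) else 0)"
      proof -
        have "(x \<otimes>\<^bsub>?K\<^esub> \<one>\<^bsub>?K\<^esub>) (u,p) = (\<Sum>i\<le>length p.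
            x (u, take i p) * (if awlast u (take i p) \<in> verts G \<and> drop i p = [] then 1 else 0))"
          by (simp add: path_algebra_def)
        also have "\<dots> = (\<Sum>i\<le>length p. if i = length p then (if awlast u p \<in> verts G then x (u,p) else 0) else 0)"
          by (intro sum.cong) auto
        finally show ?thesis .
      qed
      also have "\<dots> = x (u,p)" using supp by auto
      finally show "(x \<otimes>\<^bsub>?K\<^esub> \<one>\<^bsub>?K\<^esub>) (u,p) = x (u,p)" .
    qed
  qed (use path_algebra_mult_closed path_algebra_mult_assoc one in auto)
qed (auto simp: path_algebra_def sum.distrib algebra_simps)

lemma rmod_iso_refl:
  assumes "right_module A M" shows "rmod_iso A M M"
proof -
  interpret right_module A M by fact
  show ?thesis unfolding rmod_iso_def
    by (rule bexI[of _ "\<lambda>x\<in>carrier M. x"])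
       (auto simp: rhom_def ract_closed bij_betw_def inj_on_def)
qed

lemma rmod_iso_sym:
  assumes "right_module A M" "rmod_iso A M N" shows "rmod_iso A N M"
proof -
  interpret right_module A M by fact
  from assms obtain f where f: "f \<in> rhom A M N" and b: "bij_betw f (carrier M) (carrier N)"
    by (auto simp: rmod_iso_def)
  let ?g = "restrict (inv_into (carrier M) f) (carrier N)"
  have bg: "bij_betw ?g (carrier N) (carrier M)"
    using bij_betw_inv_into[OF b] by (subst bij_betw_cong[of _ _ "inv_into (carrier M) f"]) auto
  have gf: "\<And>x. x \<in> carrier M \<Longrightarrow> ?g (f x) = x" using b by (auto simp: bij_betw_def)
  have N: "\<exists>x\<in>carrier M. y = f x" if "y \<in> carrier N" for y using b that by (auto simp: bij_betw_def)
  have "?g \<in> rhom A N M" unfolding rhom_def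
  proof (intro CollectI conjI ballI)
    show "?g \<in> carrier N \<rightarrow>\<^sub>E carrier M" using bg bij_betwE by fastforce
    fix x y assume "x \<in> carrier N" "y \<in> carrier N"
    then obtain a b where ab: "a \<in> carrier M" "x = f a" "b \<in> carrier M" "y = f b" using N by meson
    then have "x \<oplus>\<^bsub>N\<^esub> y = f (a \<oplus>\<^bsub>M\<^esub> b)" using f by (auto simp: rhom_def)
    then show "?g (x \<oplus>\<^bsub>N\<^esub> y) = ?g x \<oplus>\<^bsub>M\<^esub> ?g y" using gf ab by (simp del: restrict_apply)
  next
    fix x r assume "x \<in> carrier N" and r: "r \<in> carrier A"
    then obtain a where ab: "a \<in> carrier M" "x = f a" using N by meson
    then have "x \<lhd>\<^bsub>N\<^esub> r = f (a \<lhd>\<^bsub>M\<^esub> r)" using f r by (auto simp: rhom_def)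
    then show "?g (x \<lhd>\<^bsub>N\<^esub> r) = ?g x \<lhd>\<^bsub>M\<^esub> r" using gf ab r ract_closed by (simp del: restrict_apply)
  qed
  with bg show ?thesis unfolding rmod_iso_def by blast
qed

lemma rmod_iso_trans:
  assumes "right_module A M" "rmod_iso A M N" "rmod_iso A N L" shows "rmod_iso A M L"
proof -
  interpret right_module A M by fact
  obtain f g where f: "f \<in> rhom A M N" "bij_betw f (carrier M) (carrier N)"
    and g: "g \<in> rhom A N L" "bij_betw g (carrier N) (carrier L)"
    using assms by (auto simp: rmod_iso_def)
  have fg: "\<And>x. x \<in> carrier M \<Longrightarrow> f x \<in> carrier N" "\<And>x. x \<in> carrier N \<Longrightarrow> g x \<in> carrier L"
    using f g by (auto simp: bij_betw_def)
  have b: "bij_betw (compose (carrier M) g f) (carrier M) (carrier L)"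
    using f(2) g(2) by (rule bij_betw_compose)
  have "compose (carrier M) g f \<in> rhom A M L"
    using f(1) g(1) fg ract_closed by (auto simp: rhom_def compose_def)
  with b show ?thesis unfolding rmod_iso_def by blast
qed

lemma indec_GP_representatives_exist: "\<exists>\<G>. indec_GP_representatives A \<G>"
proof -
  define rep where "rep M = (SOME G. G \<in> indec_GP A \<and> rmod_iso A M G)" for M :: "('a, nat \<Rightarrow> 'a) rmodule"
  have mod: "right_module A M" if "M \<in> indec_GP A" for M
    using that by (simp add: indec_GP_def indecomposable_def)
  have rep: "rep M \<in> indec_GP A \<and> rmod_iso A M (rep M)" if "M \<in> indec_GP A" for M
    unfolding rep_def by (rule someI[of _ M]) (use that mod rmod_iso_refl in auto)
  have rep_eq: "rep M = rep N" if "M \<in> indec_GP A" "N \<in> indec_GP A" "rmod_iso A M N" for M N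
  proof -
    have "(\<lambda>G. G \<in> indec_GP A \<and> rmod_iso A M G) = (\<lambda>G. G \<in> indec_GP A \<and> rmod_iso A N G)"
    proof (rule ext)
      fix G
      have "rmod_iso A N M" using rmod_iso_sym mod that by metis
      then show "(G \<in> indec_GP A \<and> rmod_iso A M G) = (G \<in> indec_GP A \<and> rmod_iso A N G)"
        using rmod_iso_trans[OF mod[OF that(1)] that(3), of G]
          rmod_iso_trans[OF mod[OF that(1)] that(3), of G]
          rmod_iso_trans[OF mod[OF that(2)], of M G] rmod_iso_trans[OF mod[OF that(1)], of N G] that(3) by meson
    qed
    then show ?thesis by (simp add: rep_def)
  qed
  have "indec_GP_representatives A (rep ` indec_GP A)"
    unfolding indec_GP_representatives_def
  proof (intro conjI ballI ex1I)
    show "rep ` indec_GP A \<subseteq> indec_GP A" using rep by auto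
    fix M assume M: "M \<in> indec_GP A"
    show "rep M \<in> rep ` indec_GP A" "rmod_iso A M (rep M)" using M rep by auto
    fix G assume G: "G \<in> rep ` indec_GP A \<and> rmod_iso A M G"
    then obtain N where N: "N \<in> indec_GP A" "G = rep N" by auto
    have "G \<in> indec_GP A" using N rep by auto
    then show "G = rep M" using rep_eq M N rep G by metis
  qed
  then show ?thesis ..
qed



lemma ring_extend:
  assumes "ring R" shows "ring (ring.extend R X)"
proof -
  interpret ring R by fact
  have [simp]: "carrier (ring.extend R X) = carrier R" "monoid.mult (ring.extend R X) = monoid.mult R"
    "one (ring.extend R X) = one R" "zero (ring.extend R X) = zero R" "add (ring.extend R X) = add R"
    by (simp_all add: ring.defs)
  show ?thesis
    by (intro ringI abelian_groupI monoidI)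
       (auto simp: a_ac m_assoc l_distr r_distr intro: l_neg)
qed

lemma (in sag_algebra) bound_quiver_algebra_ring: "ring (bound_quiver_algebra Q I)"
proof -
  interpret K: ring "path_algebra Q :: ('k, _) module" by (rule path_algebra_ring)
  obtain Z where Z: "Z \<subseteq> qpaths Q" "I = Idl\<^bsub>path_algebra Q\<^esub> (path_vec ` Z)"
    using quadratic_monomial by blast
  have "path_vec ` Z \<subseteq> carrier (path_algebra Q :: ('k, _) module)"
    using Z(1) by (auto simp: path_vec_def path_algebra_def split: if_splits)
  then interpret ideal I "path_algebra Q" unfolding Z by (rule K.genideal_ideal)
  show ?thesis
    unfolding quotient_algebra_def by (rule ring_extend) (rule quotient_is_ring)
qed

lemma regular_right_module:
  assumes "ring A" shows "right_module A (regular_module A)"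
proof -
  interpret ring A by fact
  have "abelian_group (regular_module A)"
    by (rule abelian_groupI) (auto simp: regular_module_def a_ac intro: l_neg)
  then show ?thesis
    by (intro right_module.intro right_module_axioms.intro assms)
       (auto simp: regular_module_def m_assoc l_distr r_distr)
qed

end

theory Submission
  imports Defs
begin

text \<open>
  Of the conditions on an SAG-algebra \<open>A\<close>, only finite-dimensionality and quadratic monomial relations
  matter.  A Gorenstein-projective module \<open>M\<close> is reflexive.  If \<open>M\<close> is indecomposable and some
  homomorphism \<open>M \<rightarrow> A\<close> has a value outside the radical, then \<open>M\<close> is isomorphic to some \<open>e\<^sub>v A\<close>.
  Otherwise, for \<open>m \<in> M\<close> and an arrow \<open>c\<close>, the part of \<open>f m\<close> ending in \<open>c\<close> depends left linearly on
  \<open>f \<in> Hom\<^sub>A(M, A)\<close>, so it is \<open>f m\<^sub>c\<close> for some \<open>m\<^sub>c \<in> M\<close>.  As the homomorphisms cannot all have their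
  values in the square of the radical, some \<open>f m\<^sub>c\<close> involves the arrow \<open>c\<close> itself, and then
  \<open>m\<^sub>c\<close> generates a direct summand isomorphic to \<open>cA\<close>.  If \<open>cA\<close> is not projective, comparing syzygies
  shows that there is exactly one arrow \<open>b\<close> with \<open>cb = 0\<close>, that \<open>c\<close> is the only arrow with this property
  for \<open>b\<close>, and that \<open>bA\<close> is again a nonprojective summand of an image in the complex; so \<open>c\<close> lies on
  a perfect forbidden cycle.  Conversely, a perfect forbidden cycle gives a periodic totally exact
  complex.  So \<open>A\<close> plus the sum of the \<open>\<alpha>A\<close> is isomorphic to the sum of the representatives, and
  isomorphic modules have isomorphic endomorphism algebras.
\<close>

section \<open>Right modules\<close>

text \<open>The recurring device is that a reflexive module is recovered from its functionals: an
  additive operation on \<open>R\<close> that commutes with left multiplication on all values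
  \<open>f m\<close> is evaluation at some element of the module, so paths can be cut and shortened
  inside \<open>M\<close> itself. Shortening explains why the values cannot all lie in the square of
  the radical: removing last arrows would push them into ever higher powers, and the radical is
  nilpotent. Summands are treated as retracts, and locality is read off from a single coefficient,
  because an element of \<open>R\<close> with nonzero coefficients at all trivial paths is a unit.
  The same criterion repairs the comparison of syzygies, where lifting a retraction gives back the
  identity only up to a term in the radical. That the passage from \<open>c\<close> to
  \<open>b\<close> closes up to a cycle is finiteness: \<open>b\<close> determines \<open>c\<close>,
  so the passage is an injective map of a finite set into itself. All this needs only the
  coefficients of elements at nonzero paths, which the locale
  \<open>quadratic_monomial_algebra\<close> isolates from the quotient construction.\<close>

abbreviation dual :: "('a, 'b) ring_scheme \<Rightarrow> ('a, 'm) rmodule \<Rightarrow> ('m \<Rightarrow> 'a) set" where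
  "dual A M \<equiv> rhom A M (regular_module A)"

lemma regular_module_simps [simp]:
  "carrier (regular_module A) = carrier A" "zero (regular_module A) = zero A"
  "add (regular_module A) = add A" "ract (regular_module A) = monoid.mult A"
  by (simp_all add: regular_module_def)

lemma principal_right_ideal_simps [simp]:
  "carrier (principal_right_ideal A x) = {x \<otimes>\<^bsub>A\<^esub> a | a. a \<in> carrier A}"
  "zero (principal_right_ideal A x) = zero A"
  "add (principal_right_ideal A x) = add A" "ract (principal_right_ideal A x) = monoid.mult A"
  by (simp_all add: principal_right_ideal_def regular_module_def)

abbreviation (in ring) "rideal \<equiv> principal_right_ideal R"

lemma right_moduleI:
  assumes "ring A" "abelian_group M"
    and "\<And>m a. \<lbrakk>m \<in> carrier M; a \<in> carrier A\<rbrakk> \<Longrightarrow> m \<lhd>\<^bsub>M\<^esub> a \<in> carrier M"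
    and "\<And>m. m \<in> carrier M \<Longrightarrow> m \<lhd>\<^bsub>M\<^esub> \<one>\<^bsub>A\<^esub> = m"
    and "\<And>m a b. \<lbrakk>m \<in> carrier M; a \<in> carrier A; b \<in> carrier A\<rbrakk> \<Longrightarrow>
          m \<lhd>\<^bsub>M\<^esub> (a \<otimes>\<^bsub>A\<^esub> b) = (m \<lhd>\<^bsub>M\<^esub> a) \<lhd>\<^bsub>M\<^esub> b"
    and "\<And>m n a. \<lbrakk>m \<in> carrier M; n \<in> carrier M; a \<in> carrier A\<rbrakk> \<Longrightarrow>
          (m \<oplus>\<^bsub>M\<^esub> n) \<lhd>\<^bsub>M\<^esub> a = (m \<lhd>\<^bsub>M\<^esub> a) \<oplus>\<^bsub>M\<^esub> (n \<lhd>\<^bsub>M\<^esub> a)"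
    and "\<And>m a b. \<lbrakk>m \<in> carrier M; a \<in> carrier A; b \<in> carrier A\<rbrakk> \<Longrightarrow>
          m \<lhd>\<^bsub>M\<^esub> (a \<oplus>\<^bsub>A\<^esub> b) = (m \<lhd>\<^bsub>M\<^esub> a) \<oplus>\<^bsub>M\<^esub> (m \<lhd>\<^bsub>M\<^esub> b)"
  shows "right_module A M"
  using assms by (intro right_module.intro right_module_axioms.intro) auto

lemma (in abelian_group) eq_if_diff_zero:
  "\<lbrakk>x \<in> carrier G; y \<in> carrier G; x \<oplus> \<ominus> y = \<zero>\<rbrakk> \<Longrightarrow> x = y"
  using minus_equality[of x "\<ominus> y"] by simp

context right_module
begin

lemma ract_zero: "m \<in> carrier M \<Longrightarrow> m \<lhd>\<^bsub>M\<^esub> \<zero>\<^bsub>A\<^esub> = \<zero>\<^bsub>M\<^esub>"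
  using ract_add_right[of m "\<zero>\<^bsub>A\<^esub>" "\<zero>\<^bsub>A\<^esub>"] ract_closed[of m "\<zero>\<^bsub>A\<^esub>"]
  by (simp add: M.add.l_cancel_one')

lemma zero_ract: "a \<in> carrier A \<Longrightarrow> \<zero>\<^bsub>M\<^esub> \<lhd>\<^bsub>M\<^esub> a = \<zero>\<^bsub>M\<^esub>"
  using ract_add_left[of "\<zero>\<^bsub>M\<^esub>" "\<zero>\<^bsub>M\<^esub>" a] ract_closed[of "\<zero>\<^bsub>M\<^esub>" a]
  by (simp add: M.add.l_cancel_one')

lemma ract_minus: "\<lbrakk>m \<in> carrier M; a \<in> carrier A\<rbrakk> \<Longrightarrow> m \<lhd>\<^bsub>M\<^esub> (\<ominus>\<^bsub>A\<^esub> a) = \<ominus>\<^bsub>M\<^esub> (m \<lhd>\<^bsub>M\<^esub> a)"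
  by (rule M.minus_equality[symmetric])
     (simp_all add: ract_closed ract_zero A.l_neg flip: ract_add_right)

lemma minus_eq_ract: "m \<in> carrier M \<Longrightarrow> \<ominus>\<^bsub>M\<^esub> m = m \<lhd>\<^bsub>M\<^esub> (\<ominus>\<^bsub>A\<^esub> \<one>\<^bsub>A\<^esub>)"
  by (simp add: ract_minus ract_one)

lemma finsum_ract:
  "\<lbrakk>finite S; g \<in> S \<rightarrow> carrier M; a \<in> carrier A\<rbrakk> \<Longrightarrow> finsum M g S \<lhd>\<^bsub>M\<^esub> a = (\<Oplus>\<^bsub>M\<^esub>j\<in>S. g j \<lhd>\<^bsub>M\<^esub> a)"
proof (induction rule: finite_induct)
  case (insert s S)
  then have *: "g \<in> S \<rightarrow> carrier M" "g s \<in> carrier M" "(\<lambda>j. g j \<lhd>\<^bsub>M\<^esub> a) \<in> S \<rightarrow> carrier M"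
    by (auto intro: ract_closed)
  with insert show ?case
    by (simp add: ract_add_left ract_closed)
qed (simp add: zero_ract)

end

text \<open>Closure under negatives is automatic, because negation is the action of the ring element
  \<open>\<ominus> \<one>\<close>.\<close>

lemma right_submoduleI:
  assumes M: "right_module A M" and "U \<subseteq> carrier M" "\<zero>\<^bsub>M\<^esub> \<in> U"
    and "\<And>x y. \<lbrakk>x \<in> U; y \<in> U\<rbrakk> \<Longrightarrow> x \<oplus>\<^bsub>M\<^esub> y \<in> U"
    and ract: "\<And>x a. \<lbrakk>x \<in> U; a \<in> carrier A\<rbrakk> \<Longrightarrow> x \<lhd>\<^bsub>M\<^esub> a \<in> U"
  shows "right_submodule A M U"
proof -
  interpret right_module A M by fact
  have "\<ominus>\<^bsub>M\<^esub> x \<in> U" if "x \<in> U" for x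
    using that assms(2) ract[OF that, of "\<ominus>\<^bsub>A\<^esub> \<one>\<^bsub>A\<^esub>"] minus_eq_ract[of x] by auto
  then have "subgroup U (add_monoid M)"
    using assms by (intro M.add.subgroupI) (auto simp: a_inv_def)
  with ract show ?thesis
    by (auto simp: right_submodule_def intro: additive_subgroup.intro)
qed

lemma right_submoduleD:
  assumes "right_module A M" "right_submodule A M U"
  shows "U \<subseteq> carrier M" "\<zero>\<^bsub>M\<^esub> \<in> U" "\<And>x y. \<lbrakk>x \<in> U; y \<in> U\<rbrakk> \<Longrightarrow> x \<oplus>\<^bsub>M\<^esub> y \<in> U"
    "\<And>x a. \<lbrakk>x \<in> U; a \<in> carrier A\<rbrakk> \<Longrightarrow> x \<lhd>\<^bsub>M\<^esub> a \<in> U" "\<And>x. x \<in> U \<Longrightarrow> \<ominus>\<^bsub>M\<^esub> x \<in> U"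
proof -
  interpret right_module A M by fact
  have U: "additive_subgroup U M" and *: "\<And>x a. \<lbrakk>x \<in> U; a \<in> carrier A\<rbrakk> \<Longrightarrow> x \<lhd>\<^bsub>M\<^esub> a \<in> U"
    using assms(2) by (auto simp: right_submodule_def)
  interpret additive_subgroup U M by fact
  show "U \<subseteq> carrier M" "\<zero>\<^bsub>M\<^esub> \<in> U" "\<And>x y. \<lbrakk>x \<in> U; y \<in> U\<rbrakk> \<Longrightarrow> x \<oplus>\<^bsub>M\<^esub> y \<in> U"
    "\<And>x a. \<lbrakk>x \<in> U; a \<in> carrier A\<rbrakk> \<Longrightarrow> x \<lhd>\<^bsub>M\<^esub> a \<in> U"
    using * a_subset by auto
  show "\<ominus>\<^bsub>M\<^esub> x \<in> U" if "x \<in> U" for x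
    using that a_subset *[OF that, of "\<ominus>\<^bsub>A\<^esub> \<one>\<^bsub>A\<^esub>"] minus_eq_ract[of x] by auto
qed

lemma submodule_right_module:
  assumes "right_module A M" "right_submodule A M U"
  shows "right_module A (M\<lparr>carrier := U\<rparr>)"
proof -
  interpret right_module A M by fact
  show ?thesis
  proof (rule right_moduleI)
    note U = right_submoduleD[OF assms]
    have *: "x \<in> carrier M" if "x \<in> U" for x using that U by auto
    show "abelian_group (M\<lparr>carrier := U\<rparr>)"
    proof (rule abelian_groupI)
      fix x assume "x \<in> carrier (M\<lparr>carrier := U\<rparr>)"
      then show "\<exists>y\<in>carrier (M\<lparr>carrier := U\<rparr>). y \<oplus>\<^bsub>M\<lparr>carrier := U\<rparr>\<^esub> x = \<zero>\<^bsub>M\<lparr>carrier := U\<rparr>\<^esub>"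
        using U by (auto simp: * M.l_neg intro!: bexI[of _ "\<ominus>\<^bsub>M\<^esub> x"])
    qed (auto simp: U M.a_ac *)
  qed (use right_submoduleD(1,4)[OF assms] in \<open>auto simp: A.ring_axioms ract_one ract_mult ract_add_left ract_add_right subset_iff\<close>)
qed

lemma rhomD:
  assumes "f \<in> rhom A M N"
  shows "\<And>x. x \<in> carrier M \<Longrightarrow> f x \<in> carrier N"
    "\<And>x y. \<lbrakk>x \<in> carrier M; y \<in> carrier M\<rbrakk> \<Longrightarrow> f (x \<oplus>\<^bsub>M\<^esub> y) = f x \<oplus>\<^bsub>N\<^esub> f y"
    "\<And>x a. \<lbrakk>x \<in> carrier M; a \<in> carrier A\<rbrakk> \<Longrightarrow> f (x \<lhd>\<^bsub>M\<^esub> a) = f x \<lhd>\<^bsub>N\<^esub> a"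
  using assms by (auto simp: rhom_def)

lemma rhom_ext:
  assumes "f \<in> rhom A M N" "g \<in> rhom A M L" "\<And>x. x \<in> carrier M \<Longrightarrow> f x = g x"
  shows "f = g"
  by (rule extensionalityI[of f "carrier M" g]) (use assms in \<open>auto simp: rhom_def PiE_def\<close>)

lemma rhomI:
  assumes "right_module A M"
    and "\<And>x. x \<in> carrier M \<Longrightarrow> f x \<in> carrier N"
    and "\<And>x y. \<lbrakk>x \<in> carrier M; y \<in> carrier M\<rbrakk> \<Longrightarrow> f (x \<oplus>\<^bsub>M\<^esub> y) = f x \<oplus>\<^bsub>N\<^esub> f y"
    and "\<And>x a. \<lbrakk>x \<in> carrier M; a \<in> carrier A\<rbrakk> \<Longrightarrow> f (x \<lhd>\<^bsub>M\<^esub> a) = f x \<lhd>\<^bsub>N\<^esub> a"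
  shows "restrict f (carrier M) \<in> rhom A M N"
proof -
  interpret right_module A M by fact
  show ?thesis using assms(2-4) by (auto simp: rhom_def ract_closed)
qed

lemma rhom_zero:
  assumes "right_module A M" "right_module A N" "f \<in> rhom A M N"
  shows "f \<zero>\<^bsub>M\<^esub> = \<zero>\<^bsub>N\<^esub>"
proof -
  interpret M: right_module A M by fact
  interpret N: right_module A N by fact
  have "f (\<zero>\<^bsub>M\<^esub> \<lhd>\<^bsub>M\<^esub> \<zero>\<^bsub>A\<^esub>) = f \<zero>\<^bsub>M\<^esub> \<lhd>\<^bsub>N\<^esub> \<zero>\<^bsub>A\<^esub>"
    by (rule rhomD(3)[OF assms(3)]) auto
  then show ?thesis using rhomD(1)[OF assms(3), of "\<zero>\<^bsub>M\<^esub>"] by (simp add: M.zero_ract N.ract_zero)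
qed

lemma rhom_minus:
  assumes "right_module A M" "right_module A N" "f \<in> rhom A M N" "x \<in> carrier M"
  shows "f (\<ominus>\<^bsub>M\<^esub> x) = \<ominus>\<^bsub>N\<^esub> f x"
proof -
  interpret M: right_module A M by fact
  interpret N: right_module A N by fact
  show ?thesis using assms(3,4) by (simp add: M.minus_eq_ract N.minus_eq_ract rhomD)
qed

lemma rhom_compose:
  assumes "right_module A M" "f \<in> rhom A M N" "g \<in> rhom A N L"
  shows "compose (carrier M) g f \<in> rhom A M L"
  unfolding compose_def
  by (rule rhomI) (use assms in \<open>auto simp: rhomD\<close>)

lemma rhom_finsum:
  assumes "right_module A M" "right_module A N" "f \<in> rhom A M N" "finite S" "g \<in> S \<rightarrow> carrier M"
  shows "f (finsum M g S) = (\<Oplus>\<^bsub>N\<^esub>j\<in>S. f (g j))"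
proof -
  interpret M: right_module A M by fact
  interpret N: right_module A N by fact
  show ?thesis using assms(4,5)
  proof (induction rule: finite_induct)
    case (insert s S)
    then have *: "g \<in> S \<rightarrow> carrier M" "g s \<in> carrier M" "(\<lambda>j. f (g j)) \<in> S \<rightarrow> carrier N"
      using rhomD(1)[OF assms(3)] by (auto simp: Pi_iff)
    with insert show ?case
      by (simp add: rhomD[OF assms(3)])
  qed (simp add: rhom_zero[OF assms(1-3)])
qed

lemma rhom_restrict_carrier:
  "f \<in> rhom A M N \<Longrightarrow> U \<subseteq> carrier M \<Longrightarrow> right_module A (M\<lparr>carrier := U\<rparr>) \<Longrightarrow>
     restrict f U \<in> rhom A (M\<lparr>carrier := U\<rparr>) N"
  using rhomI[of A "M\<lparr>carrier := U\<rparr>" f N] by (auto simp: rhomD subset_iff)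

lemma (in ring) dual_add:
  assumes "right_module R M" "f \<in> dual R M" "g \<in> dual R M"
  shows "(\<lambda>x\<in>carrier M. f x \<oplus> g x) \<in> dual R M"
proof (rule rhomI[OF assms(1)])
  note f = rhomD[OF assms(2), simplified] and g = rhomD[OF assms(3), simplified]
  fix x y a assume "x \<in> carrier M" "y \<in> carrier M"
  then show "f (x \<oplus>\<^bsub>M\<^esub> y) \<oplus> g (x \<oplus>\<^bsub>M\<^esub> y) = (f x \<oplus> g x) \<oplus>\<^bsub>regular_module R\<^esub> (f y \<oplus> g y)"
    using f g by (simp add: a_ac)
qed (use assms in \<open>auto simp: rhomD(1)[where N = "regular_module R", simplified] rhomD(3) l_distr\<close>)

lemma (in ring) dual_left_mult:
  assumes "right_module R M" "f \<in> dual R M" "a \<in> carrier R"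
  shows "(\<lambda>x\<in>carrier M. a \<otimes> f x) \<in> dual R M"
proof (rule rhomI[OF assms(1)])
  note f = rhomD[OF assms(2), simplified]
  show "\<And>x. x \<in> carrier M \<Longrightarrow> a \<otimes> f x \<in> carrier (regular_module R)"
    "\<And>x y. x \<in> carrier M \<Longrightarrow> y \<in> carrier M \<Longrightarrow> a \<otimes> f (x \<oplus>\<^bsub>M\<^esub> y) = a \<otimes> f x \<oplus>\<^bsub>regular_module R\<^esub> a \<otimes> f y"
    "\<And>x b. x \<in> carrier M \<Longrightarrow> b \<in> carrier R \<Longrightarrow> a \<otimes> f (x \<lhd>\<^bsub>M\<^esub> b) = a \<otimes> f x \<lhd>\<^bsub>regular_module R\<^esub> b"
    using f assms(3) by (auto simp: r_distr m_assoc)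
qed

lemma (in ring) dual_finsum:
  assumes "right_module R M" "f \<in> dual R M" "finite S" "g \<in> S \<rightarrow> carrier M"
  shows "f (finsum M g S) = (\<Oplus>j\<in>S. f (g j))"
proof -
  have eq: "finsum (regular_module R) = finsum R" by (intro ext) (simp add: finsum_def finprod_def)
  show ?thesis using rhom_finsum[OF assms(1) regular_right_module[OF ring_axioms] assms(2-)] unfolding eq .
qed

lemma (in ring) right_submodule_regularI:
  assumes "U \<subseteq> carrier R" "\<zero> \<in> U" "\<And>x y. \<lbrakk>x \<in> U; y \<in> U\<rbrakk> \<Longrightarrow> x \<oplus> y \<in> U"
    "\<And>x a. \<lbrakk>x \<in> U; a \<in> carrier R\<rbrakk> \<Longrightarrow> x \<otimes> a \<in> U"
  shows "right_module R ((regular_module R)\<lparr>carrier := U\<rparr>)"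
proof -
  interpret M: right_module R "regular_module R" by (rule regular_right_module) (rule ring_axioms)
  show ?thesis by (rule submodule_right_module[OF M.right_module_axioms]) (rule right_submoduleI[OF M.right_module_axioms], use assms in auto)
qed

lemma (in ring) principal_right_module:
  assumes "x \<in> carrier R" shows "right_module R (rideal x)"
proof -
  have "right_module R ((regular_module R)\<lparr>carrier := {x \<otimes> a | a. a \<in> carrier R}\<rparr>)"
  proof (rule right_submodule_regularI; clarsimp)
    fix a assume "a \<in> carrier R" then show "x \<otimes> a \<in> carrier R" using assms by auto
  next
    show "\<exists>a. \<zero> = x \<otimes> a \<and> a \<in> carrier R" using assms by (auto intro!: exI[of _ \<zero>])
  next
    fix a b assume "a \<in> carrier R" "b \<in> carrier R"
    then show "\<exists>c. x \<otimes> a \<oplus> x \<otimes> b = x \<otimes> c \<and> c \<in> carrier R"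
      using assms by (intro exI[of _ "a \<oplus> b"]) (simp add: r_distr)
  next
    fix a b assume "a \<in> carrier R" "b \<in> carrier R"
    then show "\<exists>c. x \<otimes> a \<otimes> b = x \<otimes> c \<and> c \<in> carrier R"
      using assms by (intro exI[of _ "a \<otimes> b"]) (simp add: m_assoc)
  qed
  then show ?thesis by (simp add: principal_right_ideal_def)
qed

text \<open>The module \<open>a R\<close> is the quotient of \<open>R\<close> by the right
  annihilator of \<open>a\<close>, so \<open>a\<close> may be sent to any \<open>x\<close> that this
  annihilator kills.\<close>

lemma (in ring) principal_hom:
  assumes M: "right_module R M" and a: "a \<in> carrier R" and x: "x \<in> carrier M"
    and ann: "\<And>z. z \<in> carrier R \<Longrightarrow> a \<otimes> z = \<zero> \<Longrightarrow> x \<lhd>\<^bsub>M\<^esub> z = \<zero>\<^bsub>M\<^esub>"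
  obtains f where "f \<in> rhom R (rideal a) M" "\<And>z. z \<in> carrier R \<Longrightarrow> f (a \<otimes> z) = x \<lhd>\<^bsub>M\<^esub> z"
proof -
  interpret M: right_module R M by fact
  have wd: "x \<lhd>\<^bsub>M\<^esub> z = x \<lhd>\<^bsub>M\<^esub> z'" if "z \<in> carrier R" "z' \<in> carrier R" "a \<otimes> z = a \<otimes> z'" for z z'
  proof -
    have "a \<otimes> (z \<ominus> z') = \<zero>" using that a by (simp add: minus_eq r_distr r_minus r_neg)
    then have "x \<lhd>\<^bsub>M\<^esub> (z \<ominus> z') = \<zero>\<^bsub>M\<^esub>" using that by (intro ann) auto
    then show ?thesis
      using that x M.M.eq_if_diff_zero[of "x \<lhd>\<^bsub>M\<^esub> z" "x \<lhd>\<^bsub>M\<^esub> z'"]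
      by (simp add: minus_eq M.ract_add_right M.ract_minus M.ract_closed)
  qed
  define f where "f y = x \<lhd>\<^bsub>M\<^esub> (SOME z. z \<in> carrier R \<and> y = a \<otimes> z)" for y
  have f: "f (a \<otimes> z) = x \<lhd>\<^bsub>M\<^esub> z" if z: "z \<in> carrier R" for z
  proof -
    have *: "(SOME z'. z' \<in> carrier R \<and> a \<otimes> z = a \<otimes> z') \<in> carrier R \<and> a \<otimes> z = a \<otimes> (SOME z'. z' \<in> carrier R \<and> a \<otimes> z = a \<otimes> z')"
      by (rule someI[of "\<lambda>z'. z' \<in> carrier R \<and> a \<otimes> z = a \<otimes> z'" z]) (use z in simp)
    show ?thesis unfolding f_def by (rule wd[OF z conjunct1[OF *] conjunct2[OF *], symmetric])
  qed
  have "restrict f (carrier (rideal a)) \<in> rhom R (rideal a) M"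
  proof (rule rhomI[OF principal_right_module[OF a]])
    fix y y' r assume "y \<in> carrier (rideal a)"
    then obtain z where z: "z \<in> carrier R" "y = a \<otimes> z" by auto
    show "f y \<in> carrier M" using z x by (simp add: f M.ract_closed)
    { assume "y' \<in> carrier (rideal a)"
      then obtain z' where z': "z' \<in> carrier R" "y' = a \<otimes> z'" by auto
      have "y \<oplus> y' = a \<otimes> (z \<oplus> z')" using z z' a by (simp add: r_distr)
      then show "f (y \<oplus>\<^bsub>rideal a\<^esub> y') = f y \<oplus>\<^bsub>M\<^esub> f y'"
        using z z' x f[of "z \<oplus> z'"] f[of z] f[of z'] by (simp add: M.ract_add_right) }
    { assume r: "r \<in> carrier R"
      have "y \<otimes> r = a \<otimes> (z \<otimes> r)" using z r a by (simp add: m_assoc)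
      then show "f (y \<lhd>\<^bsub>rideal a\<^esub> r) = f y \<lhd>\<^bsub>M\<^esub> r"
        using z r x f[of "z \<otimes> r"] f[of z] by (simp add: M.ract_mult) }
  qed
  moreover have "restrict f (carrier (rideal a)) (a \<otimes> z) = x \<lhd>\<^bsub>M\<^esub> z" if "z \<in> carrier R" for z
    using f[OF that] that by auto
  ultimately show ?thesis using that by blast
qed

section \<open>Retracts\<close>

text \<open>This says that \<open>N\<close> is isomorphic to a direct summand of \<open>M\<close>.
  No complement is named and the element types may differ, so retracts transport easily along
  isomorphisms and maps.\<close>

definition retract :: "('a, 'b) ring_scheme \<Rightarrow> ('a, 'n) rmodule \<Rightarrow> ('a, 'm) rmodule \<Rightarrow> bool" where
  "retract A N M \<longleftrightarrow> (\<exists>i\<in>rhom A N M. \<exists>r\<in>rhom A M N. \<forall>x\<in>carrier N. r (i x) = x)"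

lemma rmod_iso_inverse:
  assumes "right_module A M" "rmod_iso A M N"
  obtains f g where "f \<in> rhom A M N" "g \<in> rhom A N M"
    "\<And>x. x \<in> carrier M \<Longrightarrow> g (f x) = x" "\<And>y. y \<in> carrier N \<Longrightarrow> f (g y) = y"
proof -
  interpret right_module A M by fact
  from assms(2) obtain f where f: "f \<in> rhom A M N" and b: "bij_betw f (carrier M) (carrier N)"
    by (auto simp: rmod_iso_def)
  let ?g = "restrict (inv_into (carrier M) f) (carrier N)"
  have gf: "?g (f x) = x" if "x \<in> carrier M" for x using b that by (auto simp: bij_betw_def)
  have fg: "f (?g y) = y" "?g y \<in> carrier M" if "y \<in> carrier N" for y
    using b that by (auto simp: bij_betw_def f_inv_into_f inv_into_into)
  have "?g \<in> rhom A N M"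
    unfolding rhom_def
  proof (intro CollectI conjI ballI)
    show "?g \<in> carrier N \<rightarrow>\<^sub>E carrier M" using fg by auto
  next
    fix x y assume xy: "x \<in> carrier N" "y \<in> carrier N"
    have "f (?g x \<oplus>\<^bsub>M\<^esub> ?g y) = x \<oplus>\<^bsub>N\<^esub> y"
      using xy fg by (simp add: rhomD[OF f] del: restrict_apply)
    then show "?g (x \<oplus>\<^bsub>N\<^esub> y) = ?g x \<oplus>\<^bsub>M\<^esub> ?g y"
      using gf[of "?g x \<oplus>\<^bsub>M\<^esub> ?g y"] fg(2)[OF xy(1)] fg(2)[OF xy(2)] by (simp del: restrict_apply)
  next
    fix x a assume xy: "x \<in> carrier N" "a \<in> carrier A"
    have "f (?g x \<lhd>\<^bsub>M\<^esub> a) = x \<lhd>\<^bsub>N\<^esub> a"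
      using xy fg by (simp add: rhomD[OF f] del: restrict_apply)
    then show "?g (x \<lhd>\<^bsub>N\<^esub> a) = ?g x \<lhd>\<^bsub>M\<^esub> a"
      using gf[of "?g x \<lhd>\<^bsub>M\<^esub> a"] fg(2)[OF xy(1)] xy by (simp add: ract_closed del: restrict_apply)
  qed
  with f gf fg(1) show ?thesis using that by blast
qed

lemma rmod_isoI:
  assumes "f \<in> rhom A M N" "g \<in> rhom A N M"
    "\<And>x. x \<in> carrier M \<Longrightarrow> g (f x) = x" "\<And>y. y \<in> carrier N \<Longrightarrow> f (g y) = y"
  shows "rmod_iso A M N"
  unfolding rmod_iso_def
proof (rule bexI[OF _ assms(1)])
  show "bij_betw f (carrier M) (carrier N)"
    by (rule bij_betw_byWitness[of _ g]) (use assms in \<open>auto simp: rhomD\<close>)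
qed

lemma rmod_iso_retract:
  assumes "right_module A M" "rmod_iso A M N" shows "retract A N M"
  using rmod_iso_inverse[OF assms] unfolding retract_def by metis

lemma submodule_finsum:
  assumes M: "right_module A M" and V: "right_submodule A M V" and "finite S" "h \<in> S \<rightarrow> V"
  shows "finsum M h S \<in> V"
proof -
  interpret right_module A M by fact
  note V' = right_submoduleD[OF M V]
  show ?thesis using assms(3,4)
  proof (induction rule: finite_induct)
    case (insert s S)
    moreover have "h \<in> S \<rightarrow> carrier M" "h s \<in> carrier M" using insert.prems V'(1) by auto
    ultimately show ?case using V'(3) by simp
  qed (use V'(2) in simp)
qed

text \<open>\<open>M\<close> is the direct sum of the image of \<open>i\<close> and the kernel of
  \<open>r\<close>. The image is nonzero because \<open>N\<close> is, so the kernel vanishes and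
  \<open>r\<close> is an isomorphism.\<close>

lemma indecomposable_retract:
  assumes "indecomposable A M" "right_module A N" "carrier N \<noteq> {\<zero>\<^bsub>N\<^esub>}" "retract A N M"
  shows "rmod_iso A M N"
proof -
  have M: "right_module A M" using assms(1) by (simp add: indecomposable_def)
  interpret M: right_module A M by fact
  interpret N: right_module A N by fact
  obtain i r where i: "i \<in> rhom A N M" and r: "r \<in> rhom A M N" and ri: "\<And>x. x \<in> carrier N \<Longrightarrow> r (i x) = x"
    using assms(4) by (auto simp: retract_def)
  note i' = rhomD[OF i] and r' = rhomD[OF r]
  note i0 = rhom_zero[OF N.right_module_axioms M i] and r0 = rhom_zero[OF M N.right_module_axioms r]
  let ?U = "i ` carrier N" and ?W = "{x \<in> carrier M. r x = \<zero>\<^bsub>N\<^esub>}"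
  have zU: "\<zero>\<^bsub>M\<^esub> \<in> ?U" using i0 by (metis N.M.zero_closed imageI)
  have U: "right_submodule A M ?U"
    by (rule right_submoduleI[OF M]) (use zU in \<open>auto simp: i' N.ract_closed simp flip: i'(2,3)\<close>)
  have W: "right_submodule A M ?W"
    by (rule right_submoduleI[OF M]) (auto simp: r' r0 M.ract_closed N.zero_ract)
  have "x \<in> ?U <+>\<^bsub>M\<^esub> ?W" if x: "x \<in> carrier M" for x
  proof -
    have "r (x \<ominus>\<^bsub>M\<^esub> i (r x)) = \<zero>\<^bsub>N\<^esub>"
      using x by (simp add: M.minus_eq r' i' rhom_minus[OF M N.right_module_axioms r] ri N.r_neg)
    moreover have "x = i (r x) \<oplus>\<^bsub>M\<^esub> (x \<ominus>\<^bsub>M\<^esub> i (r x))"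
      using x by (simp add: M.minus_eq r' i' M.a_lcomm M.r_neg)
    ultimately have "\<exists>u\<in>?U. \<exists>w\<in>?W. x = u \<oplus>\<^bsub>M\<^esub> w"
      using x i'(1) r'(1) by (intro bexI[of _ "i (r x)"] bexI[of _ "x \<ominus>\<^bsub>M\<^esub> i (r x)"]) auto
    then show ?thesis unfolding set_add_def' by blast
  qed
  moreover have "?U <+>\<^bsub>M\<^esub> ?W \<subseteq> carrier M" using i' by (auto simp: set_add_def')
  ultimately have "internal_direct_sum A M ?U ?W"
    unfolding internal_direct_sum_def using U W i'(1) ri zU r0 by auto
  then have "?U = {\<zero>\<^bsub>M\<^esub>} \<or> ?W = {\<zero>\<^bsub>M\<^esub>}" using assms(1) unfolding indecomposable_def by blast
  moreover have "?U \<noteq> {\<zero>\<^bsub>M\<^esub>}"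
  proof
    assume *: "?U = {\<zero>\<^bsub>M\<^esub>}"
    have "x = \<zero>\<^bsub>N\<^esub>" if "x \<in> carrier N" for x
      using ri[OF that] that * r0 by (metis imageI singletonD)
    with assms(3) show False by auto
  qed
  ultimately have W0: "?W = {\<zero>\<^bsub>M\<^esub>}" by blast
  show ?thesis
  proof (rule rmod_isoI[OF r i _ ri])
    fix x assume x: "x \<in> carrier M"
    have "r (x \<ominus>\<^bsub>M\<^esub> i (r x)) = \<zero>\<^bsub>N\<^esub>"
      using x by (simp add: M.minus_eq r' i' rhom_minus[OF M N.right_module_axioms r] ri N.r_neg)
    then have "x \<ominus>\<^bsub>M\<^esub> i (r x) \<in> ?W" using x i'(1) r'(1) by simp
    then have "x \<ominus>\<^bsub>M\<^esub> i (r x) = \<zero>\<^bsub>M\<^esub>" unfolding W0 by simp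
    then show "i (r x) = x" using x i'(1) r'(1) M.eq_if_diff_zero[of x "i (r x)"] by (simp add: M.minus_eq)
  qed
qed

text \<open>The section sends \<open>a\<close> to \<open>x\<close>, and \<open>f\<close> is the
  retraction since it sends \<open>x\<close> back to \<open>a\<close>. In this form summands are
  detected by one element and one functional.\<close>

lemma (in ring) principal_retract:
  assumes M: "right_module R M" and a: "a \<in> carrier R" and x: "x \<in> carrier M"
    and ann: "\<And>z. z \<in> carrier R \<Longrightarrow> a \<otimes> z = \<zero> \<Longrightarrow> x \<lhd>\<^bsub>M\<^esub> z = \<zero>\<^bsub>M\<^esub>"
    and f: "f \<in> dual R M" and fM: "\<And>m. m \<in> carrier M \<Longrightarrow> f m \<in> carrier (rideal a)" and fx: "f x = a"
  shows "retract R (rideal a) M"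
proof -
  obtain g where g: "g \<in> rhom R (rideal a) M" "\<And>z. z \<in> carrier R \<Longrightarrow> g (a \<otimes> z) = x \<lhd>\<^bsub>M\<^esub> z"
    using principal_hom[OF M a x ann] by blast
  have "f \<in> rhom R M (rideal a)"
    using f fM by (auto simp: rhom_def)
  moreover have "f (g y) = y" if "y \<in> carrier (rideal a)" for y
    using that g(2) x rhomD(3)[OF f x] fx by auto
  ultimately show ?thesis unfolding retract_def using g(1) by blast
qed

section \<open>Dual bases and reflexive modules\<close>

text \<open>This is the coordinate system of the dual basis lemma, which characterizes finitely
  generated projective modules. It replaces embeddings into free modules: both lifting and
  reflexivity follow from explicit sums.\<close>

definition dual_basis ::
  "('a, 'b) ring_scheme \<Rightarrow> ('a, 'm) rmodule \<Rightarrow> nat \<Rightarrow> (nat \<Rightarrow> 'm) \<Rightarrow> (nat \<Rightarrow> 'm \<Rightarrow> 'a) \<Rightarrow> bool" where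
  "dual_basis A P n x f \<longleftrightarrow> x \<in> {..<n} \<rightarrow> carrier P \<and> f \<in> {..<n} \<rightarrow> dual A P \<and>
     (\<forall>p\<in>carrier P. p = (\<Oplus>\<^bsub>P\<^esub>j\<in>{..<n}. x j \<lhd>\<^bsub>P\<^esub> f j p))"

text \<open>An element of the double dual, where the dual is a left module by multiplication on
  values. Values of \<open>\<rho>\<close> away from \<open>dual A M\<close> are left open.\<close>

definition left_linear :: "('a, 'b) ring_scheme \<Rightarrow> ('a, 'm) rmodule \<Rightarrow> (('m \<Rightarrow> 'a) \<Rightarrow> 'a) \<Rightarrow> bool" where
  "left_linear A M \<rho> \<longleftrightarrow> \<rho> \<in> dual A M \<rightarrow> carrier A \<and>
     (\<forall>f\<in>dual A M. \<forall>g\<in>dual A M. \<rho> (\<lambda>x\<in>carrier M. f x \<oplus>\<^bsub>A\<^esub> g x) = \<rho> f \<oplus>\<^bsub>A\<^esub> \<rho> g) \<and>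
     (\<forall>a\<in>carrier A. \<forall>f\<in>dual A M. \<rho> (\<lambda>x\<in>carrier M. a \<otimes>\<^bsub>A\<^esub> f x) = a \<otimes>\<^bsub>A\<^esub> \<rho> f)"

text \<open>The two clauses are injectivity and surjectivity of the evaluation map from
  \<open>M\<close> to its double dual.\<close>

definition reflexive :: "('a, 'b) ring_scheme \<Rightarrow> ('a, 'm) rmodule \<Rightarrow> bool" where
  "reflexive A M \<longleftrightarrow> (\<forall>x\<in>carrier M. (\<forall>f\<in>dual A M. f x = \<zero>\<^bsub>A\<^esub>) \<longrightarrow> x = \<zero>\<^bsub>M\<^esub>) \<and>
     (\<forall>\<rho>. left_linear A M \<rho> \<longrightarrow> (\<exists>x\<in>carrier M. \<forall>f\<in>dual A M. \<rho> f = f x))"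

lemma direct_sum_simps [simp]:
  "zero (direct_sum J M) = (\<lambda>i\<in>J. \<zero>\<^bsub>M i\<^esub>)"
  "add (direct_sum J M) = (\<lambda>x y. \<lambda>i\<in>J. x i \<oplus>\<^bsub>M i\<^esub> y i)"
  "ract (direct_sum J M) = (\<lambda>x a. \<lambda>i\<in>J. x i \<lhd>\<^bsub>M i\<^esub> a)"
  by (simp_all add: direct_sum_def)

lemma carrier_direct_sum_finite:
  "finite J \<Longrightarrow> carrier (direct_sum J M) = (\<Pi>\<^sub>E i\<in>J. carrier (M i))"
  by (auto simp: direct_sum_def)

lemma direct_sum_right_module:
  assumes "ring A" "finite J" "\<And>j. j \<in> J \<Longrightarrow> right_module A (M j)"
  shows "right_module A (direct_sum J M)"
proof (rule right_moduleI[OF assms(1)])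
  note mod = assms(3)
  have ab: "abelian_group (M j)" if "j \<in> J" for j
    using mod[OF that] by (simp add: right_module_def)
  note [simp] = carrier_direct_sum_finite[OF assms(2)]
  note ag = abelian_group.axioms[OF ab]
  note [simp] = abelian_monoid.a_closed[OF ag(1)] abelian_monoid.zero_closed[OF ag(1)]
  show "abelian_group (direct_sum J M)"
  proof (rule abelian_groupI)
    fix x y z
    assume x: "x \<in> carrier (direct_sum J M)"
    then have x': "x j \<in> carrier (M j)" if "j \<in> J" for j using that by auto
    { assume y: "y \<in> carrier (direct_sum J M)"
      then have y': "y j \<in> carrier (M j)" if "j \<in> J" for j using that by auto
      show "x \<oplus>\<^bsub>direct_sum J M\<^esub> y \<in> carrier (direct_sum J M)" using x' y' by simp
      show "x \<oplus>\<^bsub>direct_sum J M\<^esub> y = y \<oplus>\<^bsub>direct_sum J M\<^esub> x"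
        using x' y' by (auto intro!: restrict_ext abelian_monoid.a_comm[OF ag(1)])
      { assume z: "z \<in> carrier (direct_sum J M)"
        then have z': "z j \<in> carrier (M j)" if "j \<in> J" for j using that by auto
        show "x \<oplus>\<^bsub>direct_sum J M\<^esub> y \<oplus>\<^bsub>direct_sum J M\<^esub> z = x \<oplus>\<^bsub>direct_sum J M\<^esub> (y \<oplus>\<^bsub>direct_sum J M\<^esub> z)"
          using x' y' z' by (auto intro!: restrict_ext abelian_monoid.a_assoc[OF ag(1)]) } }
    show "\<zero>\<^bsub>direct_sum J M\<^esub> \<oplus>\<^bsub>direct_sum J M\<^esub> x = x"
      using x by (auto intro!: extensionalityI[of _ J] simp: PiE_def x' abelian_monoid.l_zero[OF ag(1)])
    show "\<exists>y\<in>carrier (direct_sum J M). y \<oplus>\<^bsub>direct_sum J M\<^esub> x = \<zero>\<^bsub>direct_sum J M\<^esub>"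
      by (rule bexI[of _ "\<lambda>j\<in>J. \<ominus>\<^bsub>M j\<^esub> x j"])
         (auto intro!: restrict_ext simp: x' abelian_group.l_neg[OF ab] abelian_group.a_inv_closed[OF ab])
  qed simp
qed (auto intro!: restrict_ext extensionalityI[of _ J]
  simp: PiE_def Pi_iff carrier_direct_sum_finite[OF assms(2)] right_module.ract_closed[OF assms(3)]
    right_module.ract_one[OF assms(3)] right_module.ract_mult[OF assms(3)]
    right_module.ract_add_left[OF assms(3)] right_module.ract_add_right[OF assms(3)])

context ring
begin

lemma free_dual_basis:
  fixes n :: nat
  defines "F \<equiv> direct_sum {..<n} (\<lambda>_. regular_module R)"
  obtains x f where "dual_basis R F n x f"
proof -
  have F: "right_module R F"
    unfolding F_def by (intro direct_sum_right_module ring_axioms regular_right_module) auto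
  interpret F: right_module R F by fact
  have carF: "carrier F = {..<n} \<rightarrow>\<^sub>E carrier R" by (simp add: F_def carrier_direct_sum_finite)
  define x where "x j = (\<lambda>k\<in>{..<n}. if k = j then \<one> else \<zero>)" for j
  define f where "f j = (\<lambda>p\<in>carrier F. p j)" for j
  have x: "x j \<in> carrier F" for j by (auto simp: x_def carF)
  have f: "f j \<in> dual R F" if "j < n" for j
    unfolding f_def by (rule rhomI[OF F]) (use that in \<open>auto simp: carF[unfolded F_def] F_def\<close>)
  have "p = (\<Oplus>\<^bsub>F\<^esub>j\<in>{..<n}. x j \<lhd>\<^bsub>F\<^esub> f j p)" if p: "p \<in> carrier F" for p
  proof -
    have pc: "p j \<in> carrier R" if "j < n" for j
      using p that unfolding carF by (auto dest: PiE_mem)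
    have c: "x j \<lhd>\<^bsub>F\<^esub> f j p \<in> carrier F" if "j < n" for j
      using p x rhomD(1)[OF f[OF that] p] by (simp add: F.ract_closed)
    then have s: "(\<Oplus>\<^bsub>F\<^esub>j\<in>{..<n}. x j \<lhd>\<^bsub>F\<^esub> f j p) \<in> carrier F"
      by (intro F.M.finsum_closed Pi_I) simp
    show ?thesis
    proof (rule extensionalityI[of _ "{..<n}"])
      show "p \<in> extensional {..<n}" "(\<Oplus>\<^bsub>F\<^esub>j\<in>{..<n}. x j \<lhd>\<^bsub>F\<^esub> f j p) \<in> extensional {..<n}"
        using p s unfolding carF by (simp_all add: PiE_def)
      fix k assume "k \<in> {..<n}"
      then have k: "k < n" by simp
      have "f k (\<Oplus>\<^bsub>F\<^esub>j\<in>{..<n}. x j \<lhd>\<^bsub>F\<^esub> f j p)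
          = (\<Oplus>j\<in>{..<n}. f k (x j \<lhd>\<^bsub>F\<^esub> f j p))"
        by (rule dual_finsum[OF F f[OF k]]) (use c in auto)
      also have "\<dots> = (\<Oplus>j\<in>{..<n}. if k = j then p j else \<zero>)"
      proof (rule finsum_cong')
        fix j assume j: "j \<in> {..<n}"
        have "f k (x j \<lhd>\<^bsub>F\<^esub> f j p) = x j k \<otimes> p j"
          using c[of j] j k p by (simp add: f_def) (simp add: F_def)
        then show "f k (x j \<lhd>\<^bsub>F\<^esub> f j p) = (if k = j then p j else \<zero>)"
          using j k pc[of j] by (auto simp: x_def)
      qed (use pc in auto)
      also have "\<dots> = p k" using finsum_singleton[of k "{..<n}" p] k pc by (simp add: Pi_iff)
      finally show "p k = (\<Oplus>\<^bsub>F\<^esub>j\<in>{..<n}. x j \<lhd>\<^bsub>F\<^esub> f j p) k"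
        using s by (simp add: f_def)
    qed
  qed
  with x f have "dual_basis R F n x f" by (auto simp: dual_basis_def)
  with that show ?thesis by blast
qed

lemma retract_dual_basis:
  assumes "right_module R P" "right_module R F" "retract R P F" "dual_basis R F n x f"
  obtains y g where "dual_basis R P n y g"
proof -
  interpret P: right_module R P by fact
  interpret F: right_module R F by fact
  from assms(3) obtain i r where i: "i \<in> rhom R P F" and r: "r \<in> rhom R F P"
    and ri: "\<And>x. x \<in> carrier P \<Longrightarrow> r (i x) = x" by (auto simp: retract_def)
  from assms(4) have x: "\<And>j. j < n \<Longrightarrow> x j \<in> carrier F" and f: "\<And>j. j < n \<Longrightarrow> f j \<in> dual R F"
    and xf: "\<And>p. p \<in> carrier F \<Longrightarrow> p = (\<Oplus>\<^bsub>F\<^esub>j\<in>{..<n}. x j \<lhd>\<^bsub>F\<^esub> f j p)"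
    by (auto simp: dual_basis_def)
  have fc: "f j p \<in> carrier R" if "j < n" "p \<in> carrier F" for j p
    using rhomD(1)[OF f] that by simp
  have "dual_basis R P n (\<lambda>j. r (x j)) (\<lambda>j. compose (carrier P) (f j) i)"
    unfolding dual_basis_def
  proof (intro conjI ballI)
    show "(\<lambda>j. r (x j)) \<in> {..<n} \<rightarrow> carrier P" using x rhomD(1)[OF r] by auto
    show "(\<lambda>j. compose (carrier P) (f j) i) \<in> {..<n} \<rightarrow> dual R P"
      using rhom_compose[OF assms(1) i f] by auto
    fix p assume p: "p \<in> carrier P"
    have ip: "i p \<in> carrier F" using rhomD(1)[OF i p] .
    have "p = r (i p)" using ri p by simp
    also have "\<dots> = r (\<Oplus>\<^bsub>F\<^esub>j\<in>{..<n}. x j \<lhd>\<^bsub>F\<^esub> f j (i p))" using xf[OF ip] by simp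
    also have "\<dots> = (\<Oplus>\<^bsub>P\<^esub>j\<in>{..<n}. r (x j \<lhd>\<^bsub>F\<^esub> f j (i p)))"
      by (rule rhom_finsum[OF assms(2,1) r]) (auto intro: F.ract_closed x fc ip)
    also have "\<dots> = (\<Oplus>\<^bsub>P\<^esub>j\<in>{..<n}. r (x j) \<lhd>\<^bsub>P\<^esub> compose (carrier P) (f j) i p)"
      by (rule P.M.finsum_cong') 
         (auto simp: compose_def p x fc ip rhomD(1)[OF r] rhomD(3)[OF r] intro!: P.ract_closed)
    finally show "p = (\<Oplus>\<^bsub>P\<^esub>j\<in>{..<n}. r (x j) \<lhd>\<^bsub>P\<^esub> compose (carrier P) (f j) i p)" .
  qed
  with that show ?thesis by blast
qed

text \<open>The new generators \<open>y j\<close> are the \<open>U\<close>-components of the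
  \<open>x j\<close>. For \<open>p\<close> in \<open>U\<close> the \<open>W\<close>-components sum
  to an element of \<open>U \<inter> W\<close>, hence to zero.\<close>

lemma direct_summand_dual_basis:
  assumes F: "right_module R F" and db: "dual_basis R F n x f" and sum: "internal_direct_sum R F U W"
  obtains y g where "dual_basis R (F\<lparr>carrier := U\<rparr>) n y g"
proof -
  interpret F: right_module R F by fact
  let ?F = "F\<lparr>carrier := U\<rparr>"
  have U: "right_submodule R F U" and W: "right_submodule R F W"
    and UW: "U <+>\<^bsub>F\<^esub> W = carrier F" "U \<inter> W = {\<zero>\<^bsub>F\<^esub>}"
    using sum by (auto simp: internal_direct_sum_def)
  note U' = right_submoduleD[OF F U] and W' = right_submoduleD[OF F W] and modU = submodule_right_module[OF F U]
  from db have x: "\<And>j. j < n \<Longrightarrow> x j \<in> carrier F" and f: "\<And>j. j < n \<Longrightarrow> f j \<in> dual R F"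
    and xf: "\<And>p. p \<in> carrier F \<Longrightarrow> p = (\<Oplus>\<^bsub>F\<^esub>j\<in>{..<n}. x j \<lhd>\<^bsub>F\<^esub> f j p)"
    by (auto simp: dual_basis_def)
  have "\<exists>u w. u \<in> U \<and> w \<in> W \<and> x j = u \<oplus>\<^bsub>F\<^esub> w" if "j < n" for j
  proof -
    have "x j \<in> U <+>\<^bsub>F\<^esub> W" unfolding UW(1) by (rule x[OF that])
    then show ?thesis by (auto simp: set_add_def')
  qed
  then obtain y w where y: "\<And>j. j < n \<Longrightarrow> y j \<in> U" and w: "\<And>j. j < n \<Longrightarrow> w j \<in> W"
    and xyw: "\<And>j. j < n \<Longrightarrow> x j = y j \<oplus>\<^bsub>F\<^esub> w j" by metis
  have incl: "restrict (\<lambda>p. p) (carrier ?F) \<in> rhom R ?F F" by (rule rhomI[OF modU]) (use U'(1) in auto)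
  have "p = (\<Oplus>\<^bsub>?F\<^esub>j\<in>{..<n}. y j \<lhd>\<^bsub>F\<^esub> f j p)" if p: "p \<in> U" for p
  proof -
    have pF: "p \<in> carrier F" using p U'(1) by blast
    have fp: "f j p \<in> carrier R" if "j < n" for j using rhomD(1)[OF f[OF that] pF] by simp
    have c: "y j \<lhd>\<^bsub>F\<^esub> f j p \<in> U" "w j \<lhd>\<^bsub>F\<^esub> f j p \<in> W" if "j < n" for j
      using U'(4)[OF y fp] W'(4)[OF w fp] that by blast+
    have cF: "y j \<in> carrier F" "w j \<in> carrier F" "y j \<lhd>\<^bsub>F\<^esub> f j p \<in> carrier F" "w j \<lhd>\<^bsub>F\<^esub> f j p \<in> carrier F"
      if "j < n" for j using that y w c U'(1) W'(1) by blast+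
    let ?s = "\<Oplus>\<^bsub>F\<^esub>j\<in>{..<n}. y j \<lhd>\<^bsub>F\<^esub> f j p" and ?t = "\<Oplus>\<^bsub>F\<^esub>j\<in>{..<n}. w j \<lhd>\<^bsub>F\<^esub> f j p"
    have s: "?s \<in> U" by (rule submodule_finsum[OF F U]) (use c in auto)
    have t: "?t \<in> W" by (rule submodule_finsum[OF F W]) (use c in auto)
    have st: "?s \<in> carrier F" "?t \<in> carrier F" using s t U'(1) W'(1) by auto
    have "(\<Oplus>\<^bsub>F\<^esub>j\<in>{..<n}. x j \<lhd>\<^bsub>F\<^esub> f j p) = (\<Oplus>\<^bsub>F\<^esub>j\<in>{..<n}. y j \<lhd>\<^bsub>F\<^esub> f j p \<oplus>\<^bsub>F\<^esub> w j \<lhd>\<^bsub>F\<^esub> f j p)"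
      by (rule F.M.finsum_cong') (auto simp: xyw cF fp F.ract_add_left)
    also have "\<dots> = ?s \<oplus>\<^bsub>F\<^esub> ?t" by (rule F.M.finsum_addf) (use cF in auto)
    finally have p_eq: "p = ?s \<oplus>\<^bsub>F\<^esub> ?t" using xf[OF pF] by simp
    have "?t = p \<oplus>\<^bsub>F\<^esub> \<ominus>\<^bsub>F\<^esub> ?s" using st by (subst p_eq) (simp add: F.M.a_ac F.M.r_neg)
    then have "?t \<in> U" using U'(3)[OF p U'(5)[OF s]] by metis
    then have "?t = \<zero>\<^bsub>F\<^esub>" using t UW(2) by blast
    then have "p = ?s" using p_eq st by simp
    \<comment> \<open>A sum in the submodule record is a different term from the sum in
      \<open>F\<close>; applying the inclusion homomorphism identifies the two.\<close>
    also have "\<dots> = restrict (\<lambda>p. p) (carrier ?F) (\<Oplus>\<^bsub>?F\<^esub>j\<in>{..<n}. y j \<lhd>\<^bsub>F\<^esub> f j p)"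
      by (subst rhom_finsum[OF modU F incl]) (use c cF in \<open>auto intro!: F.M.finsum_cong'\<close>)
    also have "\<dots> = (\<Oplus>\<^bsub>?F\<^esub>j\<in>{..<n}. y j \<lhd>\<^bsub>F\<^esub> f j p)"
      using abelian_monoid.finsum_closed[of ?F "\<lambda>j. y j \<lhd>\<^bsub>F\<^esub> f j p" "{..<n}"] modU c
      by (simp add: right_module_def abelian_group_def Pi_iff)
    finally show ?thesis .
  qed
  moreover have "restrict (f j) U \<in> dual R ?F" if "j < n" for j
    by (rule rhom_restrict_carrier[OF f[OF that] U'(1) modU])
  ultimately have "dual_basis R ?F n y (\<lambda>j. restrict (f j) U)"
    using y by (auto simp: dual_basis_def)
  with that show ?thesis by blast
qed

lemma fg_projective_dual_basis:
  assumes "fg_projective R P"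
  obtains n x f where "dual_basis R P n x f"
proof -
  from assms obtain n U W where P: "right_module R P"
    and UW: "internal_direct_sum R (direct_sum {..<n::nat} (\<lambda>_. regular_module R)) U W"
    and iso: "rmod_iso R P ((direct_sum {..<n} (\<lambda>_. regular_module R))\<lparr>carrier := U\<rparr>)"
    by (auto simp: fg_projective_def Let_def)
  let ?F = "direct_sum {..<n} (\<lambda>_. regular_module R)"
  have F: "right_module R ?F"
    by (intro direct_sum_right_module ring_axioms regular_right_module) auto
  have U: "right_module R (?F\<lparr>carrier := U\<rparr>)"
    using submodule_right_module[OF F] UW by (simp add: internal_direct_sum_def)
  obtain x f where "dual_basis R ?F n x f" by (rule free_dual_basis)
  then obtain y g where "dual_basis R (?F\<lparr>carrier := U\<rparr>) n y g" using direct_summand_dual_basis[OF F _ UW] by blast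
  then show ?thesis
    using retract_dual_basis[OF P U rmod_iso_retract[OF U rmod_iso_sym[OF P iso]]] that by blast
qed

lemma dual_basis_hom:
  assumes P: "right_module R P" and N: "right_module R N" and db: "dual_basis R P n x f"
    and "y \<in> {..<n} \<rightarrow> carrier N"
  shows "(\<lambda>p\<in>carrier P. \<Oplus>\<^bsub>N\<^esub>j\<in>{..<n}. y j \<lhd>\<^bsub>N\<^esub> f j p) \<in> rhom R P N" (is "restrict ?s _ \<in> _")
proof -
  interpret N: right_module R N by fact
  from db have f: "\<And>j. j < n \<Longrightarrow> f j \<in> dual R P" by (auto simp: dual_basis_def)
  note f' = rhomD[OF f, simplified]
  have y: "y j \<in> carrier N" if "j < n" for j using assms(4) that by auto
  have c: "y j \<lhd>\<^bsub>N\<^esub> f j p \<in> carrier N" if "j < n" "p \<in> carrier P" for j p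
    using that by (simp add: N.ract_closed y f')
  have "?s (p \<oplus>\<^bsub>P\<^esub> q) = ?s p \<oplus>\<^bsub>N\<^esub> ?s q" if p: "p \<in> carrier P" and q: "q \<in> carrier P" for p q
  proof -
    have "?s (p \<oplus>\<^bsub>P\<^esub> q) = (\<Oplus>\<^bsub>N\<^esub>j\<in>{..<n}. y j \<lhd>\<^bsub>N\<^esub> f j p \<oplus>\<^bsub>N\<^esub> y j \<lhd>\<^bsub>N\<^esub> f j q)"
      using p q by (intro N.M.finsum_cong') (auto simp: c f' y N.ract_add_right)
    then show ?thesis using p q c by (simp add: N.M.finsum_addf Pi_iff)
  qed
  moreover have "?s p \<in> carrier N" if "p \<in> carrier P" for p
    using c that by (intro N.M.finsum_closed) auto
  moreover have "?s (p \<lhd>\<^bsub>P\<^esub> a) = ?s p \<lhd>\<^bsub>N\<^esub> a" if "p \<in> carrier P" "a \<in> carrier R" for p a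
    using that c by (subst N.finsum_ract) (auto intro!: N.M.finsum_cong' simp: c f' y N.ract_mult N.ract_closed)
  ultimately show ?thesis by (intro rhomI[OF P])
qed

text \<open>The lifting property of projective modules, with surjectivity of \<open>\<pi>\<close>
  asked for only at the values of \<open>h\<close>. The lift uses preimages \<open>y j\<close> of
  \<open>h (x j)\<close> as coefficients in place of the \<open>x j\<close>.\<close>

lemma dual_basis_lift:
  assumes P: "right_module R P" and L: "right_module R L" and N: "right_module R N"
    and db: "dual_basis R P n x f"
    and h: "h \<in> rhom R P N" and \<pi>: "\<pi> \<in> rhom R L N"
    and lift: "\<And>p. p \<in> carrier P \<Longrightarrow> \<exists>y\<in>carrier L. \<pi> y = h p"
  obtains k where "k \<in> rhom R P L" "\<And>p. p \<in> carrier P \<Longrightarrow> \<pi> (k p) = h p"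
proof -
  interpret P: right_module R P by fact
  interpret L: right_module R L by fact
  interpret N: right_module R N by fact
  from db have x: "\<And>j. j < n \<Longrightarrow> x j \<in> carrier P" and f: "\<And>j. j < n \<Longrightarrow> f j \<in> dual R P"
    and xf: "\<And>p. p \<in> carrier P \<Longrightarrow> p = (\<Oplus>\<^bsub>P\<^esub>j\<in>{..<n}. x j \<lhd>\<^bsub>P\<^esub> f j p)"
    by (auto simp: dual_basis_def)
  note f' = rhomD[OF f, simplified]
  have "\<forall>j. \<exists>y. j < n \<longrightarrow> y \<in> carrier L \<and> \<pi> y = h (x j)" using lift x by blast
  then obtain y where y: "\<And>j. j < n \<Longrightarrow> y j \<in> carrier L" "\<And>j. j < n \<Longrightarrow> \<pi> (y j) = h (x j)" by metis
  show ?thesis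
  proof (rule that)
    show "(\<lambda>p\<in>carrier P. \<Oplus>\<^bsub>L\<^esub>j\<in>{..<n}. y j \<lhd>\<^bsub>L\<^esub> f j p) \<in> rhom R P L"
      by (rule dual_basis_hom[OF P L db]) (use y in auto)
    fix p assume p: "p \<in> carrier P"
    have "\<pi> (\<Oplus>\<^bsub>L\<^esub>j\<in>{..<n}. y j \<lhd>\<^bsub>L\<^esub> f j p) = (\<Oplus>\<^bsub>N\<^esub>j\<in>{..<n}. \<pi> (y j \<lhd>\<^bsub>L\<^esub> f j p))"
      by (rule rhom_finsum[OF L N \<pi>]) (auto intro: L.ract_closed y f' p)
    also have "\<dots> = (\<Oplus>\<^bsub>N\<^esub>j\<in>{..<n}. h (x j \<lhd>\<^bsub>P\<^esub> f j p))"
      by (rule N.M.finsum_cong')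
        (auto simp: rhomD[OF h] rhomD[OF \<pi>] y x f' p P.ract_closed N.ract_closed)
    also have "\<dots> = h (\<Oplus>\<^bsub>P\<^esub>j\<in>{..<n}. x j \<lhd>\<^bsub>P\<^esub> f j p)"
      by (rule rhom_finsum[OF P N h, symmetric]) (auto intro: P.ract_closed x f' p)
    also have "\<dots> = h p" using xf[OF p] by simp
    finally show "\<pi> ((\<lambda>p\<in>carrier P. \<Oplus>\<^bsub>L\<^esub>j\<in>{..<n}. y j \<lhd>\<^bsub>L\<^esub> f j p) p) = h p" using p by simp
  qed
qed

lemma left_linear_zero:
  assumes "right_module R M" "left_linear R M \<rho>"
  shows "\<rho> (\<lambda>x\<in>carrier M. \<zero>) = \<zero>"
proof -
  have z: "(\<lambda>x\<in>carrier M. \<zero>) \<in> dual R M" by (rule rhomI[OF assms(1)]) auto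
  have "\<rho> (\<lambda>x\<in>carrier M. \<zero> \<otimes> (\<lambda>x\<in>carrier M. \<zero>) x) = \<zero> \<otimes> \<rho> (\<lambda>x\<in>carrier M. \<zero>)"
    using assms(2) z unfolding left_linear_def by blast
  moreover have "(\<lambda>x\<in>carrier M. \<zero> \<otimes> (\<lambda>x\<in>carrier M. \<zero>) x) = (\<lambda>x\<in>carrier M. \<zero>)" by (rule restrict_ext) simp
  moreover have "\<rho> (\<lambda>x\<in>carrier M. \<zero>) \<in> carrier R" using assms(2) z by (auto simp: left_linear_def)
  ultimately show ?thesis by simp
qed

text \<open>Every functional expands as the left combination of the \<open>f j\<close> with
  coefficients \<open>g (x j)\<close>. Applying \<open>\<rho>\<close> and moving the coefficients
  inside \<open>g\<close> shows that \<open>\<rho>\<close> is evaluation at the sum of the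
  \<open>x j \<lhd> \<rho> (f j)\<close>.\<close>

lemma dual_basis_reflexive:
  assumes P: "right_module R P" and db: "dual_basis R P n x f"
  shows "reflexive R P"
  unfolding reflexive_def
proof (intro conjI ballI allI impI)
  interpret P: right_module R P by fact
  from db have x: "\<And>j. j < n \<Longrightarrow> x j \<in> carrier P" and f: "\<And>j. j < n \<Longrightarrow> f j \<in> dual R P"
    and xf: "\<And>p. p \<in> carrier P \<Longrightarrow> p = (\<Oplus>\<^bsub>P\<^esub>j\<in>{..<n}. x j \<lhd>\<^bsub>P\<^esub> f j p)"
    by (auto simp: dual_basis_def)
  note f' = rhomD[OF f, simplified]
  { fix p assume p: "p \<in> carrier P" "\<forall>f\<in>dual R P. f p = \<zero>"
    have "f j p = \<zero>" if "j < n" for j using p(2) f[OF that] by blast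
    then have "(\<Oplus>\<^bsub>P\<^esub>j\<in>{..<n}. x j \<lhd>\<^bsub>P\<^esub> f j p) = (\<Oplus>\<^bsub>P\<^esub>j\<in>{..<n}. \<zero>\<^bsub>P\<^esub>)"
      using x by (intro P.M.finsum_cong') (auto simp: P.ract_zero)
    also have "\<dots> = \<zero>\<^bsub>P\<^esub>" by simp
    finally show "p = \<zero>\<^bsub>P\<^esub>" using xf[OF p(1)] by simp }
  fix \<rho> assume \<rho>: "left_linear R P \<rho>"
  then have \<rho>c: "\<And>f. f \<in> dual R P \<Longrightarrow> \<rho> f \<in> carrier R" by (auto simp: left_linear_def)
  define y where "y = (\<Oplus>\<^bsub>P\<^esub>j\<in>{..<n}. x j \<lhd>\<^bsub>P\<^esub> \<rho> (f j))"
  have y: "y \<in> carrier P" unfolding y_def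
    by (rule P.M.finsum_closed) (auto intro: P.ract_closed x \<rho>c f)
  show "\<exists>y\<in>carrier P. \<forall>g\<in>dual R P. \<rho> g = g y"
  proof (rule bexI[OF ballI y])
    fix g assume g: "g \<in> dual R P"
    note g' = rhomD[OF g, simplified]
    \<comment> \<open>These are the partial sums of the expansion of \<open>g\<close>. They are
      needed because \<open>\<rho>\<close> is only known to respect binary sums, so the expansion is
      pushed through it by induction on \<open>S\<close>.\<close>
    define gS where "gS S = (\<lambda>p\<in>carrier P. \<Oplus>j\<in>S. g (x j) \<otimes> f j p)" for S
    have gS: "gS S \<in> dual R P \<and> \<rho> (gS S) = (\<Oplus>j\<in>S. g (x j) \<otimes> \<rho> (f j))"
      if "S \<subseteq> {..<n}" for S
      using finite_subset[OF that finite_lessThan] that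
    proof (induction S rule: finite_induct)
      case empty
      have "(\<lambda>x\<in>carrier P. \<zero>) \<in> dual R P" by (rule rhomI[OF P]) auto
      then show ?case using left_linear_zero[OF P \<rho>] by (simp add: gS_def del: restrict_apply)
    next
      case (insert j S)
      then have j: "j < n" and IH: "gS S \<in> dual R P" "\<rho> (gS S) = (\<Oplus>j\<in>S. g (x j) \<otimes> \<rho> (f j))"
        and S: "\<And>j. j \<in> S \<Longrightarrow> j < n"
        by auto
      define h where "h = (\<lambda>p\<in>carrier P. g (x j) \<otimes> f j p)"
      have h: "h \<in> dual R P" unfolding h_def by (rule dual_left_mult[OF P f]) (use j x g' in auto)
      have \<rho>h: "\<rho> h = g (x j) \<otimes> \<rho> (f j)" using \<rho> f[OF j] g'(1)[OF x[OF j]] by (simp add: h_def left_linear_def)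
      have "gS (insert j S) = (\<lambda>p\<in>carrier P. h p \<oplus> gS S p)"
        unfolding gS_def h_def
      proof (rule restrict_ext)
        fix p assume p: "p \<in> carrier P"
        have "(\<lambda>j. g (x j) \<otimes> f j p) \<in> S \<rightarrow> carrier R" "g (x j) \<otimes> f j p \<in> carrier R"
          using S j p by (auto simp: g' f' x)
        then show "(\<Oplus>j\<in>insert j S. g (x j) \<otimes> f j p) =
          (\<lambda>p\<in>carrier P. g (x j) \<otimes> f j p) p \<oplus> (\<lambda>p\<in>carrier P. \<Oplus>j\<in>S. g (x j) \<otimes> f j p) p"
          using insert p finsum_insert[of S j "\<lambda>j. g (x j) \<otimes> f j p"] by simp
      qed
      moreover have "(\<lambda>p\<in>carrier P. h p \<oplus> gS S p) \<in> dual R P" by (rule dual_add[OF P h IH(1)])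
      moreover have "\<rho> (\<lambda>p\<in>carrier P. h p \<oplus> gS S p) = \<rho> h \<oplus> \<rho> (gS S)"
        using \<rho> h IH(1) by (simp add: left_linear_def)
      moreover have "(\<Oplus>j\<in>insert j S. g (x j) \<otimes> \<rho> (f j))
        = g (x j) \<otimes> \<rho> (f j) \<oplus> (\<Oplus>j\<in>S. g (x j) \<otimes> \<rho> (f j))"
        using insert S j finsum_insert[of S j "\<lambda>j. g (x j) \<otimes> \<rho> (f j)"] by (auto simp: Pi_iff g' x \<rho>c f)
      ultimately show ?case using \<rho>h IH by (simp del: restrict_apply)
    qed
    have "gS {..<n} = g"
    proof (rule rhom_ext[OF conjunct1[OF gS] g])
      fix p assume p: "p \<in> carrier P"
      have "g p = g (\<Oplus>\<^bsub>P\<^esub>j\<in>{..<n}. x j \<lhd>\<^bsub>P\<^esub> f j p)" using xf[OF p] by simp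
      also have "\<dots> = (\<Oplus>j\<in>{..<n}. g (x j \<lhd>\<^bsub>P\<^esub> f j p))"
        by (rule dual_finsum[OF P g]) (auto intro: P.ract_closed x f' p)
      also have "\<dots> = gS {..<n} p"
        using p by (auto simp: gS_def g' x f' intro!: finsum_cong')
      finally show "gS {..<n} p = g p" ..
    qed simp
    then have "\<rho> g = (\<Oplus>j\<in>{..<n}. g (x j) \<otimes> \<rho> (f j))"
      using gS[of "{..<n}"] by simp
    also have "\<dots> = (\<Oplus>j\<in>{..<n}. g (x j \<lhd>\<^bsub>P\<^esub> \<rho> (f j)))"
      by (auto simp: g' x \<rho>c f intro!: finsum_cong')
    also have "\<dots> = g y" unfolding y_def
      by (rule dual_finsum[OF P g, symmetric]) (auto intro: P.ract_closed x \<rho>c f)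
    finally show "\<rho> g = g y" .
  qed
qed

text \<open>A functional \<open>\<rho>\<close> on the dual of \<open>N\<close> becomes one on the
  dual of \<open>M\<close> by composing with \<open>i\<close>; the element of \<open>M\<close> that
  represents it is brought back to \<open>N\<close> by \<open>r\<close>.\<close>

lemma retract_reflexive:
  assumes N: "right_module R N" and M: "right_module R M" and ret: "retract R N M" and refl: "reflexive R M"
  shows "reflexive R N"
  unfolding reflexive_def
proof (intro conjI ballI allI impI)
  from ret obtain i r where i: "i \<in> rhom R N M" and r: "r \<in> rhom R M N"
    and ri: "\<And>x. x \<in> carrier N \<Longrightarrow> r (i x) = x" by (auto simp: retract_def)
  note i' = rhomD[OF i] and r' = rhomD[OF r]
  { fix x assume x: "x \<in> carrier N" "\<forall>f\<in>dual R N. f x = \<zero>"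
    have "f (i x) = \<zero>" if "f \<in> dual R M" for f
      using x rhom_compose[OF N i that] by (force simp: compose_def)
    then have "i x = \<zero>\<^bsub>M\<^esub>" using refl i' x unfolding reflexive_def by blast
    then show "x = \<zero>\<^bsub>N\<^esub>" using ri[OF x(1)] rhom_zero[OF M N r] by simp }
  fix \<rho> assume \<rho>: "left_linear R N \<rho>"
  define \<rho>' where "\<rho>' f = \<rho> (compose (carrier N) f i)" for f
  have fi: "compose (carrier N) f i \<in> dual R N" if "f \<in> dual R M" for f
    using rhom_compose[OF N i that] .
  have "left_linear R M \<rho>'"
    unfolding left_linear_def
  proof (intro conjI ballI)
    show "\<rho>' \<in> dual R M \<rightarrow> carrier R" using \<rho> fi by (auto simp: \<rho>'_def left_linear_def)
    fix f g a assume f: "f \<in> dual R M"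
    { assume g: "g \<in> dual R M"
      have "compose (carrier N) (\<lambda>x\<in>carrier M. f x \<oplus> g x) i
        = (\<lambda>x\<in>carrier N. compose (carrier N) f i x \<oplus> compose (carrier N) g i x)"
        by (auto simp: compose_def i' intro!: restrict_ext)
      then show "\<rho>' (\<lambda>x\<in>carrier M. f x \<oplus> g x) = \<rho>' f \<oplus> \<rho>' g"
        using \<rho> fi[OF f] fi[OF g] by (simp add: \<rho>'_def left_linear_def) }
    { assume a: "a \<in> carrier R"
      have "compose (carrier N) (\<lambda>x\<in>carrier M. a \<otimes> f x) i
        = (\<lambda>x\<in>carrier N. a \<otimes> compose (carrier N) f i x)"
        by (auto simp: compose_def i' intro!: restrict_ext)
      then show "\<rho>' (\<lambda>x\<in>carrier M. a \<otimes> f x) = a \<otimes> \<rho>' f"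
        using \<rho> fi[OF f] a by (simp add: \<rho>'_def left_linear_def) }
  qed
  then obtain m where m: "m \<in> carrier M" "\<And>f. f \<in> dual R M \<Longrightarrow> \<rho>' f = f m"
    using refl unfolding reflexive_def by blast
  show "\<exists>x\<in>carrier N. \<forall>f\<in>dual R N. \<rho> f = f x"
  proof (intro bexI ballI)
    show "r m \<in> carrier N" using r' m by simp
    fix g assume g: "g \<in> dual R N"
    have "compose (carrier N) (compose (carrier M) g r) i = g"
      by (rule rhom_ext[OF fi[OF rhom_compose[OF M r g]] g]) (simp add: compose_def i' ri)
    then have "\<rho> g = \<rho>' (compose (carrier M) g r)" by (simp add: \<rho>'_def)
    also have "\<dots> = g (r m)" using m(2)[OF rhom_compose[OF M r g]] m(1) by (simp add: compose_def)
    finally show "\<rho> g = g (r m)" .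
  qed
qed

end

section \<open>Totally exact complexes\<close>

abbreviation image_module :: "(int \<Rightarrow> ('a, 'm) rmodule) \<Rightarrow> (int \<Rightarrow> 'm \<Rightarrow> 'm) \<Rightarrow> int \<Rightarrow> ('a, 'm) rmodule" where
  "image_module P d i \<equiv> (P (i + 1))\<lparr>carrier := d i ` carrier (P i)\<rparr>"

lemma rhom_image_submodule:
  assumes M: "right_module A M" and N: "right_module A N" and f: "f \<in> rhom A M N"
  shows "right_submodule A N (f ` carrier M)"
proof -
  interpret M: right_module A M by fact
  note f' = rhomD[OF f]
  have "\<zero>\<^bsub>N\<^esub> \<in> f ` carrier M" using rhom_zero[OF assms] by (metis M.M.zero_closed imageI)
  then show ?thesis
    by (intro right_submoduleI[OF N]) (auto simp: f' M.ract_closed simp flip: f'(2,3))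
qed

context
  fixes A :: "('a, 'b) ring_scheme" and P :: "int \<Rightarrow> ('a, 'm) rmodule" and d
  assumes te: "totally_exact A P d"
begin

lemma te_fg: "fg_projective A (P i)"
  using te by (simp add: totally_exact_def)

lemma te_module: "right_module A (P i)"
  using te_fg by (simp add: fg_projective_def)

lemma te_hom: "d i \<in> rhom A (P i) (P (i + 1))"
  using te by (simp add: totally_exact_def)

lemma te_exact: "d i ` carrier (P i) = {x \<in> carrier (P (i + 1)). d (i + 1) x = \<zero>\<^bsub>P (i + 1 + 1)\<^esub>}"
  using te unfolding totally_exact_def by blast

lemma te_exact': "d (i - 1) ` carrier (P (i - 1)) = {x \<in> carrier (P i). d i x = \<zero>\<^bsub>P (i + 1)\<^esub>}"
  using te_exact[of "i - 1"] by simp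

lemma te_image_submodule: "right_submodule A (P (i + 1)) (d i ` carrier (P i))"
  by (rule rhom_image_submodule[OF te_module te_module te_hom])

lemma te_image_module: "right_module A (image_module P d i)"
  by (rule submodule_right_module[OF te_module te_image_submodule])

lemma te_hom_image: "d i \<in> rhom A (P i) (image_module P d i)"
  using te_hom[of i] by (auto simp: rhom_def)

lemma te_ring: "ring A"
  using te_module by (simp add: right_module_def)

text \<open>The composite of \<open>d i\<close> and \<open>h\<close> kills the image of
  \<open>d (i - 1)\<close>, so exactness of the dual complex writes it as the composite of
  \<open>d i\<close> and some \<open>g\<close>. Equivalently, the first Ext group of the cokernel of
  \<open>d i\<close> with values in \<open>A\<close> vanishes. Apart from this lemma, only ordinary
  exactness of the complex is used.\<close>

lemma te_extend:
  assumes h: "h \<in> dual A (image_module P d i)"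
  obtains g where "g \<in> dual A (P (i + 1))" "\<And>x. x \<in> d i ` carrier (P i) \<Longrightarrow> g x = h x"
proof -
  have "(\<lambda>g. compose (carrier (P (i - 1 + 1))) g (d (i - 1 + 1))) `
              rhom A (P (i - 1 + 1 + 1)) (regular_module A) =
          {f \<in> rhom A (P (i - 1 + 1)) (regular_module A). \<forall>x\<in>carrier (P (i - 1)). f (d (i - 1) x) = \<zero>\<^bsub>A\<^esub>}"
    using te unfolding totally_exact_def by blast
  then have *: "(\<lambda>g. compose (carrier (P i)) g (d i)) ` dual A (P (i + 1)) =
          {f \<in> dual A (P i). \<forall>x\<in>carrier (P (i - 1)). f (d (i - 1) x) = \<zero>\<^bsub>A\<^esub>}"
    by simp
  have h0: "h \<zero>\<^bsub>P (i + 1)\<^esub> = \<zero>\<^bsub>A\<^esub>"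
    using rhom_zero[OF te_image_module regular_right_module[OF te_ring] h] by simp
  have "compose (carrier (P i)) h (d i) \<in> {f \<in> dual A (P i). \<forall>x\<in>carrier (P (i - 1)). f (d (i - 1) x) = \<zero>\<^bsub>A\<^esub>}"
  proof (intro CollectI conjI ballI)
    show "compose (carrier (P i)) h (d i) \<in> dual A (P i)"
      by (rule rhom_compose[OF te_module te_hom_image h])
    fix x assume "x \<in> carrier (P (i - 1))"
    then have "d (i - 1) x \<in> d (i - 1) ` carrier (P (i - 1))" by simp
    then have "d (i - 1) x \<in> carrier (P i)" "d i (d (i - 1) x) = \<zero>\<^bsub>P (i + 1)\<^esub>"
      unfolding te_exact' by auto
    then show "compose (carrier (P i)) h (d i) (d (i - 1) x) = \<zero>\<^bsub>A\<^esub>"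
      by (simp add: compose_def h0)
  qed
  then have "compose (carrier (P i)) h (d i) \<in> (\<lambda>g. compose (carrier (P i)) g (d i)) ` dual A (P (i + 1))"
    unfolding * .
  then obtain g where g: "g \<in> dual A (P (i + 1))"
    and eq: "compose (carrier (P i)) h (d i) = compose (carrier (P i)) g (d i)" by (elim imageE)
  have "g (d i x) = h (d i x)" if "x \<in> carrier (P i)" for x
    using fun_cong[OF eq, of x] that by (simp add: compose_def)
  with g that show ?thesis by blast
qed

lemma te_reflexive: "reflexive A (P i)"
proof -
  interpret ring A by (rule te_ring)
  obtain n x f where "dual_basis A (P i) n x f" using fg_projective_dual_basis[OF te_fg] by blast
  then show ?thesis by (rule dual_basis_reflexive[OF te_module])
qed

text \<open>Injectivity is inherited from the projective module around the image. For surjectivity,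
  \<open>\<rho>\<close> is composed with restriction and becomes evaluation at some \<open>p\<close>
  in \<open>P (i + 1)\<close>. This \<open>p\<close> lies in the kernel of \<open>d (i + 1)\<close>,
  which is the image, and since every functional on the image extends, evaluation at
  \<open>p\<close> gives \<open>\<rho>\<close> on all of them.\<close>

lemma te_image_reflexive: "reflexive A (image_module P d i)"
  unfolding reflexive_def
proof (intro conjI ballI allI impI)
  interpret ring A by (rule te_ring)
  interpret P: right_module A "P (i + 1)" by (rule te_module)
  let ?M = "image_module P d i"
  have sub: "carrier ?M \<subseteq> carrier (P (i + 1))"
    using right_submoduleD(1)[OF te_module te_image_submodule] by simp
  define res where "res g = restrict g (carrier ?M)" for g :: "'m \<Rightarrow> 'a"
  have res: "res g \<in> dual A ?M" if "g \<in> dual A (P (i + 1))" for g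
    using rhom_restrict_carrier[OF that, of "carrier ?M"] sub te_image_module by (simp add: res_def)
  { fix x assume x: "x \<in> carrier ?M" "\<forall>f\<in>dual A ?M. f x = \<zero>\<^bsub>A\<^esub>"
    have "g x = \<zero>\<^bsub>A\<^esub>" if "g \<in> dual A (P (i + 1))" for g
      using bspec[OF x(2) res[OF that]] x(1) by (simp add: res_def)
    then show "x = \<zero>\<^bsub>?M\<^esub>" using te_reflexive[of "i + 1"] x(1) sub unfolding reflexive_def by auto }
  fix \<rho> assume \<rho>: "left_linear A ?M \<rho>"
  have "left_linear A (P (i + 1)) (\<lambda>g. \<rho> (res g))"
    unfolding left_linear_def
  proof (intro conjI ballI)
    show "(\<lambda>g. \<rho> (res g)) \<in> dual A (P (i + 1)) \<rightarrow> carrier A" using \<rho> res by (auto simp: left_linear_def)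
    fix f g a assume f: "f \<in> dual A (P (i + 1))"
    { assume g: "g \<in> dual A (P (i + 1))"
      have "res (\<lambda>x\<in>carrier (P (i + 1)). f x \<oplus>\<^bsub>A\<^esub> g x) = (\<lambda>x\<in>carrier ?M. res f x \<oplus>\<^bsub>A\<^esub> res g x)"
        unfolding res_def by (rule restrict_ext) (use sub in auto)
      then show "\<rho> (res (\<lambda>x\<in>carrier (P (i + 1)). f x \<oplus>\<^bsub>A\<^esub> g x)) = \<rho> (res f) \<oplus>\<^bsub>A\<^esub> \<rho> (res g)"
        using \<rho> res[OF f] res[OF g] unfolding left_linear_def by simp }
    { assume a: "a \<in> carrier A"
      have "res (\<lambda>x\<in>carrier (P (i + 1)). a \<otimes>\<^bsub>A\<^esub> f x) = (\<lambda>x\<in>carrier ?M. a \<otimes>\<^bsub>A\<^esub> res f x)"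
        unfolding res_def by (rule restrict_ext) (use sub in auto)
      then show "\<rho> (res (\<lambda>x\<in>carrier (P (i + 1)). a \<otimes>\<^bsub>A\<^esub> f x)) = a \<otimes>\<^bsub>A\<^esub> \<rho> (res f)"
        using \<rho> res[OF f] a unfolding left_linear_def by simp }
  qed
  then obtain p where p: "p \<in> carrier (P (i + 1))" "\<And>g. g \<in> dual A (P (i + 1)) \<Longrightarrow> \<rho> (res g) = g p"
    using te_reflexive[of "i + 1"] unfolding reflexive_def by blast
  \<comment> \<open>Functionals that factor through \<open>d (i + 1)\<close> restrict to zero on the
    image of \<open>d i\<close>, so \<open>\<rho>\<close> kills them; as
    \<open>P (i + 1 + 1)\<close> is separated by its functionals, \<open>d (i + 1) p\<close> is
    zero.\<close>
  have "g (d (i + 1) p) = \<zero>\<^bsub>A\<^esub>" if g: "g \<in> dual A (P (i + 1 + 1))" for g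
  proof -
    let ?g = "compose (carrier (P (i + 1))) g (d (i + 1))"
    have g': "?g \<in> dual A (P (i + 1))" by (rule rhom_compose[OF te_module te_hom g])
    have "res ?g = (\<lambda>x\<in>carrier ?M. \<zero>\<^bsub>A\<^esub>)"
      unfolding res_def
    proof (rule restrict_ext)
      fix x assume "x \<in> carrier ?M"
      then have "x \<in> carrier (P (i + 1))" "d (i + 1) x = \<zero>\<^bsub>P (i + 1 + 1)\<^esub>"
        using te_exact[of i] by auto
      then show "?g x = \<zero>\<^bsub>A\<^esub>"
        using rhom_zero[OF te_module regular_right_module[OF te_ring] g] by (simp add: compose_def)
    qed
    then have "\<rho> (res ?g) = \<zero>\<^bsub>A\<^esub>" using left_linear_zero[OF te_image_module \<rho>] by simp
    then show ?thesis using p(2)[OF g'] p(1) by (simp add: compose_def)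
  qed
  moreover have "d (i + 1) p \<in> carrier (P (i + 1 + 1))" using rhomD(1)[OF te_hom p(1)] .
  ultimately have "d (i + 1) p = \<zero>\<^bsub>P (i + 1 + 1)\<^esub>"
    using te_reflexive[of "i + 1 + 1"] unfolding reflexive_def by blast
  then have pM: "p \<in> carrier ?M" using p(1) te_exact[of i] by simp
  show "\<exists>x\<in>carrier ?M. \<forall>f\<in>dual A ?M. \<rho> f = f x"
  proof (rule bexI[OF ballI pM])
    fix f assume f: "f \<in> dual A ?M"
    then obtain g where g: "g \<in> dual A (P (i + 1))" "\<And>x. x \<in> d i ` carrier (P i) \<Longrightarrow> g x = f x"
      using te_extend by blast
    have "res g = f" by (rule rhom_ext[OF res[OF g(1)] f]) (use g(2) in \<open>simp add: res_def\<close>)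
    then show "\<rho> f = f p" using p(2)[OF g(1)] g(2)[of p] pM by simp
  qed
qed

end

context ring
begin

lemma gorenstein_projective_reflexive:
  assumes "gorenstein_projective R G" shows "reflexive R G"
proof -
  from assms obtain P :: "int \<Rightarrow> ('a, nat \<Rightarrow> 'a) rmodule" and d i where G: "right_module R G"
    and te: "totally_exact R P d" and iso: "rmod_iso R G (image_module P d i)"
    unfolding gorenstein_projective_def by blast
  note M = te_image_module[OF te]
  show ?thesis
    by (rule retract_reflexive[OF G M rmod_iso_retract[OF M rmod_iso_sym[OF G iso]] te_image_reflexive[OF te]])
qed

text \<open>
  \<open>x \<mapsto> p \<lhd> x\<close> and \<open>\<psi>\<close> are the maps between the syzygies of \<open>aR\<close> and of the image module that a
  retraction induces; their composition differs from the identity by multiplication by \<open>k\<close>.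
\<close>

lemma syzygy_comparison:
  assumes te: "totally_exact R P d" and a: "a \<in> carrier R" and e: "e \<in> carrier R"
    and ae: "a \<otimes> e = a" and ee: "e \<otimes> e = e"
    and ret: "retract R (rideal a) (image_module P d i)"
    and K: "K = {x \<in> carrier R. e \<otimes> x = x \<and> a \<otimes> x = \<zero>}"
  obtains p \<psi> k where "p \<in> carrier (P i)" "\<psi> \<in> dual R (P i)" "k \<in> K"
    "\<And>x. x \<in> K \<Longrightarrow> p \<lhd>\<^bsub>P i\<^esub> x \<in> carrier (image_module P d (i - 1))"
    "\<And>q. q \<in> carrier (image_module P d (i - 1)) \<Longrightarrow> q \<in> carrier (P i) \<and> \<psi> q \<in> K"
    "\<And>x. x \<in> K \<Longrightarrow> \<psi> (p \<lhd>\<^bsub>P i\<^esub> x) = k \<otimes> x \<oplus> x"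
proof -
  let ?M = "image_module P d i" and ?a = "rideal a" and ?e = "rideal e"
  note P = te_module[OF te] and M = te_image_module[OF te] and dM = te_hom_image[OF te]
  interpret P: right_module R "P i" by (rule P)
  note a_mod = principal_right_module[OF a] and e_mod = principal_right_module[OF e]
  from ret obtain \<iota> \<rho> where \<iota>: "\<iota> \<in> rhom R ?a ?M" and \<rho>: "\<rho> \<in> rhom R ?M ?a"
    and \<rho>\<iota>: "\<And>x. x \<in> carrier ?a \<Longrightarrow> \<rho> (\<iota> x) = x" by (auto simp: retract_def)
  have aa: "a \<in> carrier ?a" using a by (auto intro!: exI[of _ \<one>])
  have "\<iota> a \<in> carrier ?M" using rhomD(1)[OF \<iota> aa] .
  then obtain p where p: "p \<in> carrier (P i)" "d i p = \<iota> a" by auto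
  have dx: "d i (p \<lhd>\<^bsub>P i\<^esub> x) = \<iota> (a \<otimes> x)" if "x \<in> carrier R" for x
    using rhomD(3)[OF dM p(1) that] rhomD(3)[OF \<iota> aa that] p(2) by simp
  obtain n x f where db: "dual_basis R (P i) n x f" using fg_projective_dual_basis[OF te_fg[OF te]] by blast
  have h: "compose (carrier (P i)) \<rho> (d i) \<in> rhom R (P i) ?a" by (rule rhom_compose[OF P dM \<rho>])
  \<comment> \<open>Left multiplication by \<open>a\<close> maps \<open>e R\<close> onto
    \<open>a R\<close>, as \<open>a \<otimes> e = a\<close>. Projectivity of \<open>P i\<close>
    lifts the composite of \<open>d i\<close> and \<open>\<rho>\<close> along this surjection, and
    the lift carries the kernel of \<open>d i\<close> into \<open>K\<close>.\<close>
  have \<pi>: "(\<lambda>x\<in>carrier ?e. a \<otimes> x) \<in> rhom R ?e ?a"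
    by (rule rhomI[OF e_mod]) (use a e in \<open>auto simp: r_distr m_assoc\<close>)
  have lift: "\<exists>y\<in>carrier ?e. (\<lambda>x\<in>carrier ?e. a \<otimes> x) y = compose (carrier (P i)) \<rho> (d i) q"
    if q: "q \<in> carrier (P i)" for q
  proof -
    obtain y where y: "y \<in> carrier R" "compose (carrier (P i)) \<rho> (d i) q = a \<otimes> y"
      using rhomD(1)[OF h q] by auto
    then have "a \<otimes> (e \<otimes> y) = compose (carrier (P i)) \<rho> (d i) q"
      using a e ae by (simp flip: m_assoc)
    then show ?thesis using y(1) by (intro bexI[of _ "e \<otimes> y"]) auto
  qed
  obtain k where k: "k \<in> rhom R (P i) ?e"
    and ak: "\<And>q. q \<in> carrier (P i) \<Longrightarrow> (\<lambda>x\<in>carrier ?e. a \<otimes> x) (k q) = compose (carrier (P i)) \<rho> (d i) q"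
    using dual_basis_lift[OF P e_mod a_mod db h \<pi> lift] by blast
  have kc: "k q \<in> carrier ?e" if "q \<in> carrier (P i)" for q using rhomD(1)[OF k that] .
  have kR: "k q \<in> carrier R" and ek: "e \<otimes> k q = k q" if q: "q \<in> carrier (P i)" for q
  proof -
    obtain y where "y \<in> carrier R" "k q = e \<otimes> y" using kc[OF q] by auto
    then show "k q \<in> carrier R" "e \<otimes> k q = k q" using e ee by (simp_all flip: m_assoc)
  qed
  have ak': "a \<otimes> k q = \<rho> (d i q)" if "q \<in> carrier (P i)" for q
    using ak[OF that] kc[OF that] that by (simp add: compose_def)
  have k_dual: "k \<in> dual R (P i)" using k kR by (auto simp: rhom_def)
  have ker: "carrier (image_module P d (i - 1)) = {x \<in> carrier (P i). d i x = \<zero>\<^bsub>P (i + 1)\<^esub>}"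
    using te_exact'[OF te] by simp
  have kp: "a \<otimes> k p = a" using ak'[OF p(1)] p(2) \<rho>\<iota>[OF aa] by simp
  \<comment> \<open>Left multiplication by \<open>a\<close> sends both \<open>k p\<close> and
    \<open>e\<close> to \<open>a\<close>; their difference is the defect that the statement calls
    \<open>k\<close>, while the lift \<open>k\<close> itself serves as
    \<open>\<psi>\<close>.\<close>
  have "k p \<ominus> e \<in> K"
    using kR[OF p(1)] e a by (simp add: K minus_eq r_distr r_minus ek[OF p(1)] ee kp ae r_neg)
  moreover have "p \<lhd>\<^bsub>P i\<^esub> x \<in> carrier (image_module P d (i - 1))" if "x \<in> K" for x
    using that dx rhom_zero[OF a_mod M \<iota>] p(1) unfolding ker by (simp add: K P.ract_closed)
  moreover have "q \<in> carrier (P i) \<and> k q \<in> K" if "q \<in> carrier (image_module P d (i - 1))" for q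
    using that ak'[of q] rhom_zero[OF M a_mod \<rho>] kR ek unfolding ker by (simp add: K)
  moreover have "k (p \<lhd>\<^bsub>P i\<^esub> x) = (k p \<ominus> e) \<otimes> x \<oplus> x" if "x \<in> K" for x
  proof -
    have "k p = (k p \<ominus> e) \<oplus> e" using kR[OF p(1)] e by (simp add: minus_eq a_assoc l_neg)
    then have "k p \<otimes> x = (k p \<ominus> e) \<otimes> x \<oplus> x"
      using that kR[OF p(1)] e l_distr[of "k p \<ominus> e" e x] by (simp add: K)
    then show ?thesis using rhomD(3)[OF k_dual p(1), of x] that by (simp add: K)
  qed
  ultimately show ?thesis using that[of p k "k p \<ominus> e"] p(1) k_dual by blast
qed

text \<open>\<open>K\<close> is the kernel of the map from \<open>e R\<close> onto
  \<open>a R\<close>. The functional \<open>h \<circ> \<psi>\<close> on the preceding image extends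
  to some \<open>g\<close> on \<open>P i\<close>, and evaluating at \<open>p \<lhd> x\<close> gives
  \<open>g p \<otimes> x = h k \<otimes> x \<oplus> h x\<close>. Hence \<open>h\<close> is left
  multiplication by \<open>g p \<ominus> h k\<close>.\<close>

lemma ext_vanishing:
  assumes te: "totally_exact R P d" and a: "a \<in> carrier R" and e: "e \<in> carrier R"
    and ae: "a \<otimes> e = a" and ee: "e \<otimes> e = e"
    and ret: "retract R (rideal a) (image_module P d i)"
    and K: "K = {x \<in> carrier R. e \<otimes> x = x \<and> a \<otimes> x = \<zero>}"
    and hc: "\<And>x. x \<in> K \<Longrightarrow> h x \<in> carrier R"
    and ha: "\<And>x y. x \<in> K \<Longrightarrow> y \<in> K \<Longrightarrow> h (x \<oplus> y) = h x \<oplus> h y"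
    and hm: "\<And>x r. x \<in> K \<Longrightarrow> r \<in> carrier R \<Longrightarrow> h (x \<otimes> r) = h x \<otimes> r"
  obtains y where "y \<in> carrier R" "\<And>x. x \<in> K \<Longrightarrow> h x = y \<otimes> x"
proof -
  let ?M = "image_module P d (i - 1)"
  obtain p \<psi> k where p: "p \<in> carrier (P i)" and \<psi>: "\<psi> \<in> dual R (P i)" and k: "k \<in> K"
    and pK: "\<And>x. x \<in> K \<Longrightarrow> p \<lhd>\<^bsub>P i\<^esub> x \<in> carrier ?M"
    and \<psi>K: "\<And>q. q \<in> carrier ?M \<Longrightarrow> q \<in> carrier (P i) \<and> \<psi> q \<in> K"
    and \<psi>p: "\<And>x. x \<in> K \<Longrightarrow> \<psi> (p \<lhd>\<^bsub>P i\<^esub> x) = k \<otimes> x \<oplus> x"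
    using syzygy_comparison[OF te a e ae ee ret K] by metis
  note \<psi>' = rhomD[OF \<psi>, simplified]
  have M: "right_module R ?M" by (rule te_image_module[OF te])
  have "restrict (\<lambda>q. h (\<psi> q)) (carrier ?M) \<in> dual R ?M"
    by (rule rhomI[OF M]) (use \<psi>K \<psi>' in \<open>auto simp: hc ha hm simp del: rmodule.simps\<close>)
  then obtain g where g: "g \<in> dual R (P (i - 1 + 1))"
    and gh: "\<And>q. q \<in> d (i - 1) ` carrier (P (i - 1)) \<Longrightarrow> g q = restrict (\<lambda>q. h (\<psi> q)) (carrier ?M) q"
    using te_extend[OF te] by blast
  have g: "g \<in> dual R (P i)" using g by simp
  note g' = rhomD[OF g, simplified]
  show ?thesis
  proof (rule that)
    show "g p \<ominus> h k \<in> carrier R" using g'(1)[OF p] hc[OF k] by simp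
    fix x assume x: "x \<in> K"
    then have xR: "x \<in> carrier R" and kx: "k \<otimes> x \<in> K" using k e a by (simp_all add: K flip: m_assoc)
    have "g p \<otimes> x = g (p \<lhd>\<^bsub>P i\<^esub> x)" using g'(3)[OF p xR] by simp
    also have "\<dots> = h (k \<otimes> x \<oplus> x)" using gh[of "p \<lhd>\<^bsub>P i\<^esub> x"] pK[OF x] \<psi>p[OF x] by simp
    also have "\<dots> = h k \<otimes> x \<oplus> h x" using ha[OF kx x] hm[OF k xR] by simp
    finally show "h x = (g p \<ominus> h k) \<otimes> x"
      using g'(1)[OF p] hc[OF k] hc[OF x] xR
      by (simp add: minus_eq l_distr l_minus) (simp add: a_ac r_neg2 r_neg1 l_neg r_neg)
  qed
qed

text \<open>The composite of the two maps between the syzygies is left multiplication by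
  \<open>\<one> \<oplus> k\<close>; correcting \<open>\<psi>\<close> by the inverse of this unit
  makes it a retraction.\<close>

lemma syzygy_retract:
  assumes te: "totally_exact R P d" and a: "a \<in> carrier R" and e: "e \<in> carrier R"
    and ae: "a \<otimes> e = a" and ee: "e \<otimes> e = e"
    and ret: "retract R (rideal a) (image_module P d i)"
    and b: "b \<in> carrier R" and bK: "carrier (rideal b) = {x \<in> carrier R. e \<otimes> x = x \<and> a \<otimes> x = \<zero>}"
    and unit: "\<And>k. k \<in> carrier (rideal b) \<Longrightarrow>
      \<exists>w\<in>carrier R. w \<otimes> (\<one> \<oplus> k) = \<one> \<and> (\<one> \<oplus> k) \<otimes> w = \<one>"
  shows "retract R (rideal b) (image_module P d (i - 1))"
proof -
  let ?M = "image_module P d (i - 1)" and ?b = "rideal b"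
  obtain p \<psi> k where p: "p \<in> carrier (P i)" and \<psi>: "\<psi> \<in> dual R (P i)" and k: "k \<in> carrier ?b"
    and pK: "\<And>x. x \<in> carrier ?b \<Longrightarrow> p \<lhd>\<^bsub>P i\<^esub> x \<in> carrier ?M"
    and \<psi>K: "\<And>q. q \<in> carrier ?M \<Longrightarrow> q \<in> carrier (P i) \<and> \<psi> q \<in> carrier ?b"
    and \<psi>p: "\<And>x. x \<in> carrier ?b \<Longrightarrow> \<psi> (p \<lhd>\<^bsub>P i\<^esub> x) = k \<otimes> x \<oplus> x"
    using syzygy_comparison[OF te a e ae ee ret bK] by metis
  interpret P: right_module R "P i" by (rule te_module[OF te])
  note \<psi>' = rhomD[OF \<psi>, simplified] and b_mod = principal_right_module[OF b]
  interpret b: right_module R ?b by (rule b_mod)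
  have M: "right_module R ?M" by (rule te_image_module[OF te])
  have bR: "x \<in> carrier R" if "x \<in> carrier ?b" for x using that b by auto
  have bm: "x \<otimes> r \<in> carrier ?b" if "x \<in> carrier ?b" "r \<in> carrier R" for x r
    using b.ract_closed[OF that] by simp
  obtain w where w: "w \<in> carrier R" "w \<otimes> (\<one> \<oplus> k) = \<one>" "(\<one> \<oplus> k) \<otimes> w = \<one>" using unit[OF k] by blast
  \<comment> \<open>The inverse \<open>w\<close> preserves \<open>b R\<close> because
    \<open>w \<otimes> y\<close> differs from \<open>y\<close> by a right multiple of
    \<open>k\<close>, and \<open>k\<close> lies in \<open>b R\<close>.\<close>
  have wy: "w \<otimes> y \<in> carrier ?b" if y: "y \<in> carrier ?b" for y
  proof -
    note R = bR[OF y] bR[OF k] w(1)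
    have "w \<oplus> k \<otimes> w = \<one>" using w(3) R by (simp add: l_distr)
    then have "(w \<oplus> k \<otimes> w) \<otimes> y = y" using R by simp
    then have "w \<otimes> y \<oplus> k \<otimes> (w \<otimes> y) = y" using R by (simp add: l_distr m_assoc)
    moreover have "(w \<otimes> y \<oplus> k \<otimes> (w \<otimes> y)) \<oplus> k \<otimes> (\<ominus> (w \<otimes> y)) = w \<otimes> y"
      using R by (simp add: r_minus a_assoc r_neg)
    ultimately have "w \<otimes> y = y \<oplus> k \<otimes> (\<ominus> (w \<otimes> y))" by simp
    then show ?thesis using b.M.a_closed[OF y bm[OF k, of "\<ominus> (w \<otimes> y)"]] R by simp
  qed
  have "restrict (\<lambda>x. p \<lhd>\<^bsub>P i\<^esub> x) (carrier ?b) \<in> rhom R ?b ?M"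
    by (rule rhomI[OF b_mod pK])
      (use p bR in \<open>auto simp: P.ract_add_right P.ract_mult simp del: principal_right_ideal_simps(1)\<close>)
  moreover have "restrict (\<lambda>q. w \<otimes> \<psi> q) (carrier ?M) \<in> rhom R ?M ?b"
    by (rule rhomI[OF M wy])
      (use \<psi>K w(1) \<psi>' in \<open>auto simp: r_distr m_assoc simp del: principal_right_ideal_simps(1)\<close>)
  moreover have "w \<otimes> \<psi> (p \<lhd>\<^bsub>P i\<^esub> x) = x" if x: "x \<in> carrier ?b" for x
  proof -
    have "\<psi> (p \<lhd>\<^bsub>P i\<^esub> x) = (\<one> \<oplus> k) \<otimes> x" using \<psi>p[OF x] bR[OF x] bR[OF k] by (simp add: l_distr a_comm)
    then have "w \<otimes> \<psi> (p \<lhd>\<^bsub>P i\<^esub> x) = (w \<otimes> (\<one> \<oplus> k)) \<otimes> x" using w(1) bR[OF x] bR[OF k] by (simp add: m_assoc)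
    then show ?thesis using w(2) bR[OF x] by simp
  qed
  ultimately show ?thesis unfolding retract_def
    using pK by (intro bexI ballI) (auto simp del: principal_right_ideal_simps(1))
qed

end

section \<open>Constructing Gorenstein-projective modules\<close>

text \<open>The complex has the terms \<open>g i R\<close>, and its differentials are left
  multiplications by \<open>a i\<close>. A functional on \<open>g i R\<close> is left multiplication
  by an element of \<open>R g i\<close>, so the dual complex consists of right multiplications, and
  \<open>left_exact\<close> is its exactness.\<close>

lemma (in ring) gorenstein_projective_principal:
  fixes g a :: "int \<Rightarrow> 'a"
  assumes gR: "\<And>i. g i \<in> carrier R" and aR: "\<And>i. a i \<in> carrier R"
    and gg: "\<And>i. g i \<otimes> g i = g i" and ag: "\<And>i. a i \<otimes> g i = a i" and ga: "\<And>i. g (i + 1) \<otimes> a i = a i"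
    and aa: "\<And>i. a (i + 1) \<otimes> a i = \<zero>"
    and right_exact: "\<And>i x. \<lbrakk>x \<in> carrier R; g (i + 1) \<otimes> x = x; a (i + 1) \<otimes> x = \<zero>\<rbrakk> \<Longrightarrow> \<exists>y\<in>carrier R. x = a i \<otimes> y"
    and left_exact: "\<And>i y. \<lbrakk>y \<in> carrier R; y \<otimes> g (i + 1) = y; y \<otimes> a i = \<zero>\<rbrakk> \<Longrightarrow> \<exists>z\<in>carrier R. y = z \<otimes> a (i + 1)"
  obtains G :: "('a, nat \<Rightarrow> 'a) rmodule" where "gorenstein_projective R G"
    "rmod_iso R G (rideal (a i))"
proof -
  define F where "F = direct_sum {..<1::nat} (\<lambda>_. regular_module R)"
  \<comment> \<open>The modules of a complex must consist of functions on \<open>nat\<close>, so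
    \<open>R\<close> is realized as the free module of rank one, with \<open>b x\<close> the vector
    whose only coordinate is \<open>x\<close>.\<close>
  define b where "b x = (\<lambda>_\<in>{..<1::nat}. x)" for x :: 'a
  have F: "right_module R F"
    unfolding F_def by (intro direct_sum_right_module ring_axioms regular_right_module) auto
  interpret F: right_module R F by (rule F)
  have b0: "b x 0 = x" for x by (simp add: b_def)
  have carF: "carrier F = b ` carrier R"
  proof (intro equalityI subsetI)
    fix q assume q: "q \<in> carrier F"
    then have q': "q \<in> {..<1} \<rightarrow>\<^sub>E carrier R" by (simp add: F_def carrier_direct_sum_finite)
    have "q = b (q 0)" by (rule extensionalityI[of _ "{..<1}"]) (use q' in \<open>auto simp: b_def PiE_def\<close>)
    moreover have "q 0 \<in> carrier R" using q' by auto
    ultimately show "q \<in> b ` carrier R" by blast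
  qed (auto simp: F_def b_def carrier_direct_sum_finite split: if_splits)
  have F_add: "b x \<oplus>\<^bsub>F\<^esub> b y = b (x \<oplus> y)" and F_ract: "b x \<lhd>\<^bsub>F\<^esub> r = b (x \<otimes> r)" and F_zero: "\<zero>\<^bsub>F\<^esub> = b \<zero>" for x y r
    by (auto simp: F_def b_def intro!: restrict_ext)
  have b_inj: "b x = b y \<longleftrightarrow> x = y" for x y using b0 by metis
  have sub: "right_submodule R F (b ` U)"
    if "U \<subseteq> carrier R" "\<zero> \<in> U" "\<And>x y. \<lbrakk>x \<in> U; y \<in> U\<rbrakk> \<Longrightarrow> x \<oplus> y \<in> U"
      "\<And>x a. \<lbrakk>x \<in> U; a \<in> carrier R\<rbrakk> \<Longrightarrow> x \<otimes> a \<in> U" for U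
    by (rule right_submoduleI[OF F]) (use that in \<open>auto simp: carF F_add F_ract F_zero\<close>)
  define gU where "gU i = {x \<in> carrier R. g i \<otimes> x = x}" for i
  define P where "P i = F\<lparr>carrier := b ` gU i\<rparr>" for i
  define d where "d i = (\<lambda>q\<in>carrier (P i). b (a i \<otimes> q 0))" for i
  have carP: "carrier (P i) = b ` gU i" for i by (simp add: P_def)
  have P_simps: "\<zero>\<^bsub>P i\<^esub> = b \<zero>" "b x \<oplus>\<^bsub>P i\<^esub> b y = b (x \<oplus> y)" "b x \<lhd>\<^bsub>P i\<^esub> r = b (x \<otimes> r)" for i x y r
    by (simp_all add: P_def F_zero F_add F_ract)
  have gU_sub: "right_submodule R F (b ` gU i)" for i
    by (rule sub) (use gR[of i] in \<open>auto simp: gU_def r_distr simp flip: m_assoc\<close>)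
  have P: "right_module R (P i)" for i unfolding P_def by (rule submodule_right_module[OF F gU_sub])
  have P_fg: "fg_projective R (P i)" for i
    unfolding fg_projective_def
  proof (intro conjI P)
    \<comment> \<open>The complement is the part cut out by the complementary idempotent
      \<open>\<one> \<ominus> g i\<close>.\<close>
    let ?W = "b ` {x \<in> carrier R. g i \<otimes> x = \<zero>}"
    have W: "right_submodule R F ?W"
      by (rule sub) (use gR[of i] in \<open>auto simp: r_distr simp flip: m_assoc\<close>)
    have "q \<in> b ` gU i <+>\<^bsub>F\<^esub> ?W" if "q \<in> carrier F" for q
    proof -
      obtain x where x: "x \<in> carrier R" "q = b x" using \<open>q \<in> carrier F\<close> unfolding carF by auto
      let ?u = "g i \<otimes> x" and ?w = "x \<ominus> g i \<otimes> x"
      have "q = b ?u \<oplus>\<^bsub>F\<^esub> b ?w"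
        using x gR[of i] by (simp add: F_add b_inj minus_eq a_lcomm r_neg)
      moreover have "?u \<in> gU i" using x gR[of i] gg[of i] by (simp add: gU_def flip: m_assoc)
      moreover have "g i \<otimes> ?w = \<zero>"
        using x gR[of i] gg[of i] by (simp add: minus_eq r_distr r_minus r_neg flip: m_assoc)
      moreover have "?w \<in> carrier R" using x gR[of i] by simp
      ultimately have "\<exists>u\<in>b ` gU i. \<exists>w\<in>?W. q = u \<oplus>\<^bsub>F\<^esub> w"
        by (intro bexI[of _ "b ?u"] bexI[of _ "b ?w"]) auto
      then show ?thesis unfolding set_add_def' by blast
    qed
    moreover have "b ` gU i <+>\<^bsub>F\<^esub> ?W \<subseteq> carrier F"
      by (auto simp: set_add_def' F_add carF gU_def)
    moreover have "b ` gU i \<inter> ?W = {\<zero>\<^bsub>F\<^esub>}"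
    proof -
      have "b ` gU i \<inter> ?W \<subseteq> {\<zero>\<^bsub>F\<^esub>}" by (auto simp: b_inj gU_def F_zero)
      then show ?thesis using right_submoduleD(2)[OF F gU_sub[of i]] right_submoduleD(2)[OF F W] by blast
    qed
    ultimately have "internal_direct_sum R F (b ` gU i) ?W"
      unfolding internal_direct_sum_def using gU_sub[of i] W by blast
    moreover have "rmod_iso R (P i) (F\<lparr>carrier := b ` gU i\<rparr>)"
      using rmod_iso_refl[OF P[of i]] by (simp add: P_def)
    ultimately show "\<exists>(n::nat) U W. let F = direct_sum {..<n} (\<lambda>_. regular_module R)
        in internal_direct_sum R F U W \<and> rmod_iso R (P i) (F\<lparr>carrier := U\<rparr>)"
      unfolding F_def Let_def by blast
  qed
  have d_app: "d i (b x) = b (a i \<otimes> x)" if "x \<in> gU i" for i x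
    using that by (simp add: d_def carP b0)
  have gUR: "x \<in> carrier R" if "x \<in> gU i" for x i using that by (simp add: gU_def)
  have aU: "a i \<otimes> x \<in> gU (i + 1)" if "x \<in> carrier R" for x i
    using that aR[of i] gR[of "i + 1"] ga[of i] by (simp add: gU_def flip: m_assoc)
  have d_hom: "d i \<in> rhom R (P i) (P (i + 1))" for i
    unfolding d_def
    by (rule rhomI[OF P]) (auto simp: carP P_simps b0 gUR aU aR r_distr m_assoc)
  have im: "d i ` carrier (P i) = b ` {a i \<otimes> x | x. x \<in> carrier R}" for i
  proof (intro equalityI subsetI)
    fix q assume "q \<in> b ` {a i \<otimes> x | x. x \<in> carrier R}"
    then obtain x where x: "x \<in> carrier R" "q = b (a i \<otimes> x)" by auto
    have gx: "g i \<otimes> x \<in> gU i" using x gR[of i] gg[of i] by (simp add: gU_def flip: m_assoc)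
    have "q = d i (b (g i \<otimes> x))"
      using x gR[of i] aR[of i] ag[of i] by (simp add: d_app[OF gx] flip: m_assoc)
    then show "q \<in> d i ` carrier (P i)" using gx by (simp add: carP)
  qed (use gUR in \<open>fastforce simp: carP d_app\<close>)
  have "totally_exact R P d"
    unfolding totally_exact_def
  proof (intro conjI allI P_fg d_hom)
    fix i
    show ex: "d i ` carrier (P i) = {x \<in> carrier (P (i + 1)). d (i + 1) x = \<zero>\<^bsub>P (i + 1 + 1)\<^esub>}"
    proof (intro equalityI subsetI)
      fix q assume "q \<in> d i ` carrier (P i)"
      then obtain x where x: "x \<in> carrier R" "q = b (a i \<otimes> x)" unfolding im by auto
      have "a (i + 1) \<otimes> (a i \<otimes> x) = \<zero>" using x aR aa[of i] by (simp flip: m_assoc)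
      then show "q \<in> {x \<in> carrier (P (i + 1)). d (i + 1) x = \<zero>\<^bsub>P (i + 1 + 1)\<^esub>}"
        using x aU[OF x(1)] by (simp add: carP d_app P_simps)
    next
      fix q assume "q \<in> {x \<in> carrier (P (i + 1)). d (i + 1) x = \<zero>\<^bsub>P (i + 1 + 1)\<^esub>}"
      then obtain x where x: "x \<in> gU (i + 1)" "q = b x" "a (i + 1) \<otimes> x = \<zero>"
        by (auto simp: carP d_app P_simps b_inj)
      then obtain y where "y \<in> carrier R" "x = a i \<otimes> y" using right_exact[of x i] by (auto simp: gU_def)
      then show "q \<in> d i ` carrier (P i)" unfolding im using x by blast
    qed
    show "(\<lambda>f. compose (carrier (P (i + 1))) f (d (i + 1))) ` dual R (P (i + 1 + 1)) =
      {f \<in> dual R (P (i + 1)). \<forall>x\<in>carrier (P i). f (d i x) = \<zero>}"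
    proof (intro equalityI subsetI)
      fix f assume "f \<in> (\<lambda>f. compose (carrier (P (i + 1))) f (d (i + 1))) ` dual R (P (i + 1 + 1))"
      then obtain h where h: "h \<in> dual R (P (i + 1 + 1))" "f = compose (carrier (P (i + 1))) h (d (i + 1))" by auto
      have h0: "h \<zero>\<^bsub>P (i + 1 + 1)\<^esub> = \<zero>"
        using rhom_zero[OF P regular_right_module[OF ring_axioms] h(1)] by simp
      have "f (d i x) = \<zero>" if "x \<in> carrier (P i)" for x
      proof -
        have "d i x \<in> {x \<in> carrier (P (i + 1)). d (i + 1) x = \<zero>\<^bsub>P (i + 1 + 1)\<^esub>}"
          using that unfolding ex[symmetric] by simp
        then show ?thesis using h0 by (simp add: h(2) compose_def)
      qed
      then show "f \<in> {f \<in> dual R (P (i + 1)). \<forall>x\<in>carrier (P i). f (d i x) = \<zero>}"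
        using rhom_compose[OF P d_hom h(1)] h(2) by simp
    next
      fix f assume "f \<in> {f \<in> dual R (P (i + 1)). \<forall>x\<in>carrier (P i). f (d i x) = \<zero>}"
      then have f: "f \<in> dual R (P (i + 1))" and fd: "\<And>x. x \<in> carrier (P i) \<Longrightarrow> f (d i x) = \<zero>" by auto
      note f' = rhomD[OF f, simplified]
      \<comment> \<open>A functional on the principal module is left multiplication by its value at
        the generating idempotent.\<close>
      define y where "y = f (b (g (i + 1)))"
      have bg: "b (g (i + 1)) \<in> carrier (P (i + 1))" using gR gg by (simp add: carP gU_def)
      have yR: "y \<in> carrier R" using f'(1)[OF bg] by (simp add: y_def)
      have fb: "f (b x) = y \<otimes> x" if "x \<in> gU (i + 1)" for x
        using f'(3)[OF bg gUR[OF that]] that by (simp add: P_simps y_def gU_def)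
      have "y \<otimes> g (i + 1) = y" using fb[of "g (i + 1)"] gR gg by (simp add: gU_def y_def)
      moreover have "y \<otimes> a i = \<zero>"
      proof -
        have "b (g i) \<in> carrier (P i)" using gR gg by (simp add: carP gU_def)
        then have "f (d i (b (g i))) = \<zero>" by (rule fd)
        then have "f (b (a i)) = \<zero>" using gR[of i] gg[of i] ag[of i] by (simp add: d_app gU_def)
        then show ?thesis using fb[of "a i"] aR[of i] ga[of i] by (simp add: gU_def)
      qed
      ultimately obtain z where z: "z \<in> carrier R" "y = z \<otimes> a (i + 1)" using left_exact[OF yR] by blast
      let ?h = "\<lambda>q\<in>carrier (P (i + 1 + 1)). z \<otimes> q 0"
      have h: "?h \<in> dual R (P (i + 1 + 1))"
        by (rule rhomI[OF P]) (use z in \<open>auto simp: carP P_simps b0 gUR r_distr m_assoc\<close>)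
      have "f = compose (carrier (P (i + 1))) ?h (d (i + 1))"
      proof (rule rhom_ext[OF f rhom_compose[OF P d_hom h]])
        fix q assume "q \<in> carrier (P (i + 1))"
        then obtain x where x: "x \<in> gU (i + 1)" "q = b x" by (auto simp: carP)
        then show "f q = compose (carrier (P (i + 1))) ?h (d (i + 1)) q"
          using aU[OF gUR[OF x(1)], of "i + 1"] z aR[of "i + 1"] gUR[OF x(1)]
          by (simp add: compose_def carP fb d_app b0 m_assoc)
      qed
      with h show "f \<in> (\<lambda>f. compose (carrier (P (i + 1))) f (d (i + 1))) ` dual R (P (i + 1 + 1))" by blast
    qed
  qed
  note te = this
  let ?G = "image_module P d i"
  have G: "right_module R ?G" by (rule te_image_module[OF te])
  have "gorenstein_projective R ?G"
    unfolding gorenstein_projective_def using G te rmod_iso_refl[OF G] by blast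
  moreover have "rmod_iso R ?G (rideal (a i))"
  proof (rule rmod_isoI)
    show "(\<lambda>q\<in>carrier ?G. q 0) \<in> rhom R ?G (rideal (a i))"
      by (rule rhomI[OF G]) (auto simp: im b0 P_simps)
    show "(\<lambda>x\<in>carrier (rideal (a i)). b x) \<in> rhom R (rideal (a i)) ?G"
      by (rule rhomI[OF principal_right_module[OF aR]]) (auto simp: im P_simps)
  qed (auto simp: im b0)
  ultimately show ?thesis using that by blast
qed

section \<open>Direct sums and endomorphism algebras\<close>

lemma direct_sum_cong:
  assumes eq: "\<And>j. j \<in> J \<Longrightarrow> M j = N j" shows "direct_sum J M = direct_sum J N"
proof -
  have "(\<Pi>\<^sub>E i\<in>J. carrier (M i)) = (\<Pi>\<^sub>E i\<in>J. carrier (N i))" by (rule PiE_cong) (simp add: eq)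
  moreover have "{i \<in> J. x i \<noteq> \<zero>\<^bsub>M i\<^esub>} = {i \<in> J. x i \<noteq> \<zero>\<^bsub>N i\<^esub>}" for x using eq by auto
  moreover have "(\<lambda>i\<in>J. \<zero>\<^bsub>M i\<^esub>) = (\<lambda>i\<in>J. \<zero>\<^bsub>N i\<^esub>)" by (rule restrict_ext) (simp add: eq)
  moreover have "(\<lambda>i\<in>J. x i \<oplus>\<^bsub>M i\<^esub> y i) = (\<lambda>i\<in>J. x i \<oplus>\<^bsub>N i\<^esub> y i)" for x y by (rule restrict_ext) (simp add: eq)
  moreover have "(\<lambda>i\<in>J. x i \<lhd>\<^bsub>M i\<^esub> a) = (\<lambda>i\<in>J. x i \<lhd>\<^bsub>N i\<^esub> a)" for x a by (rule restrict_ext) (simp add: eq)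
  ultimately show ?thesis unfolding direct_sum_def by simp
qed

lemma direct_sum_isoI:
  assumes M: "right_module A M" and fin: "finite Y" and \<pi>: "\<And>y. y \<in> Y \<Longrightarrow> \<pi> y \<in> rhom A M (L y)"
    and surj: "\<And>q. q \<in> (\<Pi>\<^sub>E y\<in>Y. carrier (L y)) \<Longrightarrow> \<exists>m\<in>carrier M. \<forall>y\<in>Y. \<pi> y m = q y"
    and inj: "\<And>m m'. \<lbrakk>m \<in> carrier M; m' \<in> carrier M; \<And>y. y \<in> Y \<Longrightarrow> \<pi> y m = \<pi> y m'\<rbrakk> \<Longrightarrow> m = m'"
  shows "rmod_iso A M (direct_sum Y L)"
proof -
  note \<pi>' = rhomD[OF \<pi>] and car = carrier_direct_sum_finite[OF fin, of L]
  define f where "f m = (\<lambda>y\<in>Y. \<pi> y m)" for m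
  have fc: "f m \<in> carrier (direct_sum Y L)" if "m \<in> carrier M" for m using that \<pi>' by (simp add: car f_def)
  have "restrict f (carrier M) \<in> rhom A M (direct_sum Y L)"
    by (rule rhomI[OF M fc]) (auto simp: f_def \<pi>' intro!: restrict_ext)
  moreover have "inj_on f (carrier M)"
  proof (rule inj_onI)
    fix m m' assume m: "m \<in> carrier M" "m' \<in> carrier M" and eq: "f m = f m'"
    have "\<pi> y m = \<pi> y m'" if "y \<in> Y" for y using fun_cong[OF eq, of y] that by (simp add: f_def)
    then show "m = m'" by (rule inj[OF m])
  qed
  moreover have "q \<in> f ` carrier M" if q: "q \<in> carrier (direct_sum Y L)" for q
  proof -
    obtain m where m: "m \<in> carrier M" "\<forall>y\<in>Y. \<pi> y m = q y" using surj q unfolding car by blast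
    have "f m = q"
      by (rule extensionalityI[of _ Y]) (use m(2) q in \<open>auto simp: f_def car PiE_def\<close>)
    then show ?thesis using m(1) by blast
  qed
  ultimately show ?thesis using fc unfolding rmod_iso_def
    by (intro bexI[of _ "restrict f (carrier M)"]) (auto simp: bij_betw_def)
qed

text \<open>Conjugation by the isomorphism. It respects scalars because they act through elements of
  \<open>A\<close>, as \<open>sc\<close> guarantees, and module homomorphisms commute with
  these.\<close>

lemma algebra_iso_End:
  assumes M: "right_module A M" and iso: "rmod_iso A M N"
    and sc: "\<And>c. c \<odot>\<^bsub>A\<^esub> \<one>\<^bsub>A\<^esub> \<in> carrier A"
  shows "algebra_iso (End_algebra A M) (End_algebra A N)"
proof -
  interpret M: right_module A M by fact
  obtain f g where f: "f \<in> rhom A M N" and g: "g \<in> rhom A N M"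
    and gf: "\<And>x. x \<in> carrier M \<Longrightarrow> g (f x) = x" and fg: "\<And>y. y \<in> carrier N \<Longrightarrow> f (g y) = y"
    using rmod_iso_inverse[OF M iso] by blast
  note f' = rhomD[OF f] and g' = rhomD[OF g]
  \<comment> \<open>Closure of \<open>N\<close> under its operations is carried over from
    \<open>M\<close> through \<open>g\<close> and \<open>f\<close>.\<close>
  have Nc: "x \<oplus>\<^bsub>N\<^esub> y \<in> carrier N" if "x \<in> carrier N" "y \<in> carrier N" for x y
    using f'(1)[of "g x \<oplus>\<^bsub>M\<^esub> g y"] that by (simp add: f' g' fg)
  have Nr: "x \<lhd>\<^bsub>N\<^esub> a \<in> carrier N" if "x \<in> carrier N" "a \<in> carrier A" for x a
    using f'(1)[of "g x \<lhd>\<^bsub>M\<^esub> a"] that by (simp add: f' g' fg M.ract_closed)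
  define \<phi> where "\<phi> u = (\<lambda>y\<in>carrier N. f (u (g y)))" for u
  define \<psi> where "\<psi> v = (\<lambda>x\<in>carrier M. g (v (f x)))" for v
  have \<phi>: "\<phi> u \<in> rhom A N N" if "u \<in> rhom A M M" for u
    using rhomD[OF that] by (auto simp: rhom_def \<phi>_def f' g' Nc Nr)
  have \<psi>: "\<psi> v \<in> rhom A M M" if "v \<in> rhom A N N" for v
    using rhomD[OF that] by (auto simp: rhom_def \<psi>_def f' g' M.ract_closed)
  have "\<phi> \<in> ring_iso (End_algebra A M) (End_algebra A N)"
    unfolding ring_iso_def
  proof (intro CollectI conjI ring_hom_memI)
    fix u v assume "u \<in> carrier (End_algebra A M)" "v \<in> carrier (End_algebra A M)"
    then have u: "u \<in> rhom A M M" and v: "v \<in> rhom A M M" by (simp_all add: End_algebra_def)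
    show "\<phi> u \<in> carrier (End_algebra A N)" using \<phi>[OF u] by (simp add: End_algebra_def)
    show "\<phi> (u \<otimes>\<^bsub>End_algebra A M\<^esub> v) = \<phi> u \<otimes>\<^bsub>End_algebra A N\<^esub> \<phi> v"
      using rhomD(1)[OF u] rhomD(1)[OF v]
      by (auto simp: End_algebra_def \<phi>_def compose_def f' g' gf intro!: restrict_ext)
    show "\<phi> (u \<oplus>\<^bsub>End_algebra A M\<^esub> v) = \<phi> u \<oplus>\<^bsub>End_algebra A N\<^esub> \<phi> v"
      using rhomD(1)[OF u] rhomD(1)[OF v]
      by (auto simp: End_algebra_def \<phi>_def f' g' intro!: restrict_ext)
  next
    show "\<phi> \<one>\<^bsub>End_algebra A M\<^esub> = \<one>\<^bsub>End_algebra A N\<^esub>"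
      by (auto simp: End_algebra_def \<phi>_def g' fg intro!: restrict_ext)
    show "bij_betw \<phi> (carrier (End_algebra A M)) (carrier (End_algebra A N))"
    proof (rule bij_betw_byWitness[of _ \<psi>])
      show "\<forall>u\<in>carrier (End_algebra A M). \<psi> (\<phi> u) = u"
      proof
        fix u assume "u \<in> carrier (End_algebra A M)"
        then have u: "u \<in> rhom A M M" by (simp add: End_algebra_def)
        show "\<psi> (\<phi> u) = u"
          by (rule rhom_ext[OF \<psi>[OF \<phi>[OF u]] u]) (use rhomD(1)[OF u] in \<open>simp add: \<psi>_def \<phi>_def f' gf\<close>)
      qed
      show "\<forall>u\<in>carrier (End_algebra A N). \<phi> (\<psi> u) = u"
      proof
        fix u assume "u \<in> carrier (End_algebra A N)"
        then have u: "u \<in> rhom A N N" by (simp add: End_algebra_def)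
        show "\<phi> (\<psi> u) = u"
          by (rule rhom_ext[OF \<phi>[OF \<psi>[OF u]] u]) (use rhomD(1)[OF u] in \<open>simp add: \<psi>_def \<phi>_def g' fg\<close>)
      qed
    qed (use \<phi> \<psi> in \<open>auto simp: End_algebra_def\<close>)
  qed
  moreover have "\<phi> (c \<odot>\<^bsub>End_algebra A M\<^esub> u) = c \<odot>\<^bsub>End_algebra A N\<^esub> \<phi> u"
    if "u \<in> carrier (End_algebra A M)" for c u
  proof -
    from that have u: "u \<in> rhom A M M" by (simp add: End_algebra_def)
    show ?thesis using rhomD(1)[OF u] sc[of c]
      by (auto simp: End_algebra_def \<phi>_def f' g' intro!: restrict_ext)
  qed
  ultimately show ?thesis unfolding algebra_iso_def by blast
qed

section \<open>Quadratic monomial algebras\<close>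

text \<open>Composability of consecutive arrows is left to \<open>ok\<close>, which implies it by
  \<open>ok_comp\<close>. The starting vertex carries information only for trivial paths and is
  otherwise forced.\<close>

definition nonzero_paths :: "('v, 'e) pre_digraph \<Rightarrow> ('e \<Rightarrow> 'e \<Rightarrow> bool) \<Rightarrow> ('v, 'e) qpath set" where
  "nonzero_paths Q ok = {(u, p). (p = [] \<longrightarrow> u \<in> verts Q) \<and> (p \<noteq> [] \<longrightarrow> u = tail Q (hd p)) \<and>
     set p \<subseteq> arcs Q \<and> successively ok p}"

definition path_end :: "('v, 'e) pre_digraph \<Rightarrow> 'v \<Rightarrow> 'e list \<Rightarrow> 'v" where
  "path_end Q u p = (if p = [] then u else head Q (last p))"

text \<open>\<open>ok a b\<close> means that the path \<open>ab\<close> exists and is nonzero.\<close>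

locale quadratic_relations = fin_digraph Q
  for Q :: "('v, 'e) pre_digraph" +
  fixes ok :: "'e \<Rightarrow> 'e \<Rightarrow> bool"
  assumes ok_comp: "\<lbrakk>a \<in> arcs Q; b \<in> arcs Q; ok a b\<rbrakk> \<Longrightarrow> head Q a = tail Q b"
begin

abbreviation "nz \<equiv> nonzero_paths Q ok"

lemma nz_Nil [simp]: "(u, []) \<in> nz \<longleftrightarrow> u \<in> verts Q"
  by (simp add: nonzero_paths_def)

lemma nz_Cons: "(u, a # q) \<in> nz \<longleftrightarrow> a \<in> arcs Q \<and> u = tail Q a \<and> (head Q a, q) \<in> nz \<and> (q \<noteq> [] \<longrightarrow> ok a (hd q))"
  by (cases q) (auto simp: nonzero_paths_def ok_comp)

lemma nz_snoc: "(u, q @ [a]) \<in> nz \<longleftrightarrow> a \<in> arcs Q \<and> (u, q) \<in> nz \<and> path_end Q u q = tail Q a \<and> (q \<noteq> [] \<longrightarrow> ok (last q) a)"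
proof (induction q arbitrary: u)
  case (Cons b q)
  then show ?case by (auto simp: nz_Cons path_end_def ok_comp)
qed (auto simp: nz_Cons path_end_def)

lemma nz_single: "(u, [a]) \<in> nz \<longleftrightarrow> a \<in> arcs Q \<and> u = tail Q a"
  by (auto simp: nz_Cons)

lemma nz_arcs: "(u, p) \<in> nz \<Longrightarrow> set p \<subseteq> arcs Q"
  by (simp add: nonzero_paths_def)

lemma nz_start: "(u, p) \<in> nz \<Longrightarrow> u \<in> verts Q"
  by (cases p) (auto simp: nz_Cons)

lemma nz_take: "(u, p) \<in> nz \<Longrightarrow> (u, take i p) \<in> nz"
proof (induction p arbitrary: u i)
  case (Cons a p)
  have "(u, take (Suc j) (a # p)) \<in> nz" for j
    using Cons.prems Cons.IH[of "head Q a" j] by (cases p; cases j) (auto simp: nz_Cons)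
  then show ?case using nz_start[OF Cons.prems] by (cases i) auto
qed simp

lemma nz_drop: "(u, p) \<in> nz \<Longrightarrow> (path_end Q u (take i p), drop i p) \<in> nz"
proof (induction p arbitrary: u i)
  case (Cons a p)
  have "path_end Q u (take (Suc j) (a # p)) = path_end Q (head Q a) (take j p)" for j
    by (cases "take j p") (auto simp: path_end_def)
  then show ?case using Cons by (cases i) (auto simp: nz_Cons path_end_def)
qed (simp add: path_end_def)

lemma nz_end: "(u, p) \<in> nz \<Longrightarrow> path_end Q u p \<in> verts Q"
  using nz_drop[of u p "length p"] by simp

end

text \<open>\<open>cf x p\<close> is the coefficient of \<open>x\<close> at the path \<open>p\<close>.\<close>

locale quadratic_monomial_algebra = quadratic_relations Q ok + R?: ring R
  for Q :: "('v, 'e) pre_digraph" and ok and R :: "('a, 'b) ring_scheme" (structure) +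
  fixes cf :: "'a \<Rightarrow> ('v, 'e) qpath \<Rightarrow> 'k::field"
  assumes finite_nonzero_paths: "finite nz"
    and cf_bij: "bij_betw cf (carrier R) {f. \<forall>p. p \<notin> nz \<longrightarrow> f p = 0}"
    and cf_add: "\<lbrakk>x \<in> carrier R; y \<in> carrier R\<rbrakk> \<Longrightarrow> cf (x \<oplus> y) q = cf x q + cf y q"
    and cf_one: "cf \<one> (u, p) = (if p = [] \<and> u \<in> verts Q then 1 else 0)"
    and cf_mult: "\<lbrakk>x \<in> carrier R; y \<in> carrier R; (u, p) \<in> nz\<rbrakk> \<Longrightarrow>
      cf (x \<otimes> y) (u, p) = (\<Sum>i\<le>length p. cf x (u, take i p) * cf y (path_end Q u (take i p), drop i p))"
begin

lemma cf_outside: "\<lbrakk>x \<in> carrier R; p \<notin> nz\<rbrakk> \<Longrightarrow> cf x p = 0"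
  using bij_betw_imp_surj_on[OF cf_bij] by blast

lemma cf_eqI: "\<lbrakk>x \<in> carrier R; y \<in> carrier R; \<And>u p. (u, p) \<in> nz \<Longrightarrow> cf x (u, p) = cf y (u, p)\<rbrakk> \<Longrightarrow> x = y"
proof -
  assume *: "x \<in> carrier R" "y \<in> carrier R" "\<And>u p. (u, p) \<in> nz \<Longrightarrow> cf x (u, p) = cf y (u, p)"
  have "cf x = cf y"
  proof
    fix p :: "('v, 'e) qpath"
    show "cf x p = cf y p" using * cf_outside by (cases p; cases "p \<in> nz") auto
  qed
  then show ?thesis using cf_bij * by (auto simp: bij_betw_def inj_on_def)
qed

text \<open>Coefficients prescribed outside \<open>nz\<close> are discarded, so that elements can be
  given by formulas that make sense for all paths.\<close>

definition elem :: "(('v, 'e) qpath \<Rightarrow> 'k) \<Rightarrow> 'a" where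
  "elem f = inv_into (carrier R) cf (\<lambda>p. if p \<in> nz then f p else 0)"

lemma elem_closed [simp]: "elem f \<in> carrier R"
  and cf_elem [simp]: "cf (elem f) p = (if p \<in> nz then f p else 0)"
proof -
  let ?f = "\<lambda>p. if p \<in> nz then f p else 0"
  have "?f \<in> cf ` carrier R" using cf_bij by (auto simp: bij_betw_def)
  then show "elem f \<in> carrier R" "cf (elem f) p = ?f p"
    unfolding elem_def by (auto simp: inv_into_into f_inv_into_f)
qed

lemma cf_zero [simp]: "cf \<zero> p = 0"
  using cf_add[of \<zero> \<zero> p] by (metis R.r_zero R.zero_closed add_cancel_right_right)

lemma cf_minus: "x \<in> carrier R \<Longrightarrow> cf (\<ominus> x) p = - cf x p"
  using cf_add[of x "\<ominus> x" p] by (simp add: r_neg eq_neg_iff_add_eq_0 add.commute)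

lemma cf_diff: "\<lbrakk>x \<in> carrier R; y \<in> carrier R\<rbrakk> \<Longrightarrow> cf (x \<ominus> y) p = cf x p - cf y p"
  by (simp add: minus_eq cf_add cf_minus)

definition idem :: "'v \<Rightarrow> 'a" where "idem v = elem (\<lambda>p. if p = (v, []) then 1 else 0)"

definition arr :: "'e \<Rightarrow> 'a" where "arr a = elem (\<lambda>p. if p = (tail Q a, [a]) then 1 else 0)"

lemma idem_closed [simp]: "idem v \<in> carrier R" and arr_closed [simp]: "arr a \<in> carrier R"
  by (simp_all add: idem_def arr_def)

lemma cf_idem: "cf (idem v) (u, p) = (if v \<in> verts Q \<and> u = v \<and> p = [] then 1 else 0)"
  by (auto simp: idem_def)

lemma cf_arr: "cf (arr a) (u, p) = (if a \<in> arcs Q \<and> u = tail Q a \<and> p = [a] then 1 else 0)"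
  by (auto simp: arr_def nz_single)

lemma cf_mult_Nil: "\<lbrakk>x \<in> carrier R; y \<in> carrier R\<rbrakk> \<Longrightarrow> cf (x \<otimes> y) (v, []) = cf x (v, []) * cf y (v, [])"
  by (cases "v \<in> verts Q") (simp_all add: cf_mult path_end_def cf_outside)

lemma cf_idem_mult: "x \<in> carrier R \<Longrightarrow> cf (idem v \<otimes> x) (u, p) = (if u = v then cf x (u, p) else 0)"
proof (cases "(u, p) \<in> nz")
  case True
  assume x: "x \<in> carrier R"
  have "cf (idem v \<otimes> x) (u, p) = (\<Sum>i\<le>length p. if i = 0 then (if u = v then cf x (u, p) else 0) else 0)"
    unfolding cf_mult[OF idem_closed x True]
    by (intro sum.cong) (use nz_start[OF True] in \<open>auto simp: cf_idem path_end_def\<close>)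
  then show ?thesis by simp
qed (auto simp: cf_outside)

lemma cf_mult_idem: "x \<in> carrier R \<Longrightarrow> cf (x \<otimes> idem v) (u, p) = (if path_end Q u p = v then cf x (u, p) else 0)"
proof (cases "(u, p) \<in> nz")
  case True
  assume x: "x \<in> carrier R"
  have "cf (x \<otimes> idem v) (u, p) = (\<Sum>i\<le>length p. if i = length p then (if path_end Q u p = v then cf x (u, p) else 0) else 0)"
    unfolding cf_mult[OF x idem_closed True]
    by (intro sum.cong) (use nz_end[OF True] in \<open>auto simp: cf_idem\<close>)
  then show ?thesis by simp
qed (auto simp: cf_outside)

lemma cf_arr_mult_Nil: "x \<in> carrier R \<Longrightarrow> cf (arr a \<otimes> x) (u, []) = 0"
  by (simp add: cf_mult_Nil cf_arr)

lemma cf_mult_arr_Nil: "x \<in> carrier R \<Longrightarrow> cf (x \<otimes> arr a) (u, []) = 0"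
  by (simp add: cf_mult_Nil cf_arr)

lemma cf_arr_mult_Cons:
  assumes x: "x \<in> carrier R" and nz: "(u, b # p) \<in> nz"
  shows "cf (arr a \<otimes> x) (u, b # p) = (if b = a then cf x (head Q a, p) else 0)"
proof -
  have b: "b \<in> arcs Q" "u = tail Q b" using nz by (auto simp: nz_Cons)
  have "cf (arr a \<otimes> x) (u, b # p) =
      (\<Sum>i\<le>length (b # p). if i = 1 then (if b = a then cf x (head Q a, p) else 0) else 0)"
    unfolding cf_mult[OF arr_closed x nz]
  proof (rule sum.cong)
    fix i assume "i \<in> {..length (b # p)}"
    show "cf (arr a) (u, take i (b # p)) * cf x (path_end Q u (take i (b # p)), drop i (b # p)) =
      (if i = 1 then (if b = a then cf x (head Q a, p) else 0) else 0)"
    proof (cases i)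
      case (Suc j)
      then show ?thesis
        using b \<open>i \<in> _\<close> by (cases j; cases p) (auto simp: cf_arr path_end_def)
    qed (simp add: cf_arr)
  qed simp
  then show ?thesis by (simp del: sum.atMost_Suc)
qed

lemma cf_mult_arr_snoc:
  assumes x: "x \<in> carrier R" and nz: "(u, p @ [b]) \<in> nz"
  shows "cf (x \<otimes> arr a) (u, p @ [b]) = (if b = a then cf x (u, p) else 0)"
proof -
  have b: "b \<in> arcs Q" "path_end Q u p = tail Q b" using nz by (auto simp: nz_snoc)
  have "cf (x \<otimes> arr a) (u, p @ [b]) =
      (\<Sum>i\<le>length (p @ [b]). if i = length p then (if b = a then cf x (u, p) else 0) else 0)"
    unfolding cf_mult[OF x arr_closed nz]
  proof (rule sum.cong)
    fix i assume "i \<in> {..length (p @ [b])}"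
    then consider "i < length p" | "i = length p" | "i = Suc (length p)" by fastforce
    then show "cf x (u, take i (p @ [b])) * cf (arr a) (path_end Q u (take i (p @ [b])), drop i (p @ [b])) =
      (if i = length p then (if b = a then cf x (u, p) else 0) else 0)"
    proof cases
      case 1
      then have "drop i p @ [b] \<noteq> [a]" by simp
      with 1 show ?thesis by (simp add: cf_arr)
    qed (use b in \<open>auto simp: cf_arr\<close>)
  qed simp
  then show ?thesis by simp
qed

lemma arr_idem: "arr a \<otimes> idem (head Q a) = arr a"
  by (rule cf_eqI) (auto simp: cf_mult_idem cf_arr path_end_def)

lemma idem_arr: "idem (tail Q a) \<otimes> arr a = arr a"
  by (rule cf_eqI) (auto simp: cf_idem_mult cf_arr)

lemma idem_idem: "idem v \<otimes> idem v = idem v"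
  by (rule cf_eqI) (auto simp: cf_idem_mult cf_idem)

lemma arr_mult_arr_zero:
  assumes "\<not> ok a b" shows "arr a \<otimes> arr b = \<zero>"
proof (rule cf_eqI)
  fix u p assume nz: "(u, p) \<in> nz"
  show "cf (arr a \<otimes> arr b) (u, p) = cf \<zero> (u, p)"
  proof (cases p)
    case (Cons c q)
    then show ?thesis using nz assms cf_arr_mult_Cons[of "arr b" u c q a] by (auto simp: cf_arr nz_Cons)
  qed (simp add: cf_arr_mult_Nil)
qed auto

section \<open>Powers of the radical and units\<close>

definition rad :: "nat \<Rightarrow> 'a set" where
  "rad n = {x \<in> carrier R. \<forall>u p. length p < n \<longrightarrow> cf x (u, p) = 0}"

lemma rad_carrier: "x \<in> rad n \<Longrightarrow> x \<in> carrier R"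
  by (simp add: rad_def)

lemma rad_mono: "x \<in> rad n \<Longrightarrow> m \<le> n \<Longrightarrow> x \<in> rad m"
  by (auto simp: rad_def)

lemma rad_mult:
  assumes x: "x \<in> rad m" and y: "y \<in> rad n" shows "x \<otimes> y \<in> rad (m + n)"
proof -
  have c: "x \<in> carrier R" "y \<in> carrier R" using x y by (auto simp: rad_def)
  have "cf (x \<otimes> y) (u, p) = 0" if "length p < m + n" for u p
  proof (cases "(u, p) \<in> nz")
    case True
    have "cf x (u, take i p) = 0 \<or> cf y (path_end Q u (take i p), drop i p) = 0" if "i \<le> length p" for i
    proof (cases "i < m")
      case True then show ?thesis using x that by (auto simp: rad_def)
    next
      case False then show ?thesis using y that \<open>length p < m + n\<close> by (auto simp: rad_def)
    qed
    then show ?thesis unfolding cf_mult[OF c True] by (intro sum.neutral) auto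
  qed (use c in \<open>simp add: cf_outside\<close>)
  then show ?thesis using c by (simp add: rad_def)
qed

lemma rad_left_mult: "x \<in> carrier R \<Longrightarrow> y \<in> rad n \<Longrightarrow> x \<otimes> y \<in> rad n"
  using rad_mult[of x 0 y n] by (simp add: rad_def)

lemma rad_nilpotent: obtains n where "\<And>x m. x \<in> rad m \<Longrightarrow> n \<le> m \<Longrightarrow> x = \<zero>"
proof
  let ?n = "Suc (Max ((length \<circ> snd) ` nz))"
  fix x m assume x: "x \<in> rad m" and m: "?n \<le> m"
  show "x = \<zero>"
  proof (rule cf_eqI)
    fix u p assume "(u, p) \<in> nz"
    then have "length p \<le> Max ((length \<circ> snd) ` nz)"
      using finite_nonzero_paths by (intro Max_ge) (auto intro!: image_eqI[of _ _ "(u, p)"])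
    then show "cf x (u, p) = cf \<zero> (u, p)" using x m by (auto simp: rad_def)
  qed (use x in \<open>auto simp: rad_def\<close>)
qed

text \<open>Newton iteration. It starts with the inverse of the diagonal part of \<open>x\<close>;
  if \<open>\<one> \<ominus> w \<otimes> x\<close> is \<open>r\<close>, then replacing
  \<open>w\<close> by \<open>(\<one> \<oplus> r) \<otimes> w\<close> turns the error into
  \<open>r \<otimes> r\<close>. Nilpotency of the radical ends the iteration.\<close>

lemma left_unitI:
  assumes x: "x \<in> carrier R" and nz: "\<And>v. v \<in> verts Q \<Longrightarrow> cf x (v, []) \<noteq> 0"
  shows "\<exists>w\<in>carrier R. w \<otimes> x = \<one>"
proof -
  define c where "c = elem (\<lambda>(u, p). if p = [] then 1 / cf x (u, []) else 0)"
  have c: "c \<in> carrier R" by (simp add: c_def)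
  have "\<exists>w\<in>carrier R. \<one> \<ominus> w \<otimes> x \<in> rad (Suc n)" for n
  proof (induction n)
    case 0
    have "\<one> \<ominus> c \<otimes> x \<in> rad (Suc 0)"
      using x c nz by (auto simp: rad_def cf_diff cf_one cf_mult_Nil c_def cf_outside)
    then show ?case using c by blast
  next
    case (Suc n)
    then obtain w where w: "w \<in> carrier R" "\<one> \<ominus> w \<otimes> x \<in> rad (Suc n)" by blast
    define r where "r = \<one> \<ominus> w \<otimes> x"
    have r: "r \<in> carrier R" "r \<in> rad (Suc n)" using w x by (simp_all add: r_def)
    have wx: "w \<otimes> x = \<one> \<ominus> r" using w x by (simp add: r_def minus_eq minus_add r_neg1 r_neg2 a_assoc[symmetric] r_neg)
    have "\<one> \<ominus> ((\<one> \<oplus> r) \<otimes> w) \<otimes> x = \<one> \<ominus> (\<one> \<oplus> r) \<otimes> (\<one> \<ominus> r)"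
      using w x r wx by (simp add: m_assoc)
    also have "(\<one> \<oplus> r) \<otimes> (\<one> \<ominus> r) = \<one> \<ominus> r \<otimes> r"
      using r by (simp add: minus_eq l_distr r_distr r_minus minus_add a_assoc r_neg1 r_neg2)
    also have "\<one> \<ominus> (\<one> \<ominus> r \<otimes> r) = r \<otimes> r"
      using r by (simp add: minus_eq minus_add r_neg1 r_neg2)
    finally have "\<one> \<ominus> ((\<one> \<oplus> r) \<otimes> w) \<otimes> x \<in> rad (Suc (Suc n))"
      using rad_mult[OF r(2) r(2)] rad_mono[of "r \<otimes> r" "Suc n + Suc n" "Suc (Suc n)"] by simp
    then show ?case using r w by (intro bexI[of _ "(\<one> \<oplus> r) \<otimes> w"]) auto
  qed
  moreover obtain n where n: "\<And>x m. x \<in> rad m \<Longrightarrow> n \<le> m \<Longrightarrow> x = \<zero>" using rad_nilpotent by blast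
  ultimately obtain w where w: "w \<in> carrier R" "\<one> \<ominus> w \<otimes> x = \<zero>" by (metis le_SucI le_refl)
  then have "w \<otimes> x = \<one>" using x eq_if_diff_zero[of \<one> "w \<otimes> x"] by (simp add: minus_eq)
  then show ?thesis using w by blast
qed

text \<open>A left inverse has nonzero coefficients at the trivial paths as well, so it has a left
  inverse itself, which must be \<open>x\<close>.\<close>

lemma unitI:
  assumes x: "x \<in> carrier R" and nz: "\<And>v. v \<in> verts Q \<Longrightarrow> cf x (v, []) \<noteq> 0"
  obtains w where "w \<in> carrier R" "w \<otimes> x = \<one>" "x \<otimes> w = \<one>"
proof -
  obtain w where w: "w \<in> carrier R" "w \<otimes> x = \<one>" using left_unitI[OF assms] by blast
  have "cf w (v, []) \<noteq> 0" if "v \<in> verts Q" for v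
    using cf_mult_Nil[OF w(1) x, of v] w(2) that by (auto simp: cf_one)
  then obtain y where y: "y \<in> carrier R" "y \<otimes> w = \<one>" using left_unitI[OF w(1)] by blast
  have "y \<otimes> (w \<otimes> x) = (y \<otimes> w) \<otimes> x" using w(1) y(1) x by (simp add: m_assoc)
  then have "y = x" using w y x by simp
  then have "x \<otimes> w = \<one>" using y by simp
  then show ?thesis using that w by blast
qed

section \<open>Extracting the paths with a given first or last arrow\<close>

definition ending :: "'e \<Rightarrow> 'a \<Rightarrow> 'a" where
  "ending a x = elem (\<lambda>(u, p). if p \<noteq> [] \<and> last p = a then cf x (u, p) else 0)"

definition starting :: "'e \<Rightarrow> 'a \<Rightarrow> 'a" where
  "starting a x = elem (\<lambda>(u, p). if p \<noteq> [] \<and> hd p = a then cf x (u, p) else 0)"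

text \<open>This divides by \<open>a\<close> on the right those paths of length at least two that
  end in \<open>a\<close>. It serves to trade a bound on lengths for a better one in
  \<open>reflexive_rad_two_zero\<close>.\<close>

definition strip :: "'e \<Rightarrow> 'a \<Rightarrow> 'a" where
  "strip a x = elem (\<lambda>(u, p). if p \<noteq> [] then cf x (u, p @ [a]) else 0)"

lemma ending_closed [simp]: "ending a x \<in> carrier R"
  and starting_closed [simp]: "starting a x \<in> carrier R"
  and strip_closed [simp]: "strip a x \<in> carrier R"
  by (simp_all add: ending_def starting_def strip_def)

lemma cf_ending: "x \<in> carrier R \<Longrightarrow> cf (ending a x) (u, p) = (if p \<noteq> [] \<and> last p = a then cf x (u, p) else 0)"
  by (simp add: ending_def cf_outside)

lemma cf_starting: "x \<in> carrier R \<Longrightarrow> cf (starting a x) (u, p) = (if p \<noteq> [] \<and> hd p = a then cf x (u, p) else 0)"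
  by (simp add: starting_def cf_outside)

lemma cf_strip: "x \<in> carrier R \<Longrightarrow> cf (strip a x) (u, p) = (if p \<noteq> [] then cf x (u, p @ [a]) else 0)"
  by (auto simp: strip_def cf_outside nz_snoc)

lemma ending_add: "\<lbrakk>x \<in> carrier R; y \<in> carrier R\<rbrakk> \<Longrightarrow> ending a (x \<oplus> y) = ending a x \<oplus> ending a y"
  by (rule cf_eqI) (auto simp: cf_ending cf_add)

lemma starting_add: "\<lbrakk>x \<in> carrier R; y \<in> carrier R\<rbrakk> \<Longrightarrow> starting a (x \<oplus> y) = starting a x \<oplus> starting a y"
  by (rule cf_eqI) (auto simp: cf_starting cf_add)

lemma strip_add: "\<lbrakk>x \<in> carrier R; y \<in> carrier R\<rbrakk> \<Longrightarrow> strip a (x \<oplus> y) = strip a x \<oplus> strip a y"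
  by (rule cf_eqI) (auto simp: cf_strip cf_add)

text \<open>For \<open>x\<close> in the radical, every contributing cut of a path leaves a nonempty
  second part, and this part contains the last arrow; so \<open>b\<close> cannot influence which
  arrow comes last.\<close>

lemma ending_left_mult:
  assumes b: "b \<in> carrier R" and x: "x \<in> rad 1"
  shows "ending a (b \<otimes> x) = b \<otimes> ending a x"
proof (rule cf_eqI)
  have xR: "x \<in> carrier R" and x0: "\<And>u. cf x (u, []) = 0" using x by (auto simp: rad_def)
  fix u p assume nz: "(u, p) \<in> nz"
  show "cf (ending a (b \<otimes> x)) (u, p) = cf (b \<otimes> ending a x) (u, p)"
  proof (cases "p \<noteq> [] \<and> last p = a")
    case True
    have "cf x (path_end Q u (take i p), drop i p) = cf (ending a x) (path_end Q u (take i p), drop i p)"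
      if "i \<le> length p" for i
      using True that by (cases "i = length p") (auto simp: cf_ending xR x0)
    then show ?thesis using True b xR nz by (simp add: cf_ending cf_mult)
  next
    case False
    have "cf (ending a x) (path_end Q u (take i p), drop i p) = 0" if "i \<le> length p" for i
      using False that by (cases "i = length p") (auto simp: cf_ending xR)
    then show ?thesis using False b xR nz by (auto simp: cf_ending[of "b \<otimes> x"] cf_mult)
  qed
qed (use b rad_carrier[OF x] in auto)

lemma starting_right_mult:
  assumes b: "b \<in> carrier R" and x: "x \<in> rad 1"
  shows "starting a (x \<otimes> b) = starting a x \<otimes> b"
proof (rule cf_eqI)
  have xR: "x \<in> carrier R" and x0: "\<And>u. cf x (u, []) = 0" using x by (auto simp: rad_def)
  fix u p assume nz: "(u, p) \<in> nz"
  show "cf (starting a (x \<otimes> b)) (u, p) = cf (starting a x \<otimes> b) (u, p)"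
  proof (cases "p \<noteq> [] \<and> hd p = a")
    case True
    have "cf x (u, take i p) = cf (starting a x) (u, take i p)" for i
      using True by (cases "i = 0") (auto simp: cf_starting xR x0)
    then show ?thesis using True b xR nz by (simp add: cf_starting cf_mult)
  next
    case False
    have "cf (starting a x) (u, take i p) = 0" for i
      using False by (cases "i = 0") (auto simp: cf_starting xR)
    then show ?thesis using False b xR nz by (auto simp: cf_starting[of "x \<otimes> b"] cf_mult)
  qed
qed (use b rad_carrier[OF x] in auto)

text \<open>A path \<open>q\<close> with \<open>qa\<close> nonzero stays such when it is extended to the left; this uses that the relations are quadratic.\<close>

lemma strip_left_mult:
  assumes b: "b \<in> carrier R" and x: "x \<in> rad 2"
  shows "strip a (b \<otimes> x) = b \<otimes> strip a x"
proof (rule cf_eqI)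
  have xR: "x \<in> carrier R" and x0: "\<And>u p. length p \<le> 1 \<Longrightarrow> cf x (u, p) = 0" using x by (auto simp: rad_def)
  fix u p assume nz: "(u, p) \<in> nz"
  show "cf (strip a (b \<otimes> x)) (u, p) = cf (b \<otimes> strip a x) (u, p)"
  proof (cases "p \<noteq> [] \<and> (u, p @ [a]) \<in> nz")
    case True
    let ?t = "\<lambda>i. cf b (u, take i (p @ [a])) * cf x (path_end Q u (take i (p @ [a])), drop i (p @ [a]))"
    have "cf (strip a (b \<otimes> x)) (u, p) = (\<Sum>i\<le>Suc (length p). ?t i)"
      using True b xR by (simp add: cf_strip cf_mult del: sum.atMost_Suc)
    also have "\<dots> = (\<Sum>i\<le>length p. ?t i)" by (simp add: x0)
    also have "\<dots> = (\<Sum>i\<le>length p. cf b (u, take i p) * cf (strip a x) (path_end Q u (take i p), drop i p))"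
    proof (rule sum.cong)
      fix i assume "i \<in> {..length p}"
      then show "?t i = cf b (u, take i p) * cf (strip a x) (path_end Q u (take i p), drop i p)"
        by (cases "i = length p") (auto simp: cf_strip xR x0)
    qed simp
    also have "\<dots> = cf (b \<otimes> strip a x) (u, p)" using b nz by (simp add: cf_mult)
    finally show ?thesis .
  next
    case False
    have "cf (strip a x) (path_end Q u (take i p), drop i p) = 0" if "i \<le> length p" for i
    proof (cases "i < length p")
      case True
      with False nz have "(path_end Q u (take i p), drop i p @ [a]) \<notin> nz"
        by (auto simp: nz_snoc path_end_def)
      then show ?thesis by (simp add: cf_strip xR cf_outside)
    qed (use that in \<open>simp add: cf_strip xR\<close>)
    moreover have "cf (strip a (b \<otimes> x)) (u, p) = 0" using False b xR by (auto simp: cf_strip cf_outside)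
    ultimately show ?thesis using b nz by (simp add: cf_mult)
  qed
qed (use b rad_carrier[OF x] in auto)

end

section \<open>Indecomposable reflexive modules\<close>

context quadratic_monomial_algebra
begin

lemma starting_eq: "x \<in> carrier R \<Longrightarrow> starting c x = arr c \<otimes> elem (\<lambda>(u, p). if u = head Q c then cf x (tail Q c, c # p) else 0)"
proof (rule cf_eqI)
  fix u p assume x: "x \<in> carrier R" and nz: "(u, p) \<in> nz"
  show "cf (starting c x) (u, p) =
      cf (arr c \<otimes> elem (\<lambda>(u, p). if u = head Q c then cf x (tail Q c, c # p) else 0)) (u, p)"
  proof (cases p)
    case (Cons b q)
    with nz have "(u, b # q) \<in> nz" by simp
    then show ?thesis using x Cons by (auto simp: cf_starting cf_arr_mult_Cons) (auto simp: nz_Cons)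
  qed (simp add: cf_starting x cf_arr_mult_Nil)
qed auto

text \<open>The part ending in \<open>c\<close> is a left multiple of \<open>c\<close>, which is why
  everything annihilated by \<open>c\<close> from the left also annihilates this part.\<close>

lemma ending_eq: "x \<in> carrier R \<Longrightarrow> ending c x = elem (\<lambda>(u, p). cf x (u, p @ [c])) \<otimes> arr c"
proof (rule cf_eqI)
  fix u p assume x: "x \<in> carrier R" and nz: "(u, p) \<in> nz"
  show "cf (ending c x) (u, p) = cf (elem (\<lambda>(u, p). cf x (u, p @ [c])) \<otimes> arr c) (u, p)"
  proof (cases p rule: rev_cases)
    case (snoc q b)
    with nz have "(u, q @ [b]) \<in> nz" by simp
    then show ?thesis using x snoc by (auto simp: cf_ending cf_mult_arr_snoc) (auto simp: nz_snoc)
  qed (simp add: cf_ending x cf_mult_arr_Nil)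
qed auto

lemma starting_eqI:
  assumes "x \<in> carrier R" "\<And>u p. cf x (u, p) \<noteq> 0 \<Longrightarrow> p \<noteq> [] \<and> hd p = c"
  shows "starting c x = x"
  by (rule cf_eqI) (use assms in \<open>auto simp: cf_starting\<close>)

lemma ending_eqI:
  assumes "x \<in> carrier R" "\<And>u p. cf x (u, p) \<noteq> 0 \<Longrightarrow> p \<noteq> [] \<and> last p = c"
  shows "ending c x = x"
  by (rule cf_eqI) (use assms in \<open>auto simp: cf_ending\<close>)

text \<open>With reflexivity, this turns an operation on the values \<open>f m\<close> into an
  operation on elements of \<open>M\<close>. Left linearity of \<open>op\<close> is required only on
  a set \<open>S\<close> containing these values, since the operations on paths are left linear only
  on powers of the radical.\<close>

lemma left_linear_eval:
  assumes M: "right_module R M" and m: "m \<in> carrier M" and fS: "\<And>f. f \<in> dual R M \<Longrightarrow> f m \<in> S"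
    and op: "\<And>x. op x \<in> carrier R" "\<And>x y. x \<in> carrier R \<Longrightarrow> y \<in> carrier R \<Longrightarrow> op (x \<oplus> y) = op x \<oplus> op y"
      "\<And>b x. b \<in> carrier R \<Longrightarrow> x \<in> S \<Longrightarrow> op (b \<otimes> x) = b \<otimes> op x"
  shows "left_linear R M (\<lambda>f. op (f m))"
  unfolding left_linear_def using m fS op rhomD(1)[of _ R M "regular_module R", simplified] by auto

text \<open>For each arrow \<open>a\<close>, stripping \<open>a\<close> from all \<open>f m\<close>
  is evaluation at some \<open>y\<close> in \<open>M\<close>. If all functionals have values in
  \<open>rad (n + 2)\<close>, then so do the stripped values \<open>f y\<close>, and hence
  \<open>f m\<close> lies in \<open>rad (Suc n + 2)\<close>. By nilpotency all functionals vanish,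
  and they separate the elements of \<open>M\<close>.\<close>

lemma reflexive_rad_two_zero:
  assumes M: "right_module R M" and refl: "reflexive R M"
    and rad2: "\<And>f m. f \<in> dual R M \<Longrightarrow> m \<in> carrier M \<Longrightarrow> f m \<in> rad 2"
  shows "carrier M = {\<zero>\<^bsub>M\<^esub>}"
proof -
  have "f m \<in> rad (n + 2)" if "f \<in> dual R M" "m \<in> carrier M" for n f m
    using that
  proof (induction n arbitrary: f m)
    case 0
    then show ?case using rad2[of f m] by (simp add: numeral_2_eq_2)
  next
    case (Suc n)
    have fm: "f m \<in> carrier R" using rhomD(1)[OF Suc.prems] by simp
    have "cf (f m) (u, p) = 0" if "length p < Suc n + 2" for u p
    proof (cases p rule: rev_cases)
      case Nil
      then show ?thesis using rad2[OF Suc.prems] by (auto simp: rad_def)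
    next
      case (snoc q a)
      show ?thesis
      proof (cases "q = []")
        case True
        then show ?thesis using snoc rad2[OF Suc.prems] by (auto simp: rad_def)
      next
        case False
        have "left_linear R M (\<lambda>f. strip a (f m))"
          by (rule left_linear_eval[OF M Suc.prems(2), of "rad 2"])
            (auto simp: strip_add strip_left_mult rad2 Suc.prems)
        then obtain y where y: "y \<in> carrier M" "\<And>f. f \<in> dual R M \<Longrightarrow> strip a (f m) = f y"
          using refl unfolding reflexive_def by blast
        have "cf (f y) (u, q) = 0" using Suc.IH[OF Suc.prems(1) y(1)] that snoc by (auto simp: rad_def)
        then have "cf (strip a (f m)) (u, q) = 0" using y(2)[OF Suc.prems(1)] by simp
        then show ?thesis using False snoc fm by (simp add: cf_strip)
      qed
    qed
    then show ?case using fm by (simp add: rad_def)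
  qed
  moreover obtain n where n: "\<And>x m. x \<in> rad m \<Longrightarrow> n \<le> m \<Longrightarrow> x = \<zero>" using rad_nilpotent by blast
  ultimately have "f m = \<zero>" if "f \<in> dual R M" "m \<in> carrier M" for f m
    using that n[of "f m" "n + 2"] by simp
  then have "m = \<zero>\<^bsub>M\<^esub>" if "m \<in> carrier M" for m
    using refl that unfolding reflexive_def by blast
  moreover have "\<zero>\<^bsub>M\<^esub> \<in> carrier M"
    using M by (simp add: right_module_def abelian_group_def abelian_monoid.zero_closed)
  ultimately show ?thesis by blast
qed

lemma principal_idem_nonzero: "v \<in> verts Q \<Longrightarrow> carrier (rideal (idem v)) \<noteq> {\<zero>}"
proof
  assume v: "v \<in> verts Q" and "carrier (rideal (idem v)) = {\<zero>}"
  moreover have "idem v \<in> carrier (rideal (idem v))" using idem_idem[of v] by force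
  ultimately have "cf (idem v) (v, []) = 0" by simp
  then show False using v by (simp add: cf_idem)
qed

lemma principal_arr_nonzero: "c \<in> arcs Q \<Longrightarrow> carrier (rideal (arr c)) \<noteq> {\<zero>}"
proof
  assume c: "c \<in> arcs Q" and "carrier (rideal (arr c)) = {\<zero>}"
  moreover have "arr c \<in> carrier (rideal (arr c))" using arr_idem[of c] by force
  ultimately have "cf (arr c) (tail Q c, [c]) = 0" by simp
  then show False using c by (simp add: cf_arr)
qed

text \<open>
  If all homomorphisms to \<open>R\<close> have values in the radical, then for each \<open>m\<close> and each arrow \<open>c\<close>
  reflexivity provides an element \<open>m\<^sub>c\<close> such that \<open>f m\<^sub>c\<close> is the part of \<open>f m\<close> ending in \<open>c\<close>, for all
  \<open>f\<close>; it is annihilated by the annihilator of \<open>c\<close>.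
\<close>

lemma indecomposable_reflexive_cases:
  assumes ind: "indecomposable R M" and refl: "reflexive R M"
  shows "(\<exists>v\<in>verts Q. rmod_iso R M (rideal (idem v))) \<or>
    (\<exists>c\<in>arcs Q. rmod_iso R M (rideal (arr c)))"
proof -
  have M: "right_module R M" and M0: "carrier M \<noteq> {\<zero>\<^bsub>M\<^esub>}" using ind by (auto simp: indecomposable_def)
  interpret M: right_module R M by fact
  have fc: "f m \<in> carrier R" if "f \<in> dual R M" "m \<in> carrier M" for f m
    using rhomD(1)[OF that] by simp
  show ?thesis
  proof (cases "\<forall>f\<in>dual R M. \<forall>m\<in>carrier M. f m \<in> rad 1")
    case False
    then obtain f x v where f: "f \<in> dual R M" and x: "x \<in> carrier M" and nz: "cf (f x) (v, []) \<noteq> 0"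
      using fc by (auto simp: rad_def)
    note fx = fc[OF f x]
    have v: "v \<in> verts Q" using nz cf_outside[OF fx, of "(v, [])"] by auto
    \<comment> \<open>The corner element \<open>y\<close> has a nonzero coefficient at the trivial
      path \<open>v\<close>; adding the complementary idempotent makes it a unit \<open>u\<close>,
      whose inverse then inverts \<open>y\<close> inside the corner.\<close>
    define y where "y = idem v \<otimes> f x \<otimes> idem v"
    define u where "u = y \<oplus> (\<one> \<ominus> idem v)"
    have yR: "y \<in> carrier R" and uR: "u \<in> carrier R" using fx by (simp_all add: y_def u_def)
    have "cf u (v', []) \<noteq> 0" if "v' \<in> verts Q" for v'
      using that v nz fx yR by (simp add: u_def cf_add cf_diff cf_one cf_idem) (simp add: y_def cf_mult_Nil cf_idem)
    then obtain w where w: "w \<in> carrier R" "u \<otimes> w = \<one>" using unitI[OF uR] by blast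
    have vy: "idem v \<otimes> y = y" using fx by (simp add: y_def idem_idem flip: m_assoc)
    have "idem v \<otimes> u = y" using yR by (simp add: u_def r_distr minus_eq r_minus idem_idem r_neg vy)
    then have "y \<otimes> w = idem v \<otimes> (u \<otimes> w)" using w(1) uR by (simp flip: m_assoc)
    then have yw: "y \<otimes> w = idem v" using w by simp
    \<comment> \<open>The factor \<open>w\<close> normalizes the value of \<open>g\<close> at
      \<open>x'\<close> to \<open>idem v\<close>. The last factor \<open>idem v\<close> ensures that
      the annihilator of \<open>idem v\<close> kills \<open>x'\<close>.\<close>
    define x' where "x' = x \<lhd>\<^bsub>M\<^esub> (idem v \<otimes> w \<otimes> idem v)"
    have x': "x' \<in> carrier M" using x w by (simp add: x'_def M.ract_closed)
    define g where "g = (\<lambda>m\<in>carrier M. idem v \<otimes> f m)"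
    have g: "g \<in> dual R M" unfolding g_def by (rule dual_left_mult[OF M f]) simp
    have "g x' = idem v \<otimes> (f x \<otimes> (idem v \<otimes> w \<otimes> idem v))"
      using x' x w rhomD(3)[OF f x] by (simp add: g_def x'_def)
    also have "\<dots> = y \<otimes> w \<otimes> idem v" using fx w by (simp add: y_def m_assoc)
    finally have gx': "g x' = idem v" using yw idem_idem by simp
    have "retract R (rideal (idem v)) M"
    proof (rule principal_retract[OF M _ x' _ g _ gx'])
      fix z assume z: "z \<in> carrier R" "idem v \<otimes> z = \<zero>"
      have "x' \<lhd>\<^bsub>M\<^esub> z = x \<lhd>\<^bsub>M\<^esub> (idem v \<otimes> w \<otimes> (idem v \<otimes> z))"
        using x w z(1) by (simp add: x'_def m_assoc flip: M.ract_mult)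
      then show "x' \<lhd>\<^bsub>M\<^esub> z = \<zero>\<^bsub>M\<^esub>" using z x w by (simp add: M.ract_zero)
    qed (use fc[OF f] in \<open>auto simp: g_def\<close>)
    then have "rmod_iso R M (rideal (idem v))"
      using indecomposable_retract[OF ind principal_right_module] principal_idem_nonzero[OF v] by simp
    then show ?thesis using v by blast
  next
    case True
    then have rad1: "f m \<in> rad 1" if "f \<in> dual R M" "m \<in> carrier M" for f m using that by blast
    have "\<exists>f\<in>dual R M. \<exists>m\<in>carrier M. f m \<notin> rad 2"
      using reflexive_rad_two_zero[OF M refl] M0 by blast
    then obtain f x where f: "f \<in> dual R M" and x: "x \<in> carrier M" and "f x \<notin> rad 2" by blast
    note fx = fc[OF f x]
    from \<open>f x \<notin> rad 2\<close> fx obtain u p where p: "length p < 2" "cf (f x) (u, p) \<noteq> 0" by (auto simp: rad_def)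
    moreover have "p \<noteq> []" using p rad1[OF f x] by (auto simp: rad_def)
    ultimately obtain c where c: "p = [c]" by (cases p) auto
    have "(u, [c]) \<in> nz" using p c cf_outside[OF fx] by blast
    then have cQ: "c \<in> arcs Q" and nz: "cf (f x) (tail Q c, [c]) \<noteq> 0" using p c by (auto simp: nz_single)
    have "left_linear R M (\<lambda>f. ending c (f x))"
      by (rule left_linear_eval[OF M x, of "rad 1"]) (use rad1 x in \<open>auto simp: ending_add ending_left_mult\<close>)
    then obtain xc where xc: "xc \<in> carrier M" "\<And>f. f \<in> dual R M \<Longrightarrow> ending c (f x) = f xc"
      using refl unfolding reflexive_def by blast
    have cfx: "cf (f xc) (u, p) = (if p \<noteq> [] \<and> last p = c then cf (f x) (u, p) else 0)" for u p
      using cf_ending[OF fx, of c u p] xc(2)[OF f] by simp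
    \<comment> \<open>\<open>a\<close> is \<open>f xc\<close> with the last arrow \<open>c\<close>
      removed. The default value 1 at the other trivial paths makes \<open>a\<close> a unit and is
      invisible in \<open>a \<otimes> arr c\<close>, because \<open>c\<close> starts at
      \<open>tail Q c\<close>.\<close>
    define a where "a = elem (\<lambda>(u, q). if q = [] then if u = tail Q c then cf (f x) (u, [c]) else 1 else cf (f x) (u, q @ [c]))"
    have aR: "a \<in> carrier R" by (simp add: a_def)
    have fxc: "f xc = a \<otimes> arr c"
    proof (rule cf_eqI[OF fc[OF f xc(1)]])
      fix u p assume nz': "(u, p) \<in> nz"
      show "cf (f xc) (u, p) = cf (a \<otimes> arr c) (u, p)"
      proof (cases p rule: rev_cases)
        case (snoc q b)
        with nz' have nz': "(u, q @ [b]) \<in> nz" by simp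
        then have "(u, q) \<in> nz" "q = [] \<Longrightarrow> u = tail Q b"
          by (auto simp: nz_snoc nz_single path_end_def)
        then have "cf a (u, q) = (if q = [] then if u = tail Q c then cf (f x) (u, [c]) else 1 else cf (f x) (u, q @ [c]))"
          by (simp add: a_def)
        with \<open>q = [] \<Longrightarrow> u = tail Q b\<close> show ?thesis
          using cf_mult_arr_snoc[OF aR nz', of c] snoc by (auto simp: cfx)
      qed (simp add: cfx cf_mult_arr_Nil aR)
    qed (use aR in auto)
    have "cf a (v, []) \<noteq> 0" if "v \<in> verts Q" for v using that nz by (simp add: a_def)
    then obtain w where w: "w \<in> carrier R" "w \<otimes> a = \<one>" using unitI[OF aR] by blast
    have wf: "w \<otimes> f xc = arr c" using w aR by (simp add: fxc flip: m_assoc)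
    \<comment> \<open>Multiplying by \<open>w\<close> normalizes the value at \<open>xc\<close> to
      \<open>arr c\<close>, and \<open>starting c\<close> forces all values into \<open>c R\<close>.
      The latter is right linear here because the values lie in the radical.\<close>
    define g where "g = (\<lambda>m\<in>carrier M. starting c (w \<otimes> f m))"
    have wf_rad: "w \<otimes> f m \<in> rad 1" if "m \<in> carrier M" for m
      using rad_left_mult[OF w(1) rad1[OF f that]] .
    have g: "g \<in> dual R M" unfolding g_def
      by (rule rhomI[OF M])
        (use w(1) wf_rad in \<open>auto simp: rhomD[OF f, simplified] r_distr starting_add starting_right_mult simp flip: m_assoc\<close>)
    have gxc: "g xc = arr c" using xc(1) wf by (simp add: g_def) (rule starting_eqI, auto simp: cf_arr split: if_splits)
    have "retract R (rideal (arr c)) M"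
    proof (rule principal_retract[OF M _ xc(1) _ g _ gxc])
      fix z assume z: "z \<in> carrier R" "arr c \<otimes> z = \<zero>"
      have "h (xc \<lhd>\<^bsub>M\<^esub> z) = \<zero>" if h: "h \<in> dual R M" for h
      proof -
        have "h (xc \<lhd>\<^bsub>M\<^esub> z) = ending c (h x) \<otimes> z" using rhomD(3)[OF h xc(1) z(1)] xc(2)[OF h] by simp
        also have "\<dots> = elem (\<lambda>(u, p). cf (h x) (u, p @ [c])) \<otimes> (arr c \<otimes> z)"
          using z(1) by (simp add: ending_eq[OF fc[OF h x]] m_assoc)
        finally show ?thesis using z(2) by simp
      qed
      then show "xc \<lhd>\<^bsub>M\<^esub> z = \<zero>\<^bsub>M\<^esub>"
        using refl M.ract_closed[OF xc(1) z(1)] unfolding reflexive_def by blast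
    next
      fix m assume "m \<in> carrier M"
      then show "g m \<in> carrier (rideal (arr c))"
        using starting_eq[of "w \<otimes> f m" c] w(1) fc[OF f] by (auto simp: g_def)
    qed simp
    then have "rmod_iso R M (rideal (arr c))"
      using indecomposable_retract[OF ind principal_right_module] principal_arr_nonzero[OF cQ] by simp
    then show ?thesis using cQ by blast
  qed
qed

section \<open>Arrows generating Gorenstein-projective modules\<close>

definition zero_after :: "'e \<Rightarrow> 'e set" where
  "zero_after c = {b \<in> arcs Q. tail Q b = head Q c \<and> \<not> ok c b}"

text \<open>Prepending \<open>c\<close> sends distinct paths to distinct paths, so nothing cancels
  in \<open>arr c \<otimes> x\<close> and every path in \<open>x\<close> is killed separately;
  quadratic relations make this depend on its first arrow alone.\<close>

lemma arr_mult_zeroD: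
  assumes c: "c \<in> arcs Q" and x: "x \<in> carrier R" "idem (head Q c) \<otimes> x = x" "arr c \<otimes> x = \<zero>"
    and nz0: "cf x (u, p) \<noteq> 0"
  shows "p \<noteq> [] \<and> u = head Q c \<and> hd p \<in> zero_after c"
proof -
  have nz: "(u, p) \<in> nz" using nz0 x cf_outside by blast
  have u: "u = head Q c" using cf_idem_mult[OF x(1), of "head Q c" u p] x(2) nz0 by (auto split: if_splits)
  have *: "(tail Q c, c # p) \<notin> nz"
    using cf_arr_mult_Cons[OF x(1), of "tail Q c" c p c] x(3) nz0 u by auto
  with nz u c have "p \<noteq> [] \<and> \<not> ok c (hd p)" by (auto simp: nz_Cons)
  moreover from this nz u have "hd p \<in> arcs Q" "tail Q (hd p) = head Q c" by (cases p; simp add: nz_Cons)+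
  ultimately show ?thesis using u by (simp add: zero_after_def)
qed

lemma arr_mult_zeroI:
  assumes x: "x \<in> carrier R" and *: "\<And>u p. cf x (u, p) \<noteq> 0 \<Longrightarrow> u = head Q c \<Longrightarrow> p \<noteq> [] \<and> \<not> ok c (hd p)"
  shows "arr c \<otimes> x = \<zero>"
proof (rule cf_eqI)
  fix u p assume nz: "(u, p) \<in> nz"
  show "cf (arr c \<otimes> x) (u, p) = cf \<zero> (u, p)"
  proof (cases p)
    case (Cons b q)
    then show ?thesis using nz *[of "head Q c" q] by (auto simp: cf_arr_mult_Cons x nz_Cons)
  qed (simp add: cf_arr_mult_Nil x)
qed (use x in auto)

lemma mult_arr_zeroD:
  assumes b: "b \<in> arcs Q" and y: "y \<in> carrier R" "y \<otimes> idem (tail Q b) = y" "y \<otimes> arr b = \<zero>"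
    and nz0: "cf y (u, p) \<noteq> 0"
  shows "p \<noteq> [] \<and> last p \<in> arcs Q \<and> head Q (last p) = tail Q b \<and> \<not> ok (last p) b"
proof -
  have nz: "(u, p) \<in> nz" using nz0 y cf_outside by blast
  have e: "path_end Q u p = tail Q b" using cf_mult_idem[OF y(1), of "tail Q b" u p] y(2) nz0 by (auto split: if_splits)
  have "(u, p @ [b]) \<notin> nz"
    using cf_mult_arr_snoc[OF y(1), of u p b b] y(3) nz0 by auto
  with nz e b have p: "p \<noteq> []" "\<not> ok (last p) b" by (auto simp: nz_snoc)
  then show ?thesis using e nz_arcs[OF nz] by (auto simp: path_end_def)
qed

lemma idem_mult_zeroI:
  assumes c: "c \<in> arcs Q" and z: "zero_after c = {}" and x: "x \<in> carrier R" "arr c \<otimes> x = \<zero>"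
  shows "idem (head Q c) \<otimes> x = \<zero>"
proof (rule cf_eqI)
  let ?e = "idem (head Q c)"
  have "?e \<otimes> (?e \<otimes> x) = ?e \<otimes> x" using x by (simp add: idem_idem flip: m_assoc)
  moreover have "arr c \<otimes> (?e \<otimes> x) = \<zero>" using x by (simp add: arr_idem flip: m_assoc)
  ultimately show "cf (?e \<otimes> x) (u, p) = cf \<zero> (u, p)" for u p
    using arr_mult_zeroD[OF c, of "?e \<otimes> x" u p] z x by auto
qed (use x in auto)

text \<open>If no arrow is killed by \<open>c\<close>, then \<open>arr c\<close> and
  \<open>idem (head Q c)\<close> have the same right annihilator, so exchanging the generators gives
  mutually inverse maps.\<close>

lemma principal_arr_projective:
  assumes c: "c \<in> arcs Q" and z: "zero_after c = {}"
  shows "rmod_iso R (rideal (arr c)) (rideal (idem (head Q c)))"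
proof -
  let ?e = "idem (head Q c)"
  have e: "?e \<in> carrier (rideal ?e)" using idem_idem[of "head Q c"] by force
  have a: "arr c \<in> carrier (rideal (arr c))" using arr_idem[of c] by force
  obtain f where f: "f \<in> rhom R (rideal (arr c)) (rideal ?e)"
    "\<And>z. z \<in> carrier R \<Longrightarrow> f (arr c \<otimes> z) = ?e \<otimes> z"
    using principal_hom[OF principal_right_module[OF idem_closed] arr_closed e] idem_mult_zeroI[OF c z] by auto
  have **: "arr c \<otimes> x = \<zero>" if "x \<in> carrier R" "?e \<otimes> x = \<zero>" for x
  proof -
    have "arr c \<otimes> x = arr c \<otimes> (?e \<otimes> x)" using that(1) by (simp add: arr_idem flip: m_assoc)
    then show ?thesis using that by simp
  qed
  obtain g where g: "g \<in> rhom R (rideal ?e) (rideal (arr c))"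
    "\<And>z. z \<in> carrier R \<Longrightarrow> g (?e \<otimes> z) = arr c \<otimes> z"
    using principal_hom[OF principal_right_module[OF arr_closed] idem_closed a] ** by auto
  show ?thesis by (rule rmod_isoI[OF f(1) g(1)]) (auto simp: f g)
qed

text \<open>This puts the syzygy of \<open>c R\<close> into the principal form that
  \<open>syzygy_retract\<close> requires.\<close>

lemma principal_arr_eq:
  assumes c: "c \<in> arcs Q" and z: "zero_after c = {b}"
  shows "carrier (rideal (arr b)) = {x \<in> carrier R. idem (head Q c) \<otimes> x = x \<and> arr c \<otimes> x = \<zero>}"
proof (intro equalityI subsetI)
  have b: "b \<in> arcs Q" "tail Q b = head Q c" "\<not> ok c b" using z by (auto simp: zero_after_def)
  fix x assume "x \<in> carrier (rideal (arr b))"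
  then obtain y where y: "y \<in> carrier R" "x = arr b \<otimes> y" by auto
  then show "x \<in> {x \<in> carrier R. idem (head Q c) \<otimes> x = x \<and> arr c \<otimes> x = \<zero>}"
    using arr_mult_arr_zero[OF b(3)] idem_arr[of b] b(2) by (simp flip: m_assoc)
next
  fix x assume x: "x \<in> {x \<in> carrier R. idem (head Q c) \<otimes> x = x \<and> arr c \<otimes> x = \<zero>}"
  then have "starting b x = x" by (intro starting_eqI) (use arr_mult_zeroD[OF c, of x] z in auto)
  then have "x = arr b \<otimes> elem (\<lambda>(u, p). if u = head Q b then cf x (tail Q b, b # p) else 0)"
    using starting_eq[of x b] x by simp
  then show "x \<in> carrier (rideal (arr b))" by auto
qed

text \<open>
  The syzygy of \<open>cR\<close> is the sum of the \<open>bR\<close> with \<open>cb = 0\<close>.  Extending homomorphisms from the syzygy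
  to the projective cover shows that there is exactly one such \<open>b\<close> and that \<open>bR\<close> is not projective;
  reflexivity of \<open>cR\<close> excludes other arrows \<open>a\<close> with \<open>ab = 0\<close>.
\<close>

lemma next_arrow:
  assumes te: "totally_exact R P d" and c: "c \<in> arcs Q" and zne: "zero_after c \<noteq> {}"
    and ret: "retract R (rideal (arr c)) (image_module P d i)"
  obtains b where "zero_after c = {b}" "zero_after b \<noteq> {}"
    "retract R (rideal (arr b)) (image_module P d (i - 1))"
    "\<And>a. a \<in> arcs Q \<Longrightarrow> head Q a = tail Q b \<Longrightarrow> \<not> ok a b \<Longrightarrow> a = c"
proof -
  let ?e = "idem (head Q c)"
  define K where "K = {x \<in> carrier R. ?e \<otimes> x = x \<and> arr c \<otimes> x = \<zero>}"
  note ext = ext_vanishing[OF te arr_closed idem_closed arr_idem idem_idem ret K_def]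
  have KR: "x \<in> carrier R" if "x \<in> K" for x using that by (simp add: K_def)
  have Kz: "p \<noteq> [] \<and> hd p \<in> zero_after c" if "x \<in> K" "cf x (u, p) \<noteq> 0" for x u p
    using that arr_mult_zeroD[OF c, of x u p] by (auto simp: K_def)
  have Krad: "x \<in> rad 1" if "x \<in> K" for x using Kz[OF that] KR[OF that] by (force simp: rad_def)
  have arrK: "arr b \<in> K" if "b \<in> zero_after c" for b
    using that idem_arr[of b] arr_mult_arr_zero[of c b] by (auto simp: K_def zero_after_def)
  obtain b where b: "b \<in> zero_after c" using zne by blast
  then have b': "b \<in> arcs Q" "tail Q b = head Q c" "\<not> ok c b" by (auto simp: zero_after_def)
  have cf_mult_arr: "cf (y \<otimes> arr a) (tail Q a, [a]) = cf y (tail Q a, [])" if "y \<in> carrier R" "a \<in> arcs Q" for y a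
    using cf_mult_arr_snoc[OF that(1), of "tail Q a" "[]" a a] that(2) by (simp add: nz_single)
  have only: "zero_after c = {b}"
  proof (rule ccontr)
    assume "zero_after c \<noteq> {b}"
    then obtain a where a: "a \<in> zero_after c" "a \<noteq> b" using b by blast
    then have a': "a \<in> arcs Q" "tail Q a = head Q c" by (auto simp: zero_after_def)
    \<comment> \<open>If both \<open>a\<close> and \<open>b\<close> followed \<open>c\<close> with
      zero product, projecting the syzygy to the paths starting in \<open>b\<close> would be left
      multiplication by some \<open>y\<close>. The coefficient of \<open>y\<close> at the trivial
      path \<open>head Q c\<close> would then be 1 because of \<open>b\<close> and 0 because of
      \<open>a\<close>.\<close>
    obtain y where y: "y \<in> carrier R" "\<And>x. x \<in> K \<Longrightarrow> starting b x = y \<otimes> x"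
      using ext[of "starting b"] starting_right_mult[OF _ Krad] by (auto simp: starting_add KR)
    have "starting b (arr b) = arr b" by (rule starting_eqI) (auto simp: cf_arr split: if_splits)
    then have 1: "cf (y \<otimes> arr b) (tail Q b, [b]) = 1" using y(2)[OF arrK[OF b]] b'(1) by (simp add: cf_arr)
    have "cf (starting b (arr a)) (tail Q a, [a]) = 0" using a(2) by (simp add: cf_starting)
    then have 2: "cf (y \<otimes> arr a) (tail Q a, [a]) = 0" using y(2)[OF arrK[OF a(1)]] by simp
    show False using 1 2 cf_mult_arr[OF y(1) b'(1)] cf_mult_arr[OF y(1) a'(1)] a'(2) b'(2) by simp
  qed
  note Kb = principal_arr_eq[OF c only, folded K_def]
  have zb: "zero_after b \<noteq> {}"
  proof
    assume z: "zero_after b = {}"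
    let ?f = "idem (head Q b)"
    \<comment> \<open>If \<open>b R\<close> were projective, \<open>arr b\<close> could be sent to
      \<open>idem (head Q b)\<close>. This map would be left multiplication by some
      \<open>y\<close>, but \<open>y \<otimes> arr b\<close> contains no trivial path.\<close>
    obtain h where h: "h \<in> rhom R (rideal (arr b)) (regular_module R)"
      "\<And>z. z \<in> carrier R \<Longrightarrow> h (arr b \<otimes> z) = ?f \<otimes> z"
      using principal_hom[OF regular_right_module[OF ring_axioms] arr_closed, of ?f] idem_mult_zeroI[OF b'(1) z] by auto
    note h' = rhomD[OF h(1), unfolded regular_module_simps principal_right_ideal_simps(2-) Kb]
    obtain y where y: "y \<in> carrier R" "\<And>x. x \<in> K \<Longrightarrow> h x = y \<otimes> x"
      by (rule ext[of h]) (use h' in simp_all)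
    have "y \<otimes> arr b = h (arr b \<otimes> ?f)" using y(2)[OF arrK[OF b]] by (simp add: arr_idem)
    also have "\<dots> = ?f" using h(2) by (simp add: idem_idem)
    finally have "cf (y \<otimes> arr b) (head Q b, []) = cf ?f (head Q b, [])" by simp
    then show False using b'(1) y(1) by (simp add: cf_mult_arr_Nil cf_idem)
  qed
  have retb: "retract R (rideal (arr b)) (image_module P d (i - 1))"
  proof (rule syzygy_retract[OF te arr_closed idem_closed arr_idem idem_idem ret arr_closed])
    show "carrier (rideal (arr b)) = {x \<in> carrier R. ?e \<otimes> x = x \<and> arr c \<otimes> x = \<zero>}"
      by (rule principal_arr_eq[OF c only])
    fix k assume "k \<in> carrier (rideal (arr b))"
    then have k: "k \<in> K" unfolding Kb .
    have "cf (\<one> \<oplus> k) (v, []) \<noteq> 0" if "v \<in> verts Q" for v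
      using that KR[OF k] Krad[OF k] by (simp add: cf_add cf_one rad_def)
    then obtain w where "w \<in> carrier R" "w \<otimes> (\<one> \<oplus> k) = \<one>" "(\<one> \<oplus> k) \<otimes> w = \<one>"
      using unitI[of "\<one> \<oplus> k"] KR[OF k] by auto
    then show "\<exists>w\<in>carrier R. w \<otimes> (\<one> \<oplus> k) = \<one> \<and> (\<one> \<oplus> k) \<otimes> w = \<one>" by blast
  qed
  have "a = c" if a: "a \<in> arcs Q" "head Q a = tail Q b" "\<not> ok a b" for a
  proof (rule ccontr)
    assume "a \<noteq> c"
    let ?M = "rideal (arr c)"
    have M: "right_module R ?M" by (rule principal_right_module) simp
    have refl: "reflexive R ?M"
      by (rule retract_reflexive[OF M te_image_module[OF te] ret te_image_reflexive[OF te]])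
    have cM: "arr c \<in> carrier ?M" using arr_idem[of c] by force
    \<comment> \<open>The value \<open>f (arr c)\<close> ends at \<open>tail Q b\<close> and is
      killed by \<open>b\<close> on the right, as \<open>arr c\<close> is. A trivial path at that
      vertex would survive multiplication by \<open>b\<close>, so none occurs.\<close>
    have rad1: "f (arr c) \<in> rad 1" if f: "f \<in> dual R ?M" for f
    proof -
      note f' = rhomD[OF f, unfolded regular_module_simps principal_right_ideal_simps(2-)]
      have yR: "f (arr c) \<in> carrier R" using f'(1)[OF cM] .
      have ye: "f (arr c) \<otimes> idem (tail Q b) = f (arr c)"
        using f'(3)[OF cM idem_closed, of "head Q c"] arr_idem[of c] b'(2) by simp
      have "f (arr c) \<otimes> arr b = f \<zero>" using f'(3)[OF cM arr_closed, of b] arr_mult_arr_zero[OF b'(3)] by simp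
      also have "\<dots> = \<zero>" using rhom_zero[OF M regular_right_module[OF ring_axioms] f] by simp
      finally have "f (arr c) \<otimes> arr b = \<zero>" .
      then show ?thesis using mult_arr_zeroD[OF b'(1) yR ye] yR by (force simp: rad_def)
    qed
    \<comment> \<open>Reflexivity gives \<open>x = arr c \<otimes> z\<close> representing the part
      ending in \<open>c\<close>. Its coefficient at the trivial path \<open>head Q c\<close> is
      computed twice: the inclusion of \<open>c R\<close> gives 1, and the map sending
      \<open>arr c\<close> to \<open>arr a\<close> gives 0 if \<open>a\<close> differs from
      \<open>c\<close>.\<close>
    have "left_linear R ?M (\<lambda>f. ending c (f (arr c)))"
      by (rule left_linear_eval[OF M cM, of "rad 1"]) (use rad1 in \<open>auto simp: ending_add ending_left_mult\<close>)
    then obtain x where x: "x \<in> carrier ?M" "\<And>f. f \<in> dual R ?M \<Longrightarrow> ending c (f (arr c)) = f x"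
      using refl unfolding reflexive_def by blast
    then obtain z where z: "z \<in> carrier R" "x = arr c \<otimes> z" by auto
    have cfz: "cf (arr a' \<otimes> z) (tail Q a', [a']) = cf z (head Q a', [])" if "a' \<in> arcs Q" for a'
      using cf_arr_mult_Cons[OF z(1), of "tail Q a'" a' "[]" a'] that by (simp add: nz_single)
    obtain f where f: "f \<in> dual R ?M" "\<And>z. z \<in> carrier R \<Longrightarrow> f (arr c \<otimes> z) = arr c \<otimes> z"
      using principal_hom[OF regular_right_module[OF ring_axioms] arr_closed, of "arr c" c] by auto
    have "arr c \<otimes> z = ending c (arr c)" using x(2)[OF f(1)] f(2)[OF z(1)] f(2)[of ?e] z(2) arr_idem[of c] by simp
    also have "\<dots> = arr c" by (rule ending_eqI) (auto simp: cf_arr split: if_splits)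
    finally have 1: "cf z (head Q c, []) = 1" using cfz[OF c] c by (simp add: cf_arr)
    \<comment> \<open>This makes the map sending \<open>arr c\<close> to \<open>arr a\<close> well
      defined: elements of the syzygy involve only paths starting in \<open>b\<close>, and
      \<open>a\<close> kills these too.\<close>
    have "arr a \<otimes> y = \<zero>" if y: "y \<in> carrier R" "arr c \<otimes> y = \<zero>" for y
    proof -
      have "?e \<otimes> (?e \<otimes> y) = ?e \<otimes> y" using y by (simp add: idem_idem flip: m_assoc)
      moreover have "arr c \<otimes> (?e \<otimes> y) = \<zero>" using y by (simp add: arr_idem flip: m_assoc)
      ultimately have "?e \<otimes> y \<in> K" using y by (simp add: K_def)
      then have "arr a \<otimes> (?e \<otimes> y) = \<zero>"
        using Kz[of "?e \<otimes> y"] only a(3) y(1) by (intro arr_mult_zeroI) auto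
      then show ?thesis using arr_idem[of a] a(2) b'(2) y(1) by (simp flip: m_assoc)
    qed
    then obtain g where g: "g \<in> dual R ?M" "\<And>z. z \<in> carrier R \<Longrightarrow> g (arr c \<otimes> z) = arr a \<otimes> z"
      using principal_hom[OF regular_right_module[OF ring_axioms] arr_closed, of "arr a" c] by auto
    have "arr a \<otimes> z = ending c (arr a)"
      using x(2)[OF g(1)] g(2)[OF z(1)] g(2)[of ?e] z(2) arr_idem[of c] arr_idem[of a] a(2) b'(2) by simp
    then have "cf z (head Q a, []) = 0" using cfz[OF a(1)] \<open>a \<noteq> c\<close> by (simp add: cf_ending)
    then show False using 1 a(2) b'(2) by simp
  qed
  with that only zb retb show ?thesis by blast
qed

end

section \<open>Closing up the sequence of arrows to a perfect cycle\<close>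

lemma permutation_cycle:
  assumes fin: "finite T" and fT: "f ` T \<subseteq> T" and inj: "inj_on f T" and c: "c \<in> T"
  obtains cs where "cs \<noteq> []" "distinct cs" "set cs \<subseteq> T" "c \<in> set cs"
    "\<And>i. i < length cs \<Longrightarrow> cs ! (Suc i mod length cs) = f (cs ! i)"
proof -
  have T: "(f ^^ k) x \<in> T" if "x \<in> T" for k x using that fT by (induction k) auto
  have cancel: "x = y" if "(f ^^ k) x = (f ^^ k) y" "x \<in> T" "y \<in> T" for k x y
    using that by (induction k) (auto dest!: inj_onD[OF inj] intro: T)
  have period: "(f ^^ (j - i)) c = c" if "i \<le> j" "(f ^^ i) c = (f ^^ j) c" for i j
  proof -
    have "(f ^^ i) ((f ^^ (j - i)) c) = (f ^^ i) c" using that by (simp flip: funpow_add[THEN fun_cong, unfolded comp_def])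
    then show ?thesis using cancel T c by blast
  qed
  have "\<not> inj_on (\<lambda>k. (f ^^ k) c) {..card T}"
  proof
    assume "inj_on (\<lambda>k. (f ^^ k) c) {..card T}"
    then have "card {..card T} \<le> card T" using fin T c by (intro card_inj_on_le[of "\<lambda>k. (f ^^ k) c"]) auto
    then show False by simp
  qed
  then obtain i j where "i < j" "(f ^^ i) c = (f ^^ j) c"
    unfolding inj_on_def by (metis linorder_neqE_nat)
  then have ex: "\<exists>n>0. (f ^^ n) c = c" using period[of i j] by (intro exI[of _ "j - i"]) auto
  \<comment> \<open>Taking the least period makes the arrows listed along one turn of the orbit
    pairwise distinct.\<close>
  define n where "n = (LEAST n. 0 < n \<and> (f ^^ n) c = c)"
  have n: "0 < n" "(f ^^ n) c = c" using LeastI_ex[OF ex] by (auto simp: n_def)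
  have least: "n \<le> m" if "0 < m" "(f ^^ m) c = c" for m unfolding n_def by (rule Least_le) (use that in simp)
  define cs where "cs = map (\<lambda>k. (f ^^ k) c) [0..<n]"
  have "inj_on (\<lambda>k. (f ^^ k) c) {0..<n}"
  proof (rule linorder_inj_onI)
    fix i j assume "i < j" "i \<in> {0..<n}" "j \<in> {0..<n}"
    then show "(f ^^ i) c \<noteq> (f ^^ j) c" using period[of i j] least[of "j - i"] by auto
  qed auto
  then have "distinct cs" by (simp add: cs_def distinct_map)
  moreover have "c \<in> set cs" using n by (auto simp: cs_def intro!: image_eqI[of _ _ 0])
  moreover have "cs ! (Suc i mod length cs) = f (cs ! i)" if "i < length cs" for i
  proof (cases "Suc i = n")
    case True
    then have "f ((f ^^ i) c) = c" using n(2) by auto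
    then show ?thesis using True that by (simp add: cs_def)
  qed (use that in \<open>simp add: cs_def\<close>)
  ultimately show ?thesis using that[of cs] n T c by (auto simp: cs_def)
qed

context quadratic_monomial_algebra
begin

text \<open>The counterpart of \<open>perfect_forbidden_cycle\<close> in the abstract setting, where
  relations are visible only through \<open>ok\<close>; \<open>perfect_forbidden_cycle_iff\<close>
  identifies the two.\<close>

definition perfect_cycle :: "'e list \<Rightarrow> bool" where
  "perfect_cycle cs \<longleftrightarrow> cs \<noteq> [] \<and> set cs \<subseteq> arcs Q \<and> distinct cs \<and>
     (\<forall>i<length cs. let prev = cs ! i; next = cs ! (Suc i mod length cs) in
        head Q prev = tail Q next \<and> \<not> ok prev next \<and>
        (\<forall>a\<in>arcs Q. head Q a = tail Q next \<and> a \<noteq> prev \<longrightarrow> ok a next) \<and>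
        (\<forall>b\<in>arcs Q. tail Q b = tail Q next \<and> b \<noteq> next \<longrightarrow> ok prev b))"

definition perfect :: "'e \<Rightarrow> bool" where
  "perfect c \<longleftrightarrow> (\<exists>cs. perfect_cycle cs \<and> c \<in> set cs)"

lemma perfect_arcs: "perfect c \<Longrightarrow> c \<in> arcs Q"
  by (auto simp: perfect_def perfect_cycle_def)

lemma perfect_cycleD:
  assumes cs: "perfect_cycle cs" and i: "i < length cs" and b: "b = cs ! (Suc i mod length cs)"
  shows "zero_after (cs ! i) = {b}" "\<And>a. a \<in> arcs Q \<Longrightarrow> head Q a = tail Q b \<Longrightarrow> \<not> ok a b \<Longrightarrow> a = cs ! i"
    "b \<in> arcs Q" "tail Q b = head Q (cs ! i)" "cs ! i \<in> arcs Q"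
proof -
  have "Suc i mod length cs < length cs" using i by (intro mod_less_divisor) auto
  then have sub: "b \<in> arcs Q" "cs ! i \<in> arcs Q" using cs i b by (auto simp: perfect_cycle_def dest: nth_mem)
  have *: "head Q (cs ! i) = tail Q b" "\<not> ok (cs ! i) b"
    "\<And>a. a \<in> arcs Q \<Longrightarrow> head Q a = tail Q b \<Longrightarrow> a \<noteq> cs ! i \<Longrightarrow> ok a b"
    "\<And>a. a \<in> arcs Q \<Longrightarrow> tail Q a = tail Q b \<Longrightarrow> a \<noteq> b \<Longrightarrow> ok (cs ! i) a"
    using cs i unfolding perfect_cycle_def Let_def b by blast+
  show "zero_after (cs ! i) = {b}" using * sub by (auto simp: zero_after_def)
  show "\<And>a. a \<in> arcs Q \<Longrightarrow> head Q a = tail Q b \<Longrightarrow> \<not> ok a b \<Longrightarrow> a = cs ! i" using * by blast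
  show "b \<in> arcs Q" "tail Q b = head Q (cs ! i)" "cs ! i \<in> arcs Q" using * sub by auto
qed

lemma perfect_next:
  assumes "perfect c"
  obtains b where "b \<in> zero_after c" "\<And>a. a \<in> arcs Q \<Longrightarrow> head Q a = tail Q b \<Longrightarrow> \<not> ok a b \<Longrightarrow> a = c"
proof -
  obtain cs i where cs: "perfect_cycle cs" "i < length cs" "c = cs ! i"
    using assms unfolding perfect_def by (metis in_set_conv_nth)
  show ?thesis using that perfect_cycleD[OF cs(1,2) refl] cs(3) by blast
qed

lemma perfect_if_retract:
  assumes te: "totally_exact R P d" and c: "c \<in> arcs Q" and z: "zero_after c \<noteq> {}"
    and ret: "retract R (rideal (arr c)) (image_module P d i)"
  shows "perfect c"
proof -
  define T where "T = {c \<in> arcs Q. zero_after c \<noteq> {} \<and> (\<exists>i. retract R (rideal (arr c)) (image_module P d i))}"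
  define nxt where "nxt c = the_elem (zero_after c)" for c
  have nxt: "zero_after c = {nxt c}" "nxt c \<in> T"
    "\<And>a. a \<in> arcs Q \<Longrightarrow> head Q a = tail Q (nxt c) \<Longrightarrow> \<not> ok a (nxt c) \<Longrightarrow> a = c" if "c \<in> T" for c
  proof -
    from that obtain i where c: "c \<in> arcs Q" "zero_after c \<noteq> {}"
      "retract R (rideal (arr c)) (image_module P d i)" by (auto simp: T_def)
    obtain b where b: "zero_after c = {b}" "zero_after b \<noteq> {}"
      "retract R (rideal (arr b)) (image_module P d (i - 1))"
      "\<And>a. a \<in> arcs Q \<Longrightarrow> head Q a = tail Q b \<Longrightarrow> \<not> ok a b \<Longrightarrow> a = c"
      using next_arrow[OF te c] by blast
    have n: "nxt c = b" using b(1) by (simp add: nxt_def)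
    have "b \<in> arcs Q" using b(1) by (auto simp: zero_after_def)
    then show "zero_after c = {nxt c}" "nxt c \<in> T"
      "\<And>a. a \<in> arcs Q \<Longrightarrow> head Q a = tail Q (nxt c) \<Longrightarrow> \<not> ok a (nxt c) \<Longrightarrow> a = c"
      using b unfolding n T_def by blast+
  qed
  have nz: "head Q c = tail Q (nxt c)" "\<not> ok c (nxt c)" "c \<in> arcs Q" if "c \<in> T" for c
  proof -
    have "nxt c \<in> zero_after c" using nxt(1)[OF that] by blast
    then show "head Q c = tail Q (nxt c)" "\<not> ok c (nxt c)" "c \<in> arcs Q"
      using that by (auto simp: zero_after_def T_def)
  qed
  have "finite T" by (rule finite_subset[OF _ finite_arcs]) (auto simp: T_def)
  moreover have "nxt ` T \<subseteq> T" using nxt(2) by blast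
  moreover have "inj_on nxt T"
  proof (rule inj_onI)
    fix a b assume "a \<in> T" "b \<in> T" "nxt a = nxt b"
    then show "a = b" using nxt(3)[of b a] nz[of a] by simp
  qed
  moreover have "c \<in> T" using c z ret by (auto simp: T_def)
  ultimately obtain cs where cs: "cs \<noteq> []" "distinct cs" "set cs \<subseteq> T" "c \<in> set cs"
    "\<And>i. i < length cs \<Longrightarrow> cs ! (Suc i mod length cs) = nxt (cs ! i)"
    using permutation_cycle[of T nxt c] by blast
  have "perfect_cycle cs"
    unfolding perfect_cycle_def Let_def
  proof (intro conjI allI impI ballI)
    show "set cs \<subseteq> arcs Q" using cs(3) by (auto simp: T_def)
    fix i assume i: "i < length cs"
    then have iT: "cs ! i \<in> T" using cs(3) by auto
    show "head Q (cs ! i) = tail Q (cs ! (Suc i mod length cs))" "\<not> ok (cs ! i) (cs ! (Suc i mod length cs))"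
      using nz[OF iT] cs(5)[OF i] by simp_all
    fix a assume a: "a \<in> arcs Q"
    { assume "head Q a = tail Q (cs ! (Suc i mod length cs)) \<and> a \<noteq> cs ! i"
      then show "ok a (cs ! (Suc i mod length cs))" using nxt(3)[OF iT a] cs(5)[OF i] by auto }
    { assume "tail Q a = tail Q (cs ! (Suc i mod length cs)) \<and> a \<noteq> cs ! (Suc i mod length cs)"
      then show "ok (cs ! i) a" using nxt(1)[OF iT] nz[OF iT] cs(5)[OF i] a by (auto simp: zero_after_def) }
  qed (use cs in auto)
  then show ?thesis using cs(4) by (auto simp: perfect_def)
qed

lemma gorenstein_projective_cases:
  assumes ind: "indecomposable R G" and gp: "gorenstein_projective R G"
  shows "(\<exists>v\<in>verts Q. rmod_iso R G (rideal (idem v))) \<or>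
    (\<exists>c. perfect c \<and> rmod_iso R G (rideal (arr c)))"
proof -
  have G: "right_module R G" using ind by (simp add: indecomposable_def)
  from indecomposable_reflexive_cases[OF ind gorenstein_projective_reflexive[OF gp]] show ?thesis
  proof
    assume "\<exists>c\<in>arcs Q. rmod_iso R G (rideal (arr c))"
    then obtain c where c: "c \<in> arcs Q" and iso: "rmod_iso R G (rideal (arr c))" by blast
    show ?thesis
    proof (cases "zero_after c = {}")
      case True
      have "rmod_iso R G (rideal (idem (head Q c)))"
        by (rule rmod_iso_trans[OF G iso principal_arr_projective[OF c True]])
      then show ?thesis using c by auto
    next
      case False
      from gp obtain P :: "int \<Rightarrow> ('a, nat \<Rightarrow> 'a) rmodule" and d i where
        te: "totally_exact R P d" and isoP: "rmod_iso R G (image_module P d i)"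
        unfolding gorenstein_projective_def by blast
      note M = te_image_module[OF te] and C = principal_right_module[OF arr_closed]
      have "rmod_iso R (image_module P d i) (rideal (arr c))"
        by (rule rmod_iso_trans[OF M rmod_iso_sym[OF G isoP] iso])
      then have "retract R (rideal (arr c)) (image_module P d i)"
        by (rule rmod_iso_retract[OF M])
      then show ?thesis using perfect_if_retract[OF te c False] iso by blast
    qed
  qed blast
qed

text \<open>The complex has \<open>R\<close> in every degree, with multiplications by
  \<open>idem v\<close> and \<open>\<one> \<ominus> idem v\<close> alternating. It splits, so both
  exactness conditions follow from writing an element as the sum of its two parts.\<close>

lemma gorenstein_projective_idem:
  obtains G :: "('a, nat \<Rightarrow> 'a) rmodule" where "gorenstein_projective R G"
    "rmod_iso R G (rideal (idem v))"
proof -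
  define a where "a i = (if even i then idem v else \<one> \<ominus> idem v)" for i :: int
  have aR: "a i \<in> carrier R" for i by (simp add: a_def)
  have sum: "x = a i \<otimes> x \<oplus> a (i + 1) \<otimes> x" "x = x \<otimes> a i \<oplus> x \<otimes> a (i + 1)" if "x \<in> carrier R" for x i
    using that by (auto simp: a_def minus_eq l_distr r_distr l_minus r_minus a_ac r_neg r_neg1 r_neg2)
  have aa: "a (i + 1) \<otimes> a i = \<zero>" for i
    by (auto simp: a_def minus_eq l_distr r_distr l_minus r_minus idem_idem r_neg l_neg)
  have right: "\<exists>y\<in>carrier R. x = a i \<otimes> y" if "x \<in> carrier R" "a (i + 1) \<otimes> x = \<zero>" for x i
    using sum(1)[OF that(1), of i] that aR[of i] by (intro bexI[of _ x]) auto
  have left: "\<exists>y\<in>carrier R. x = y \<otimes> a (i + 1)" if "x \<in> carrier R" "x \<otimes> a i = \<zero>" for x i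
    using sum(2)[OF that(1), of i] that aR[of "i + 1"] by (intro bexI[of _ x]) auto
  obtain G :: "('a, nat \<Rightarrow> 'a) rmodule" where "gorenstein_projective R G"
    "rmod_iso R G (rideal (a 0))"
    by (rule gorenstein_projective_principal[of "\<lambda>_. \<one>" a 0]) (use aR aa right left in auto)
  then show ?thesis using that by (simp add: a_def)
qed

text \<open>Left multiplications by the arrows of the cycle form a periodic complex. Exactness holds
  because only the next arrow is killed by an arrow of the cycle, and exactness of the dual because
  only the previous one kills it.\<close>

lemma gorenstein_projective_arr:
  assumes "perfect c"
  obtains G :: "('a, nat \<Rightarrow> 'a) rmodule" where "gorenstein_projective R G"
    "rmod_iso R G (rideal (arr c))"
proof -
  obtain cs j where cs: "perfect_cycle cs" and j: "j < length cs" "c = cs ! j"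
    using assms unfolding perfect_def by (metis in_set_conv_nth)
  define n where "n = length cs"
  have n: "0 < n" using j by (auto simp: n_def)
  \<comment> \<open>The cycle is traversed backwards: the composite of the differentials at
    \<open>i\<close> and \<open>i + 1\<close> is the path first \<open>s (i + 1)\<close>, then
    \<open>s i\<close>, so the index must drop as \<open>i\<close> grows.\<close>
  define k where "k i = nat ((- i) mod int n)" for i
  define s where "s i = cs ! k i" for i
  have k: "k i < length cs" for i using n by (simp add: k_def n_def nat_less_iff)
  have k_Suc: "Suc (k (i + 1)) mod length cs = k i" for i
  proof -
    have "int (Suc (k (i + 1)) mod n) = int (k i)"
      using n by (simp add: k_def zmod_int mod_simps)
    then show ?thesis by (simp add: n_def)
  qed
  note D = perfect_cycleD[OF cs k, of "s i" "i + 1" for i, folded s_def, simplified k_Suc s_def[symmetric], OF refl]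
  have ok: "\<not> ok (s (i + 1)) (s i)" for i using D(1)[of i] by (auto simp: zero_after_def)
  have "\<exists>y\<in>carrier R. x = arr (s i) \<otimes> y"
    if x: "x \<in> carrier R" "idem (head Q (s (i + 1))) \<otimes> x = x" "arr (s (i + 1)) \<otimes> x = \<zero>" for x i
  proof -
    have "x \<in> carrier (rideal (arr (s i)))"
      unfolding principal_arr_eq[OF D(5) D(1)] using x by simp
    then show ?thesis by auto
  qed
  moreover have "\<exists>z\<in>carrier R. y = z \<otimes> arr (s (i + 1))"
    if y: "y \<in> carrier R" "y \<otimes> idem (head Q (s (i + 1))) = y" "y \<otimes> arr (s i) = \<zero>" for y i
  proof -
    have "ending (s (i + 1)) y = y"
      using mult_arr_zeroD[OF D(3) y(1) _ y(3)] y(2) D(2)[of "last _" i] D(4)[of i]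
      by (intro ending_eqI y(1)) auto
    then show ?thesis using ending_eq[OF y(1), of "s (i + 1)"] by (metis elem_closed)
  qed
  ultimately obtain G :: "('a, nat \<Rightarrow> 'a) rmodule" where G: "gorenstein_projective R G"
    "rmod_iso R G (rideal (arr (s (- int j))))"
    using gorenstein_projective_principal[of "\<lambda>i. idem (head Q (s i))" "\<lambda>i. arr (s i)" "- int j"]
      arr_mult_arr_zero[OF ok] idem_idem arr_idem idem_arr[of "s _"] D(4)
    by (metis arr_closed idem_closed)
  have "s (- int j) = c" using j by (simp add: s_def k_def n_def)
  then show ?thesis using that G by simp
qed

section \<open>The indecomposable Gorenstein-projective modules\<close>

definition gen :: "'v + 'e \<Rightarrow> 'a" where "gen x = (case x of Inl v \<Rightarrow> idem v | Inr c \<Rightarrow> arr c)"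

definition gen_end :: "'v + 'e \<Rightarrow> 'v" where "gen_end x = (case x of Inl v \<Rightarrow> v | Inr c \<Rightarrow> head Q c)"

text \<open>The only path occurring in \<open>gen x\<close>. On \<open>gen x R\<close>, the
  coefficient at this path is the residue modulo the radical.\<close>

definition gen_path :: "'v + 'e \<Rightarrow> ('v, 'e) qpath" where
  "gen_path x = (case x of Inl v \<Rightarrow> (v, []) | Inr c \<Rightarrow> (tail Q c, [c]))"

definition gens :: "('v + 'e) set" where "gens = verts Q <+> {c. perfect c}"

lemma gen_closed [simp]: "gen x \<in> carrier R"
  by (simp add: gen_def split: sum.split)

lemma gen_idem: "gen x \<otimes> idem (gen_end x) = gen x"
  by (simp add: gen_def gen_end_def idem_idem arr_idem split: sum.split)

lemma gen_mem: "gen x \<in> carrier (rideal (gen x))"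
  using gen_idem[of x] by force

lemma gen_end_verts: "x \<in> gens \<Longrightarrow> gen_end x \<in> verts Q"
  by (auto simp: gens_def gen_end_def perfect_arcs)

lemma cf_gen_mult:
  assumes "x \<in> gens" "a \<in> carrier R" shows "cf (gen x \<otimes> a) (gen_path x) = cf a (gen_end x, [])"
  using assms cf_arr_mult_Cons[OF assms(2), of "tail Q c" c "[]" c for c]
  by (auto simp: gens_def gen_def gen_end_def gen_path_def cf_idem_mult nz_single perfect_arcs split: sum.split)

lemma cf_gen: "x \<in> gens \<Longrightarrow> cf (gen x) (gen_path x) = 1"
  using cf_gen_mult[of x "idem (gen_end x)"] gen_end_verts[of x] by (simp add: gen_idem cf_idem)

lemma finite_gens: "finite gens"
  unfolding gens_def by (intro finite_Plus finite_verts finite_subset[OF _ finite_arcs]) (auto simp: perfect_arcs)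

text \<open>Only the coefficient of \<open>a\<close> at the end vertex of \<open>gen x\<close>
  matters; if it is nonzero, \<open>a\<close> can be replaced by a unit \<open>u\<close> with the
  same product. So every element with a nonzero coefficient at \<open>gen_path x\<close> generates
  the module.\<close>

lemma gen_generator:
  assumes x: "x \<in> gens" and a: "a \<in> carrier R" and nz: "cf (gen x \<otimes> a) (gen_path x) \<noteq> 0"
  obtains w where "w \<in> carrier R" "gen x \<otimes> a \<otimes> w = gen x"
proof -
  let ?e = "idem (gen_end x)"
  define u where "u = ?e \<otimes> a \<oplus> (\<one> \<ominus> ?e)"
  have uR: "u \<in> carrier R" using a by (simp add: u_def)
  have "cf a (gen_end x, []) \<noteq> 0" using nz cf_gen_mult[OF x a] by simp
  then have "cf u (v, []) \<noteq> 0" if "v \<in> verts Q" for v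
    using that a by (auto simp: u_def cf_add cf_diff cf_one cf_idem cf_idem_mult)
  then obtain w where w: "w \<in> carrier R" "u \<otimes> w = \<one>" using unitI[OF uR] by blast
  have "gen x \<otimes> u = gen x \<otimes> ?e \<otimes> a \<oplus> (gen x \<ominus> gen x \<otimes> ?e)"
    using a by (simp add: u_def r_distr minus_eq r_minus m_assoc)
  also have "\<dots> = gen x \<otimes> a" using a by (simp add: gen_idem minus_eq r_neg)
  finally have "gen x \<otimes> a \<otimes> w = gen x" using w uR by (metis gen_closed m_assoc r_one)
  then show ?thesis using that w by blast
qed

text \<open>The module is local: a submodule containing an element with nonzero residue
  \<open>c\<close> is everything. The residues of the two components of the generator sum to 1, so
  one of the summands is the whole module.\<close>

lemma indecomposable_if_iso_gen:
  assumes x: "x \<in> gens" and M: "right_module R M" and iso: "rmod_iso R (rideal (gen x)) M"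
  shows "indecomposable R M"
  unfolding indecomposable_def
proof (intro conjI allI impI M)
  let ?P = "rideal (gen x)"
  interpret M: right_module R M by fact
  have P: "right_module R ?P" by (rule principal_right_module) simp
  obtain f g where f: "f \<in> rhom R ?P M" and g: "g \<in> rhom R M ?P"
    and gf: "\<And>y. y \<in> carrier ?P \<Longrightarrow> g (f y) = y" and fg: "\<And>y. y \<in> carrier M \<Longrightarrow> f (g y) = y"
    using rmod_iso_inverse[OF P iso] by metis
  note f' = rhomD[OF f gen_mem] and g' = rhomD[OF g]
  define c where "c m = cf (g m) (gen_path x)" for m
  have c1: "c (f (gen x)) = 1" using gf[OF gen_mem] cf_gen[OF x] by (simp add: c_def)
  have c0: "c \<zero>\<^bsub>M\<^esub> = 0" using rhom_zero[OF M P g] by (simp add: c_def)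
  show "carrier M \<noteq> {\<zero>\<^bsub>M\<^esub>}" using f'(1) c0 c1 by auto
  have all: "V = carrier M" if V: "right_submodule R M V" and u: "u \<in> V" "c u \<noteq> 0" for V u
  proof -
    note V' = right_submoduleD[OF M V]
    have uM: "u \<in> carrier M" using V'(1) u(1) by blast
    obtain a where a: "a \<in> carrier R" "g u = gen x \<otimes> a" using g'(1)[OF uM] by auto
    then obtain w where w: "w \<in> carrier R" "gen x \<otimes> a \<otimes> w = gen x"
      using gen_generator[OF x a(1)] u(2) by (auto simp: c_def)
    have "g (u \<lhd>\<^bsub>M\<^esub> w) = gen x" using g'(3)[OF uM w(1)] a w by simp
    then have "f (gen x) = u \<lhd>\<^bsub>M\<^esub> w" using fg M.ract_closed[OF uM w(1)] by metis
    then have *: "f (gen x) \<in> V" using V'(4)[OF u(1) w(1)] by simp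
    have "m \<in> V" if m: "m \<in> carrier M" for m
    proof -
      obtain r where r: "r \<in> carrier R" "g m = gen x \<otimes> r" using g'(1)[OF m] by auto
      then have "m = f (gen x) \<lhd>\<^bsub>M\<^esub> r" using fg[OF m] f'(3)[OF r(1)] by simp
      then show ?thesis using V'(4)[OF * r(1)] by simp
    qed
    then show ?thesis using V'(1) by blast
  qed
  fix U W assume "internal_direct_sum R M U W"
  then have U: "right_submodule R M U" and W: "right_submodule R M W"
    and UW: "U <+>\<^bsub>M\<^esub> W = carrier M" "U \<inter> W = {\<zero>\<^bsub>M\<^esub>}"
    by (auto simp: internal_direct_sum_def)
  have "f (gen x) \<in> U <+>\<^bsub>M\<^esub> W" unfolding UW(1) by (rule f'(1))
  then obtain u w where uw: "u \<in> U" "w \<in> W" "f (gen x) = u \<oplus>\<^bsub>M\<^esub> w" by (auto simp: set_add_def')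
  have uwM: "u \<in> carrier M" "w \<in> carrier M" using uw right_submoduleD(1)[OF M] U W by blast+
  then have "g u \<in> carrier R" "g w \<in> carrier R" using g'(1)[OF uwM(1)] g'(1)[OF uwM(2)] by auto
  then have "c u + c w = 1" using c1 uw(3) g'(2)[OF uwM] by (simp add: c_def cf_add)
  then have "c u \<noteq> 0 \<or> c w \<noteq> 0" by auto
  then have "U = carrier M \<or> W = carrier M" using all[OF U uw(1)] all[OF W uw(2)] by blast
  then show "U = {\<zero>\<^bsub>M\<^esub>} \<or> W = {\<zero>\<^bsub>M\<^esub>}"
    using UW(2) right_submoduleD(1)[OF M U] right_submoduleD(1)[OF M W] by blast
qed

text \<open>\<open>gen x\<close> is mapped to \<open>gen y \<otimes> a\<close>. Applying the inverse
  shows that \<open>a\<close> has a nonzero residue at the end vertex of \<open>gen y\<close>;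
  comparing with \<open>gen x \<otimes> idem (gen_end x)\<close> shows that the end vertices
  agree.\<close>

lemma gen_iso:
  assumes x: "x \<in> gens" and y: "y \<in> gens"
    and iso: "rmod_iso R (rideal (gen x)) (rideal (gen y))"
  obtains a where "a \<in> carrier R" "cf a (gen_end y, []) \<noteq> 0" "gen_end x = gen_end y"
    "\<And>z. z \<in> carrier R \<Longrightarrow> gen x \<otimes> z = \<zero> \<Longrightarrow> gen y \<otimes> (a \<otimes> z) = \<zero>"
proof -
  let ?M = "\<lambda>x. rideal (gen x)"
  have M: "right_module R (?M x)" for x by (rule principal_right_module) simp
  obtain f g where f: "f \<in> rhom R (?M x) (?M y)" and g: "g \<in> rhom R (?M y) (?M x)"
    and "\<And>z. z \<in> carrier (?M x) \<Longrightarrow> g (f z) = z" and fg: "\<And>z. z \<in> carrier (?M y) \<Longrightarrow> f (g z) = z"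
    by (rule rmod_iso_inverse[OF M iso], rule that; assumption)
  note gM = gen_mem
  obtain a where a: "a \<in> carrier R" "f (gen x) = gen y \<otimes> a" using rhomD(1)[OF f gM] by auto
  obtain b where b: "b \<in> carrier R" "g (gen y) = gen x \<otimes> b" using rhomD(1)[OF g gM] by auto
  have fz: "f (gen x \<otimes> z) = gen y \<otimes> (a \<otimes> z)" if "z \<in> carrier R" for z
    using rhomD(3)[OF f gM that] a that by (simp add: m_assoc)
  have "gen y \<otimes> (a \<otimes> b) = gen y" using fz[OF b(1)] fg[OF gM] b(2) by simp
  then have "cf (a \<otimes> b) (gen_end y, []) = 1" using cf_gen_mult[OF y, of "a \<otimes> b"] cf_gen[OF y] a b by simp
  then have nz: "cf a (gen_end y, []) \<noteq> 0" using a b by (auto simp: cf_mult_Nil)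
  have "gen y \<otimes> (a \<otimes> idem (gen_end x)) = gen y \<otimes> a"
    using fz[of "idem (gen_end x)"] gen_idem[of x] a by simp
  then have "cf (a \<otimes> idem (gen_end x)) (gen_end y, []) = cf a (gen_end y, [])"
    using cf_gen_mult[OF y, of a] cf_gen_mult[OF y, of "a \<otimes> idem (gen_end x)"] a by simp
  then have "gen_end x = gen_end y" using nz a by (auto simp: cf_mult_idem path_end_def split: if_splits)
  moreover have "gen y \<otimes> (a \<otimes> z) = \<zero>" if "z \<in> carrier R" "gen x \<otimes> z = \<zero>" for z
    using fz[OF that(1)] that(2) rhom_zero[OF M M f] by simp
  ultimately show ?thesis using that a(1) nz by blast
qed

text \<open>With \<open>b\<close> the arrow after \<open>c\<close> on its cycle,
  \<open>c b = 0\<close> forces the product of \<open>gen y\<close>, \<open>a\<close> and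
  \<open>b\<close> to vanish. Since \<open>a\<close> has a nonzero residue, the path
  \<open>gen_path y\<close> followed by \<open>b\<close> must be zero. This excludes idempotents,
  and for an arrow it leaves only \<open>c\<close>, the unique arrow killing
  \<open>b\<close>.\<close>

lemma gen_iso_imp_eq_aux:
  assumes c: "perfect c" and y: "y \<in> gens"
    and iso: "rmod_iso R (rideal (gen (Inr c))) (rideal (gen y))"
  shows "y = Inr c"
proof -
  have x: "Inr c \<in> gens" using c by (auto simp: gens_def)
  obtain b where b: "b \<in> zero_after c" "\<And>a. a \<in> arcs Q \<Longrightarrow> head Q a = tail Q b \<Longrightarrow> \<not> ok a b \<Longrightarrow> a = c"
    using perfect_next[OF c] by blast
  then have b': "b \<in> arcs Q" "tail Q b = head Q c" "\<not> ok c b" by (auto simp: zero_after_def)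
  obtain a where a: "a \<in> carrier R" "cf a (gen_end y, []) \<noteq> 0" and e: "head Q c = gen_end y"
    and ann: "\<And>z. z \<in> carrier R \<Longrightarrow> arr c \<otimes> z = \<zero> \<Longrightarrow> gen y \<otimes> (a \<otimes> z) = \<zero>"
    using gen_iso[OF x y iso] by (auto simp: gen_def gen_end_def)
  have z: "gen y \<otimes> (a \<otimes> arr b) = \<zero>" using ann[OF arr_closed arr_mult_arr_zero[OF b'(3)]] .
  have nb: "cf (a \<otimes> arr b) (tail Q b, [b]) = cf a (gen_end y, [])"
    using cf_mult_arr_snoc[OF a(1), of "tail Q b" "[]" b b] b' e by (simp add: nz_single)
  show ?thesis
  proof (cases y)
    case (Inl v)
    then have "cf (gen y \<otimes> (a \<otimes> arr b)) (v, [b]) = cf (a \<otimes> arr b) (tail Q b, [b])"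
      using a(1) e b'(2) by (simp add: gen_def gen_end_def cf_idem_mult)
    then show ?thesis using z nb a(2) by simp
  next
    case (Inr c')
    then have c': "c' \<in> arcs Q" "head Q c' = tail Q b" using y e b' by (auto simp: gens_def gen_end_def perfect_arcs)
    have "\<not> ok c' b"
    proof
      assume "ok c' b"
      then have "(tail Q c', [c', b]) \<in> nz" using c' b'(1) by (simp add: nz_Cons)
      then have "cf (gen y \<otimes> (a \<otimes> arr b)) (tail Q c', [c', b]) = cf (a \<otimes> arr b) (tail Q b, [b])"
        using Inr a(1) c' cf_arr_mult_Cons[of "a \<otimes> arr b" "tail Q c'" c' "[b]" c'] by (simp add: gen_def)
      then show False using z nb a(2) by simp
    qed
    then show ?thesis using b(2)[OF c'] Inr by simp
  qed
qed

lemma gen_iso_imp_eq: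
  assumes x: "x \<in> gens" and y: "y \<in> gens"
    and iso: "rmod_iso R (rideal (gen x)) (rideal (gen y))"
  shows "x = y"
proof (cases x)
  case (Inr c)
  then show ?thesis using gen_iso_imp_eq_aux[of c y] x y iso by (auto simp: gens_def)
next
  case x': (Inl v)
  show ?thesis
  proof (cases y)
    case (Inr c)
    have "rmod_iso R (rideal (gen y)) (rideal (gen x))"
      by (rule rmod_iso_sym[OF principal_right_module iso]) simp
    then show ?thesis using gen_iso_imp_eq_aux[of c x] x y Inr by (auto simp: gens_def)
  next
    case (Inl w)
    then show ?thesis using gen_iso[OF x y iso] x' by (auto simp: gen_end_def)
  qed
qed

lemma gen_in_indec_GP:
  assumes x: "x \<in> gens"
  obtains G where "G \<in> indec_GP R" "rmod_iso R (rideal (gen x)) G"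
proof -
  let ?M = "rideal (gen x)"
  have M: "right_module R ?M" by (rule principal_right_module) simp
  obtain G :: "('a, nat \<Rightarrow> 'a) rmodule" where G: "gorenstein_projective R G" "rmod_iso R G ?M"
  proof (cases x)
    case (Inl v)
    then show ?thesis using gorenstein_projective_idem[of v] that by (auto simp: gen_def)
  next
    case (Inr c)
    then show ?thesis using gorenstein_projective_arr[of c] that x by (auto simp: gen_def gens_def)
  qed
  have GM: "right_module R G" using G(1) by (simp add: gorenstein_projective_def)
  have iso: "rmod_iso R ?M G" by (rule rmod_iso_sym[OF GM G(2)])
  have "indecomposable R G" by (rule indecomposable_if_iso_gen[OF x GM iso])
  then show ?thesis using that G(1) iso by (auto simp: indec_GP_def)
qed

text \<open>Every representative is reached, since it is isomorphic to some \<open>gen x R\<close>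
  and hence to \<open>\<sigma> x\<close>, while an isomorphism class contains only one
  representative.\<close>

lemma representatives_bij:
  assumes reps: "indec_GP_representatives R \<G>"
  obtains \<sigma> where "bij_betw \<sigma> gens \<G>" "\<And>x. x \<in> gens \<Longrightarrow> rmod_iso R (rideal (gen x)) (\<sigma> x)"
proof -
  let ?M = "\<lambda>x. rideal (gen x)"
  have M: "right_module R (?M x)" for x by (rule principal_right_module) simp
  have mod: "right_module R G" if "G \<in> \<G>" for G
    using that reps by (auto simp: indec_GP_representatives_def indec_GP_def indecomposable_def)
  have "\<exists>G. G \<in> \<G> \<and> rmod_iso R (?M x) G" if x: "x \<in> gens" for x
  proof -
    obtain G where "G \<in> indec_GP R" "rmod_iso R (?M x) G" using gen_in_indec_GP[OF x] by blast
    then show ?thesis using reps rmod_iso_trans[OF M] unfolding indec_GP_representatives_def by metis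
  qed
  then obtain \<sigma> where \<sigma>: "\<And>x. x \<in> gens \<Longrightarrow> \<sigma> x \<in> \<G> \<and> rmod_iso R (?M x) (\<sigma> x)" by metis
  have "inj_on \<sigma> gens"
  proof (rule inj_onI)
    fix x y assume xy: "x \<in> gens" "y \<in> gens" "\<sigma> x = \<sigma> y"
    have "rmod_iso R (\<sigma> x) (?M y)" using rmod_iso_sym[OF M conjunct2[OF \<sigma>[OF xy(2)]]] xy(3) by simp
    then have "rmod_iso R (?M x) (?M y)" using rmod_iso_trans[OF M] \<sigma>[OF xy(1)] by blast
    then show "x = y" by (rule gen_iso_imp_eq[OF xy(1,2)])
  qed
  moreover have "G \<in> \<sigma> ` gens" if G: "G \<in> \<G>" for G
  proof -
    have G': "indecomposable R G" "gorenstein_projective R G" "G \<in> indec_GP R"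
      using G reps by (auto simp: indec_GP_representatives_def indec_GP_def)
    obtain x where x: "x \<in> gens" "rmod_iso R G (?M x)"
      using gorenstein_projective_cases[OF G'(1,2)]
    proof (elim disjE bexE exE conjE)
      fix v assume "v \<in> verts Q" "rmod_iso R G (rideal (idem v))"
      then show thesis by (intro that[of "Inl v"]) (auto simp: gens_def gen_def)
    next
      fix c assume "perfect c" "rmod_iso R G (rideal (arr c))"
      then show thesis by (intro that[of "Inr c"]) (auto simp: gens_def gen_def)
    qed
    have "rmod_iso R G (\<sigma> x)" using rmod_iso_trans[OF mod[OF G] x(2)] \<sigma>[OF x(1)] by blast
    moreover have "rmod_iso R G G" by (rule rmod_iso_refl[OF mod[OF G]])
    ultimately have "G = \<sigma> x" using reps G'(3) \<sigma>[OF x(1)] G unfolding indec_GP_representatives_def by blast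
    then show ?thesis using x(1) by blast
  qed
  ultimately have "bij_betw \<sigma> gens \<G>" using \<sigma> by (auto simp: bij_betw_def)
  then show ?thesis using that \<sigma> by blast
qed

text \<open>The summand \<open>R\<close> is split by the idempotents of all vertices, so that the
  projections \<open>pr x\<close>, followed by the isomorphisms to the representatives, are jointly
  bijective.\<close>

theorem perfect_sum_iso_representatives:
  assumes reps: "indec_GP_representatives R \<G>"
  shows "rmod_iso R (direct_sum (insert None (Some ` {c. perfect c}))
      (case_option (regular_module R) (\<lambda>c. rideal (arr c))))
    (direct_sum \<G> (\<lambda>G. G))"
proof -
  let ?J = "insert None (Some ` {c. perfect c})"
  let ?L = "case_option (regular_module R) (\<lambda>c. rideal (arr c))"
  let ?N = "\<lambda>x. rideal (gen x)"
  define S where "S = direct_sum ?J ?L"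
  have "finite {c. perfect c}" by (rule finite_subset[OF _ finite_arcs]) (auto simp: perfect_arcs)
  then have finJ: "finite ?J" by simp
  have L: "right_module R (?L j)" for j
    by (cases j) (simp_all add: regular_right_module ring_axioms principal_right_module)
  have S: "right_module R S" unfolding S_def by (rule direct_sum_right_module[OF ring_axioms finJ L])
  have carS: "carrier S = (\<Pi>\<^sub>E j\<in>?J. carrier (?L j))" unfolding S_def by (rule carrier_direct_sum_finite[OF finJ])
  have p: "p None \<in> carrier R" "\<And>c. perfect c \<Longrightarrow> p (Some c) \<in> carrier (rideal (arr c))"
    if "p \<in> carrier S" for p
  proof -
    have p: "p j \<in> carrier (?L j)" if "j \<in> ?J" for j
      using \<open>p \<in> _\<close> that unfolding carS by (rule PiE_mem)
    show "p None \<in> carrier R" using p[of None] by simp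
    show "p (Some c) \<in> carrier (rideal (arr c))" if "perfect c" for c
      using p[of "Some c"] that by (simp del: principal_right_ideal_simps)
  qed
  define pr where "pr x = (\<lambda>p\<in>carrier S. case x of Inl v \<Rightarrow> idem v \<otimes> p None | Inr c \<Rightarrow> p (Some c))" for x :: "'v + 'e"
  have pr: "pr x \<in> rhom R S (?N x)" if "x \<in> gens" for x
    unfolding pr_def
    by (rule rhomI[OF S]) (use that p in \<open>auto simp: S_def gens_def gen_def r_distr m_assoc\<close>)
  obtain \<sigma> where \<sigma>: "bij_betw \<sigma> gens \<G>" and iso: "\<And>x. x \<in> gens \<Longrightarrow> rmod_iso R (?N x) (\<sigma> x)"
    using representatives_bij[OF reps] by blast
  have N: "right_module R (?N x)" for x by (simp add: principal_right_module)
  have "\<exists>f g. f \<in> rhom R (?N x) (\<sigma> x) \<and> g \<in> rhom R (\<sigma> x) (?N x) \<and>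
     (\<forall>z\<in>carrier (?N x). g (f z) = z) \<and> (\<forall>z\<in>carrier (\<sigma> x). f (g z) = z)" if "x \<in> gens" for x
    using rmod_iso_inverse[OF N iso[OF that]] by metis
  then obtain f g where f: "\<And>x. x \<in> gens \<Longrightarrow> f x \<in> rhom R (?N x) (\<sigma> x)"
    and g: "\<And>x. x \<in> gens \<Longrightarrow> g x \<in> rhom R (\<sigma> x) (?N x)"
    and gf: "\<And>x z. x \<in> gens \<Longrightarrow> z \<in> carrier (?N x) \<Longrightarrow> g x (f x z) = z"
    and fg: "\<And>x z. x \<in> gens \<Longrightarrow> z \<in> carrier (\<sigma> x) \<Longrightarrow> f x (g x z) = z"
    by metis
  define \<tau> where "\<tau> = inv_into gens \<sigma>"
  have \<tau>: "\<tau> G \<in> gens" "\<sigma> (\<tau> G) = G" if "G \<in> \<G>" for G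
    using \<sigma> that by (auto simp: \<tau>_def bij_betw_def inv_into_into f_inv_into_f)
  have \<tau>\<sigma>: "\<sigma> x \<in> \<G>" "\<tau> (\<sigma> x) = x" if "x \<in> gens" for x using \<sigma> that by (auto simp: \<tau>_def bij_betw_def)
  define \<pi> where "\<pi> G = compose (carrier S) (f (\<tau> G)) (pr (\<tau> G))" for G
  have \<pi>: "\<pi> G m = f (\<tau> G) (pr (\<tau> G) m)" if "m \<in> carrier S" for G m using that by (simp add: \<pi>_def compose_def)
  have "rmod_iso R S (direct_sum \<G> (\<lambda>G. G))"
  proof (rule direct_sum_isoI[where \<pi> = \<pi>, OF S])
    show "finite \<G>" using \<sigma> finite_gens by (simp add: bij_betw_finite)
    show "\<pi> G \<in> rhom R S G" if "G \<in> \<G>" for G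
      unfolding \<pi>_def using rhom_compose[OF S pr f, OF \<tau>(1) \<tau>(1)] \<tau>(2) that by simp
  next
    fix q assume q: "q \<in> (\<Pi>\<^sub>E G\<in>\<G>. carrier G)"
    define r where "r x = g x (q (\<sigma> x))" for x
    have q': "q (\<sigma> x) \<in> carrier (\<sigma> x)" if "x \<in> gens" for x using q \<tau>\<sigma>(1)[OF that] by auto
    have r: "r x \<in> carrier (?N x)" "f x (r x) = q (\<sigma> x)" if "x \<in> gens" for x
      using rhomD(1)[OF g[OF that] q'[OF that]] fg[OF that q'[OF that]] unfolding r_def by blast+
    \<comment> \<open>The components in the modules \<open>idem u R\<close> are glued to one element
      of \<open>R\<close>: its coefficient at a path is taken from the component of the starting
      vertex of this path.\<close>
    define m where "m = (\<lambda>j\<in>?J. case j of None \<Rightarrow> elem (\<lambda>(u, p). cf (r (Inl u)) (u, p)) | Some c \<Rightarrow> r (Inr c))"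
    have rc: "r (Inr c) \<in> carrier (rideal (arr c))" if "perfect c" for c
      using r(1)[of "Inr c"] that by (auto simp: gens_def gen_def simp del: principal_right_ideal_simps)
    have mS: "m \<in> carrier S"
      unfolding carS m_def using rc by (auto simp del: principal_right_ideal_simps)
    have "idem v \<otimes> elem (\<lambda>(u, p). cf (r (Inl u)) (u, p)) = r (Inl v)" if v: "v \<in> verts Q" for v
    proof -
      obtain a where a: "a \<in> carrier R" "r (Inl v) = idem v \<otimes> a" using r(1)[of "Inl v"] v by (auto simp: gen_def gens_def)
      show ?thesis by (rule cf_eqI) (use a in \<open>auto simp: cf_idem_mult\<close>)
    qed
    then have "pr x m = r x" if "x \<in> gens" for x using mS that by (auto simp: pr_def m_def gens_def)
    then have "\<forall>G\<in>\<G>. \<pi> G m = q G" using \<pi>[OF mS] r(2) \<tau> by simp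
    then show "\<exists>m\<in>carrier S. \<forall>G\<in>\<G>. \<pi> G m = q G" using mS by blast
  next
    fix m m' assume m: "m \<in> carrier S" "m' \<in> carrier S" and eq: "\<And>G. G \<in> \<G> \<Longrightarrow> \<pi> G m = \<pi> G m'"
    have pr_eq: "pr x m = pr x m'" if x: "x \<in> gens" for x
    proof -
      have "f x (pr x m) = f x (pr x m')" using eq[OF \<tau>\<sigma>(1)[OF x]] \<pi> m \<tau>\<sigma>(2)[OF x] by simp
      then show ?thesis using gf[OF x rhomD(1)[OF pr[OF x] m(1)]] gf[OF x rhomD(1)[OF pr[OF x] m(2)]] by metis
    qed
    have "m None = m' None"
    proof (rule cf_eqI)
      fix u p assume "(u, p) \<in> nz"
      then have "Inl u \<in> gens" using nz_start by (auto simp: gens_def)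
      then have "idem u \<otimes> m None = idem u \<otimes> m' None" using pr_eq[of "Inl u"] m by (simp add: pr_def)
      then show "cf (m None) (u, p) = cf (m' None) (u, p)" using cf_idem_mult[of _ u u p] p(1) m by metis
    qed (use p m in auto)
    moreover have "m (Some c) = m' (Some c)" if "perfect c" for c
      using pr_eq[of "Inr c"] m that by (auto simp: pr_def gens_def)
    ultimately show "m = m'"
      using m unfolding carS by (intro extensionalityI[of m ?J m']) (auto simp: PiE_def)
  qed
  then show ?thesis by (simp add: S_def)
qed

end

section \<open>Bound quiver algebras with quadratic monomial relations\<close>

lemma awlast_eq: "pre_digraph.awlast Q u p = path_end Q u p"
  by (simp add: pre_digraph.awalk_verts_conv path_end_def)

lemma path_algebra_simps:
  "carrier (path_algebra Q) = {f. finite {p. f p \<noteq> 0} \<and> {p. f p \<noteq> 0} \<subseteq> qpaths Q}"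
  "\<zero>\<^bsub>path_algebra Q\<^esub> = (\<lambda>_. 0)" "f \<oplus>\<^bsub>path_algebra Q\<^esub> g = (\<lambda>p. f p + g p)"
  "\<one>\<^bsub>path_algebra Q\<^esub> = (\<lambda>(u, p). if u \<in> verts Q \<and> p = [] then 1 else 0)"
  "c \<odot>\<^bsub>path_algebra Q\<^esub> f = (\<lambda>p. c * f p)"
  by (simp_all add: path_algebra_def)

lemma path_algebra_mult:
  "(f \<otimes>\<^bsub>path_algebra Q\<^esub> g) (u, p) = (\<Sum>i\<le>length p. f (u, take i p) * g (path_end Q u (take i p), drop i p))"
  by (simp add: path_algebra_def awlast_eq)

lemma path_vec_mult:
  "path_vec (u, p) \<otimes>\<^bsub>path_algebra Q\<^esub> path_vec (v, q) =
    (if path_end Q u p = v then path_vec (u, p @ q) else (\<lambda>_. 0 :: 'k::field))"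
proof (rule ext, clarify)
  fix w r
  have "(path_vec (u, p) \<otimes>\<^bsub>path_algebra Q\<^esub> path_vec (v, q)) (w, r) =
      (\<Sum>i\<le>length r. if i = length p then (if (w, r) = (u, p @ q) \<and> path_end Q u p = v then 1 else 0 :: 'k) else 0)"
    unfolding path_algebra_mult
  proof (rule sum.cong)
    fix i assume "i \<in> {..length r}"
    then have i: "i \<le> length r" by simp
    show "path_vec (u, p) (w, take i r) * path_vec (v, q) (path_end Q w (take i r), drop i r) =
        (if i = length p then (if (w, r) = (u, p @ q) \<and> path_end Q u p = v then 1 else 0 :: 'k) else 0)"
    proof (cases "take i r = p")
      case True
      then have "p @ drop i r = r" using append_take_drop_id[of i r] by simp
      then have "r = p @ q \<longleftrightarrow> drop i r = q" by (metis same_append_eq)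
      moreover have "i = length p" using True i by auto
      ultimately show ?thesis using True by (simp add: path_vec_def)
    next
      case False
      then have "i = length p \<Longrightarrow> r \<noteq> p @ q" by auto
      with False show ?thesis by (auto simp: path_vec_def)
    qed
  qed simp
  then show "(path_vec (u, p) \<otimes>\<^bsub>path_algebra Q\<^esub> path_vec (v, q)) (w, r) =
      (if path_end Q u p = v then path_vec (u, p @ q) else (\<lambda>_. 0 :: 'k)) (w, r)"
    by (auto simp: path_vec_def)
qed

lemma not_successively_split:
  "\<not> successively P l \<Longrightarrow> \<exists>l1 a b l2. l = l1 @ a # b # l2 \<and> \<not> P a b"
proof (induction l rule: induct_list012)
  case (3 a b l)
  show ?case
  proof (cases "P a b")
    case True
    with 3 obtain l1 x y l2 where "b # l = l1 @ x # y # l2" "\<not> P x y" by auto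
    then show ?thesis by (intro exI[of _ "a # l1"]) auto
  next
    case False
    then show ?thesis by (intro exI[of _ "[]"]) auto
  qed
qed auto

lemma (in wf_digraph) qpaths_Nil [simp]: "(u, []) \<in> qpaths G \<longleftrightarrow> u \<in> verts G"
  by (simp add: qpaths_iff awalk_def)

lemma (in wf_digraph) qpaths_Cons: "(u, a # q) \<in> qpaths G \<longleftrightarrow> a \<in> arcs G \<and> u = tail G a \<and> (head G a, q) \<in> qpaths G"
  unfolding qpaths_def using awalk_Cons_iff by auto

lemma (in wf_digraph) qpaths_append:
  "(u, p @ q) \<in> qpaths G \<longleftrightarrow> (u, p) \<in> qpaths G \<and> (path_end G u p, q) \<in> qpaths G"
proof (induction p arbitrary: u)
  case Nil
  have "u \<in> verts G" if "(u, q) \<in> qpaths G" using that by (cases q) (auto simp: qpaths_Cons)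
  then show ?case by (auto simp: path_end_def)
next
  case (Cons a p)
  have "path_end G u (a # p) = path_end G (head G a) p" by (auto simp: path_end_def)
  then show ?case using Cons by (auto simp: qpaths_Cons)
qed

lemma (in quadratic_relations) nz_iff_qpaths: "(u, p) \<in> nz \<longleftrightarrow> (u, p) \<in> qpaths Q \<and> successively ok p"
proof (induction p arbitrary: u)
  case (Cons a p)
  then show ?case by (cases p) (auto simp: nz_Cons qpaths_Cons)
qed simp

section \<open>The bound quiver algebra as a quadratic monomial algebra\<close>

context sag_algebra
begin

abbreviation "K \<equiv> path_algebra Q :: ('k, ('v, 'e) qpath \<Rightarrow> 'k) module"

definition ok :: "'e \<Rightarrow> 'e \<Rightarrow> bool" where
  "ok a b \<longleftrightarrow> head Q a = tail Q b \<and> \<not> comp_in Q I a b"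

sublocale quadratic_relations Q ok
  by unfold_locales (simp add: ok_def)

sublocale K: ring K by (rule path_algebra_ring)

lemma path_vec_closed: "p \<in> qpaths Q \<Longrightarrow> (path_vec p :: _ \<Rightarrow> 'k) \<in> carrier K"
  by (auto simp: path_vec_def path_algebra_simps)

text \<open>The right-hand side is an ideal because the parts of a nonzero path are nonzero, and it
  contains the relations. Conversely, a zero path has a factor in \<open>Z\<close> and so lies in
  \<open>I\<close>, and elements supported on zero paths are reached by induction on the
  support.\<close>

lemma ideal_monomial:
  assumes rel: "quadratic_relations Q r" and I: "I = Idl\<^bsub>K\<^esub> (path_vec ` Z)"
    and Z: "Z \<subseteq> {p \<in> qpaths Q. length (snd p) = 2}"
    and r: "\<And>a b. \<lbrakk>a \<in> arcs Q; b \<in> arcs Q; head Q a = tail Q b\<rbrakk> \<Longrightarrow> r a b \<longleftrightarrow> (tail Q a, [a, b]) \<notin> Z"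
  shows "I = {f \<in> carrier K. \<forall>p\<in>nonzero_paths Q r. f p = 0}"
proof -
  interpret r: quadratic_relations Q r by (rule rel)
  let ?J = "{f \<in> carrier K. \<forall>p\<in>r.nz. f p = 0}"
  have ZK: "path_vec ` Z \<subseteq> carrier K" using Z path_vec_closed by auto
  have I_ideal: "ideal I K" unfolding I by (rule K.genideal_ideal[OF ZK])
  interpret I: ideal I K by (rule I_ideal)
  have "ideal ?J K"
  proof (rule idealI)
    show "ring K" by (rule K.ring_axioms)
    show "subgroup ?J (add_monoid K)"
    proof (rule K.add.subgroupI)
      show "?J \<noteq> {}" using K.zero_closed by (auto simp: path_algebra_simps(2))
      fix f assume f: "f \<in> ?J"
      have "f p + (\<ominus>\<^bsub>K\<^esub> f) p = 0" for p
        using fun_cong[OF K.r_neg, of f p] f by (simp add: path_algebra_simps(2,3))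
      then have "(\<ominus>\<^bsub>K\<^esub> f) p = - f p" for p by (simp add: eq_neg_iff_add_eq_0 add.commute)
      then show "\<ominus>\<^bsub>K\<^esub> f \<in> ?J" using f by simp
    next
      fix f g assume "f \<in> ?J" "g \<in> ?J"
      then show "f \<oplus>\<^bsub>K\<^esub> g \<in> ?J" using K.a_closed[of f g] by (simp add: path_algebra_simps(3))
    qed auto
    fix f g assume f: "f \<in> ?J" and g: "g \<in> carrier K"
    show "g \<otimes>\<^bsub>K\<^esub> f \<in> ?J" using f g K.m_closed[of g f] r.nz_drop
      by (auto simp: path_algebra_mult intro!: sum.neutral)
    show "f \<otimes>\<^bsub>K\<^esub> g \<in> ?J" using f g K.m_closed[of f g] r.nz_take
      by (auto simp: path_algebra_mult intro!: sum.neutral)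
  qed
  moreover have "path_vec ` Z \<subseteq> ?J"
  proof clarify
    fix u p assume p: "(u, p) \<in> Z"
    then obtain a b where ab: "p = [a, b]" using Z by (auto simp: length_Suc_conv numeral_2_eq_2)
    have "(u, p) \<in> qpaths Q" using p Z by auto
    then have arcs: "a \<in> arcs Q" "b \<in> arcs Q" "head Q a = tail Q b" "u = tail Q a" by (auto simp: ab qpaths_Cons)
    then have "(u, p) \<notin> r.nz" using r[OF arcs(1-3)] p by (auto simp: ab r.nz_Cons)
    then show "path_vec (u, p) \<in> carrier K \<and> (\<forall>q\<in>r.nz. path_vec (u, p) q = (0::'k))"
      using path_vec_closed[OF \<open>(u, p) \<in> qpaths Q\<close>] by (auto simp: path_vec_def)
  qed
  ultimately have "I \<subseteq> ?J" unfolding I by (rule K.genideal_minimal)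
  have single: "(\<lambda>q. if q = (u, l) then c else 0) \<in> I" if "(u, l) \<in> qpaths Q" "(u, l) \<notin> r.nz" for u l and c :: 'k
  proof -
    have "\<not> successively r l" using that by (simp add: r.nz_iff_qpaths)
    then obtain l1 a b l2 where l: "l = l1 @ a # b # l2" "\<not> r a b" using not_successively_split by blast
    have q: "(u, l1) \<in> qpaths Q" "path_end Q u l1 = tail Q a" "a \<in> arcs Q" "b \<in> arcs Q" "head Q a = tail Q b"
      "(head Q b, l2) \<in> qpaths Q" using that(1) unfolding l by (auto simp: qpaths_append qpaths_Cons)
    then have z: "(tail Q a, [a, b]) \<in> Z" using r l(2) by blast
    have zI: "path_vec (tail Q a, [a, b]) \<in> I" using K.genideal_self[OF ZK] z unfolding I by auto
    have zl: "path_vec (tail Q a, [a, b]) \<otimes>\<^bsub>K\<^esub> path_vec (head Q b, l2) \<in> I"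
      by (rule I.I_r_closed[OF zI path_vec_closed[OF q(6)]])
    \<comment> \<open>The scalar is absorbed into the left factor, since membership in a ring ideal
      gives closure under multiplication by ring elements rather than under scalars.\<close>
    have cK: "(\<lambda>q. c * path_vec (u, l1) q) \<in> carrier K"
      using q(1) by (auto simp: path_vec_def path_algebra_simps)
    have "(\<lambda>q. c * path_vec (u, l1) q) \<otimes>\<^bsub>K\<^esub> (path_vec (tail Q a, [a, b]) \<otimes>\<^bsub>K\<^esub> path_vec (head Q b, l2)) \<in> I"
      by (rule I.I_l_closed[OF zl cK])
    also have "(\<lambda>q. c * path_vec (u, l1) q) \<otimes>\<^bsub>K\<^esub> (path_vec (tail Q a, [a, b]) \<otimes>\<^bsub>K\<^esub> path_vec (head Q b, l2))
      = (\<lambda>q. c * path_vec (u, l) q)"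
    proof -
      have "(\<lambda>q. c * f q) \<otimes>\<^bsub>K\<^esub> g = (\<lambda>q. c * (f \<otimes>\<^bsub>K\<^esub> g) q)" for f g :: "('v, 'e) qpath \<Rightarrow> 'k"
        by (rule ext) (auto simp: path_algebra_mult sum_distrib_left mult.assoc)
      moreover have "path_end Q (tail Q a) [a, b] = head Q b" by (simp add: path_end_def)
      ultimately show ?thesis using q(2) by (simp add: path_vec_mult l)
    qed
    also have "\<dots> = (\<lambda>q. if q = (u, l) then c else 0)" by (auto simp: path_vec_def)
    finally show ?thesis .
  qed
  have "f \<in> I" if "finite S" "f \<in> ?J" "{p. f p \<noteq> 0} \<subseteq> S" for f S
    using that
  proof (induction S arbitrary: f rule: finite_induct)
    case empty
    then have "f = \<zero>\<^bsub>K\<^esub>" by (auto simp: path_algebra_simps)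
    then show ?case using I.zero_closed by simp
  next
    case (insert p S)
    define g where "g = (\<lambda>q. if q = p then f p else 0)"
    define h where "h = (\<lambda>q. if q = p then 0 else f q)"
    have fin: "finite {q. f q \<noteq> 0}" and sub: "\<And>q. f q \<noteq> 0 \<Longrightarrow> q \<in> qpaths Q" and nz: "\<And>q. q \<in> r.nz \<Longrightarrow> f q = 0"
      using insert.prems(1) by (auto simp: path_algebra_simps)
    have "g \<in> I"
    proof (cases "f p = 0")
      case True
      then have "g = \<zero>\<^bsub>K\<^esub>" by (auto simp: path_algebra_simps g_def)
      then show ?thesis using I.zero_closed by simp
    next
      case False
      then have "p \<in> qpaths Q" "p \<notin> r.nz" using sub nz by blast+
      then show ?thesis unfolding g_def by (cases p) (simp add: single)
    qed
    moreover have "h \<in> I"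
    proof (rule insert.IH)
      have "{q. h q \<noteq> 0} \<subseteq> {q. f q \<noteq> 0}" by (auto simp: h_def)
      then show "h \<in> ?J" using finite_subset[OF _ fin] sub nz by (auto simp: path_algebra_simps h_def)
      show "{q. h q \<noteq> 0} \<subseteq> S" using insert.prems(2) by (auto simp: h_def)
    qed
    moreover have "f = g \<oplus>\<^bsub>K\<^esub> h" by (auto simp: path_algebra_simps g_def h_def)
    ultimately show ?case using I.a_closed by simp
  qed
  then have "?J \<subseteq> I" by (auto simp: path_algebra_simps)
  with \<open>I \<subseteq> ?J\<close> show ?thesis by blast
qed

text \<open>As \<open>ok\<close> is itself defined through \<open>I\<close>, the ideal is first
  described by a relation \<open>r\<close> read off from the generators. That description decides
  which paths of length two lie in \<open>I\<close> and so yields \<open>ok = r\<close> on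
  arrows.\<close>

lemma I_eq: "I = {f \<in> carrier K. \<forall>p\<in>nz. f p = 0}"
proof -
  obtain Z where Z: "Z \<subseteq> {p \<in> qpaths Q. length (snd p) = 2}" and I: "I = Idl\<^bsub>K\<^esub> (path_vec ` Z)"
    using quadratic_monomial by blast
  define r where "r a b \<longleftrightarrow> head Q a = tail Q b \<and> (tail Q a, [a, b]) \<notin> Z" for a b
  interpret r: quadratic_relations Q r by unfold_locales (simp add: r_def)
  have eq: "I = {f \<in> carrier K. \<forall>p\<in>r.nz. f p = 0}"
    by (rule ideal_monomial[OF r.quadratic_relations_axioms I Z]) (auto simp: r_def)
  have "ok a b \<longleftrightarrow> r a b" if ab: "a \<in> arcs Q" "b \<in> arcs Q" for a b
  proof (cases "head Q a = tail Q b")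
    case True
    then have q: "(tail Q a, [a, b]) \<in> qpaths Q" using ab by (simp add: qpaths_Cons)
    have "arrow_vec Q a \<otimes>\<^bsub>K\<^esub> arrow_vec Q b = path_vec (tail Q a, [a, b])"
      using True by (simp add: arrow_vec_def path_vec_mult path_end_def)
    then have "comp_in Q I a b \<longleftrightarrow> (path_vec (tail Q a, [a, b]) :: _ \<Rightarrow> 'k) \<in> I" by (simp add: comp_in_def)
    also have "\<dots> \<longleftrightarrow> (tail Q a, [a, b]) \<notin> r.nz"
      unfolding eq using path_vec_closed[OF q] by (auto simp: path_vec_def)
    also have "\<dots> \<longleftrightarrow> \<not> r a b" using q ab True by (simp add: r.nz_iff_qpaths)
    finally show ?thesis using True by (auto simp: ok_def r_def)
  qed (simp add: ok_def r_def)
  then have "successively ok p \<longleftrightarrow> successively r p" if "set p \<subseteq> arcs Q" for p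
    using that by (induction p rule: induct_list012) auto
  then have "nz = r.nz" unfolding nonzero_paths_def by auto
  then show ?thesis using eq by simp
qed

lemma mem_I: "f \<in> I \<longleftrightarrow> f \<in> carrier K \<and> (\<forall>p\<in>nz. f p = 0)"
  using arg_cong[OF I_eq, of "\<lambda>X. f \<in> X"] unfolding mem_Collect_eq .

lemma I_ideal: "ideal I K"
proof -
  obtain Z where Z: "Z \<subseteq> qpaths Q" "I = Idl\<^bsub>K\<^esub> (path_vec ` Z)" using quadratic_monomial by blast
  have "path_vec ` Z \<subseteq> carrier K" using Z(1) path_vec_closed by auto
  then show ?thesis unfolding Z by (rule K.genideal_ideal)
qed

sublocale I: ideal I K by (rule I_ideal)

abbreviation "A \<equiv> bound_quiver_algebra Q I"

abbreviation cls :: "(('v, 'e) qpath \<Rightarrow> 'k) \<Rightarrow> (('v, 'e) qpath \<Rightarrow> 'k) set" where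
  "cls f \<equiv> I +>\<^bsub>K\<^esub> f"

text \<open>The choice of the representative is harmless: elements of \<open>I\<close> vanish on
  \<open>nz\<close>, so all representatives of a coset agree there.\<close>

definition coeff :: "(('v, 'e) qpath \<Rightarrow> 'k) set \<Rightarrow> ('v, 'e) qpath \<Rightarrow> 'k" where
  "coeff X p = (if p \<in> nz then (SOME f. f \<in> X) p else 0)"

lemma A_fields:
  "carrier A = a_rcosets\<^bsub>K\<^esub> I" "monoid.mult A = rcoset_mult K I" "\<one>\<^bsub>A\<^esub> = cls \<one>\<^bsub>K\<^esub>" "add A = set_add K"
  "c \<odot>\<^bsub>A\<^esub> X = (\<Union>x\<in>X. cls (c \<odot>\<^bsub>K\<^esub> x))"
  by (simp_all add: quotient_algebra_def FactRing_def ring.defs module.defs)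

lemma carrier_A: "X \<in> carrier A \<longleftrightarrow> (\<exists>f\<in>carrier K. X = cls f)"
  by (auto simp: A_fields A_RCOSETS_def')

lemma cls_closed [simp]: "f \<in> carrier K \<Longrightarrow> cls f \<in> carrier A"
  by (auto simp: carrier_A)

lemma cls_mult: "\<lbrakk>f \<in> carrier K; g \<in> carrier K\<rbrakk> \<Longrightarrow> cls f \<otimes>\<^bsub>A\<^esub> cls g = cls (f \<otimes>\<^bsub>K\<^esub> g)"
  by (simp add: A_fields I.rcoset_mult_add)

lemma cls_add: "\<lbrakk>f \<in> carrier K; g \<in> carrier K\<rbrakk> \<Longrightarrow> cls f \<oplus>\<^bsub>A\<^esub> cls g = cls (f \<oplus>\<^bsub>K\<^esub> g)"
  by (simp add: A_fields I.a_rcos_sum)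

lemma mem_cls: "g \<in> cls f \<longleftrightarrow> (\<exists>h\<in>I. g = (\<lambda>p. h p + f p))"
  by (auto simp: a_r_coset_def' path_algebra_simps)

lemma coeff_cls:
  assumes f: "f \<in> carrier K" shows "coeff (cls f) p = (if p \<in> nz then f p else 0)"
proof -
  have "(SOME g. g \<in> cls f) \<in> cls f" by (rule someI[of "\<lambda>g. g \<in> cls f", OF I.a_rcos_self[OF f]])
  then show ?thesis by (auto simp: coeff_def mem_cls mem_I)
qed

lemma cls_eqI:
  assumes f: "f \<in> carrier K" and g: "g \<in> carrier K" and eq: "\<And>p. p \<in> nz \<Longrightarrow> f p = g p"
  shows "cls f = cls g"
proof -
  define h where "h = g \<ominus>\<^bsub>K\<^esub> f"
  have hK: "h \<in> carrier K" using f g by (simp add: h_def)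
  have hg: "h \<oplus>\<^bsub>K\<^esub> f = g" using f g by (simp add: h_def K.minus_eq K.a_assoc K.l_neg)
  have h: "g p = h p + f p" for p using fun_cong[OF hg, of p] by (simp add: path_algebra_simps(3))
  have "h p = 0" if "p \<in> nz" for p using h[of p] eq[OF that] by simp
  then have "h \<in> I" using hK by (simp add: mem_I)
  then have "g \<in> cls f" unfolding mem_cls using h by blast
  then show ?thesis using K.a_repr_independence[OF _ f I.a_subgroup] by blast
qed

text \<open>Scalar multiplication in the quotient is a union over all representatives; the cosets in
  this union coincide.\<close>

lemma cls_smult:
  assumes f: "f \<in> carrier K" shows "c \<odot>\<^bsub>A\<^esub> cls f = cls (\<lambda>p. c * f p)"
proof -
  have sc: "(\<lambda>p. c * h p) \<in> carrier K" if "h \<in> carrier K" for h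
    using that by (auto simp: path_algebra_simps elim: finite_subset[rotated])
  have "cls (c \<odot>\<^bsub>K\<^esub> x) = cls (\<lambda>p. c * f p)" if "x \<in> cls f" for x
  proof -
    obtain h where h: "h \<in> I" "x = (\<lambda>p. h p + f p)" using \<open>x \<in> cls f\<close> by (auto simp: mem_cls)
    then have "x = h \<oplus>\<^bsub>K\<^esub> f" "h \<in> carrier K" by (auto simp: path_algebra_simps(3) mem_I)
    then have "x \<in> carrier K" using f by simp
    then have "cls (\<lambda>p. c * x p) = cls (\<lambda>p. c * f p)"
      using h by (intro cls_eqI sc f) (auto simp: mem_I)
    then show ?thesis by (simp add: path_algebra_simps)
  qed
  moreover have "f \<in> cls f" by (rule I.a_rcos_self[OF f])
  ultimately show ?thesis by (auto simp: A_fields)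
qed

lemma smult_closed: "x \<in> carrier A \<Longrightarrow> c \<odot>\<^bsub>A\<^esub> x \<in> carrier A"
  and coeff_smult: "x \<in> carrier A \<Longrightarrow> coeff (c \<odot>\<^bsub>A\<^esub> x) p = c * coeff x p"
proof -
  assume "x \<in> carrier A"
  then obtain f where f: "f \<in> carrier K" "x = cls f" by (auto simp: carrier_A)
  have sc: "(\<lambda>p. c * f p) \<in> carrier K"
    using f(1) by (auto simp: path_algebra_simps elim: finite_subset[rotated])
  then show "c \<odot>\<^bsub>A\<^esub> x \<in> carrier A" "coeff (c \<odot>\<^bsub>A\<^esub> x) p = c * coeff x p"
    using f by (simp_all add: cls_smult coeff_cls)
qed

lemma coeff_add: "\<lbrakk>x \<in> carrier A; y \<in> carrier A\<rbrakk> \<Longrightarrow> coeff (x \<oplus>\<^bsub>A\<^esub> y) p = coeff x p + coeff y p"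
  by (auto simp: carrier_A cls_add coeff_cls) (simp_all add: path_algebra_simps(3))

text \<open>The class of a nonzero path has coefficient 1 at this path, so the path occurs in some
  element of a finite spanning set, and each of these elements involves only finitely many
  paths.\<close>

lemma finite_nz: "finite nz"
proof -
  interpret A: ring A by (rule bound_quiver_algebra_ring)
  obtain B where B0: "finite B \<and> B \<subseteq> carrier A \<and> (\<forall>x\<in>carrier A. \<exists>c. x = (\<Oplus>\<^bsub>A\<^esub>b\<in>B. c b \<odot>\<^bsub>A\<^esub> b))"
    using finite_dimensional unfolding Defs.finite_dimensional_def by (rule exE)
  note B = conjunct1[OF B0] conjunct1[OF conjunct2[OF B0]] bspec[OF conjunct2[OF conjunct2[OF B0]]]
  have zero: "coeff \<zero>\<^bsub>A\<^esub> p = 0" for p using coeff_add[of "\<zero>\<^bsub>A\<^esub>" "\<zero>\<^bsub>A\<^esub>" p] A.zero_closed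
    by (metis A.r_zero add_cancel_right_right)
  have sum: "coeff (\<Oplus>\<^bsub>A\<^esub>b\<in>S. c b \<odot>\<^bsub>A\<^esub> b) p = (\<Sum>b\<in>S. c b * coeff b p)" if "finite S" "S \<subseteq> carrier A" for S c p
    using that by (induction S rule: finite_induct)
      (simp_all add: zero Pi_iff smult_closed coeff_add coeff_smult subset_iff)
  have fin: "finite {p. coeff b p \<noteq> 0}" if "b \<in> carrier A" for b
  proof -
    obtain f where f: "f \<in> carrier K" "b = cls f" using \<open>b \<in> carrier A\<close> by (auto simp: carrier_A)
    have "{p. coeff b p \<noteq> 0} \<subseteq> {p. f p \<noteq> 0}" using f by (auto simp: coeff_cls split: if_splits)
    then show ?thesis using f(1) by (auto simp: path_algebra_simps intro: finite_subset)
  qed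
  have "nz \<subseteq> (\<Union>b\<in>B. {p. coeff b p \<noteq> 0})"
  proof
    fix p assume p: "p \<in> nz"
    then have "p \<in> qpaths Q" by (cases p) (simp add: nz_iff_qpaths)
    note pK = path_vec_closed[OF this]
    obtain c where c: "cls (path_vec p) = (\<Oplus>\<^bsub>A\<^esub>b\<in>B. c b \<odot>\<^bsub>A\<^esub> b)"
      using B(3)[OF cls_closed[OF pK]] by (rule exE)
    have "coeff (cls (path_vec p)) p = 1" using coeff_cls[OF pK, of p] p by (simp add: path_vec_def)
    then have "(\<Sum>b\<in>B. c b * coeff b p) = 1" unfolding c sum[OF B(1,2)] .
    then have "(\<Sum>b\<in>B. c b * coeff b p) \<noteq> 0" by simp
    then obtain b where "b \<in> B" "c b * coeff b p \<noteq> 0" by (rule sum.not_neutral_contains_not_neutral)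
    then show "p \<in> (\<Union>b\<in>B. {p. coeff b p \<noteq> 0})" by auto
  qed
  then show ?thesis by (rule finite_subset) (use B fin in auto)
qed

sublocale quadratic_monomial_algebra Q ok A coeff
proof (intro quadratic_monomial_algebra.intro quadratic_monomial_algebra_axioms.intro)
  show "quadratic_relations Q ok" by (rule quadratic_relations_axioms)
  show "ring A" by (rule bound_quiver_algebra_ring)
  show "finite nz" by (rule finite_nz)
  show "bij_betw coeff (carrier A) {f. \<forall>p. p \<notin> nz \<longrightarrow> f p = 0}"
    unfolding bij_betw_def
  proof (intro conjI equalityI subsetI)
    show "inj_on coeff (carrier A)"
    proof (rule inj_onI)
      fix x y assume "x \<in> carrier A" "y \<in> carrier A" and eq: "coeff x = coeff y"
      then obtain f g where fg: "f \<in> carrier K" "x = cls f" "g \<in> carrier K" "y = cls g" by (auto simp: carrier_A)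
      show "x = y" unfolding fg
      proof (rule cls_eqI[OF fg(1,3)])
        fix p assume "p \<in> nz"
        then show "f p = g p" using fun_cong[OF eq, of p] fg by (simp add: coeff_cls)
      qed
    qed
    fix f :: "('v, 'e) qpath \<Rightarrow> 'k"
    { assume "f \<in> coeff ` carrier A"
      then show "f \<in> {f. \<forall>p. p \<notin> nz \<longrightarrow> f p = 0}" by (auto simp: coeff_def) }
    { assume f: "f \<in> {f. \<forall>p. p \<notin> nz \<longrightarrow> f p = 0}"
      then have sub: "{p. f p \<noteq> 0} \<subseteq> nz" by auto
      moreover have "nz \<subseteq> qpaths Q" by (auto simp: nz_iff_qpaths)
      ultimately have fK: "f \<in> carrier K"
        using finite_subset[OF sub finite_nz] by (auto simp: path_algebra_simps)
      moreover have "f = coeff (cls f)" using f by (auto simp: coeff_cls[OF fK])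
      ultimately show "f \<in> coeff ` carrier A" by (metis cls_closed imageI) }
  qed
  fix x y and q :: "('v, 'e) qpath" assume xy: "x \<in> carrier A" "y \<in> carrier A"
  show "coeff (x \<oplus>\<^bsub>A\<^esub> y) q = coeff x q + coeff y q" by (rule coeff_add[OF xy])
  fix u p assume nz: "(u, p) \<in> nz"
  obtain f g where fg: "f \<in> carrier K" "x = cls f" "g \<in> carrier K" "y = cls g" using xy by (auto simp: carrier_A)
  show "coeff (x \<otimes>\<^bsub>A\<^esub> y) (u, p) = (\<Sum>i\<le>length p. coeff x (u, take i p) * coeff y (path_end Q u (take i p), drop i p))"
    using fg nz nz_take[OF nz] nz_drop[OF nz] K.m_closed[OF fg(1,3)]
    by (simp add: cls_mult coeff_cls) (simp add: path_algebra_mult)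
next
  fix u p
  show "coeff \<one>\<^bsub>A\<^esub> (u, p) = (if p = [] \<and> u \<in> verts Q then 1 else 0)"
    using coeff_cls[OF K.one_closed, of "(u, p)"] unfolding A_fields by (auto simp: path_algebra_simps(4))
qed

lemma arrow_class_eq: "a \<in> arcs Q \<Longrightarrow> arrow_class Q I a = arr a"
proof -
  assume a: "a \<in> arcs Q"
  then have q: "(tail Q a, [a]) \<in> qpaths Q" by (simp add: qpaths_Cons)
  show ?thesis
    unfolding arrow_class_def arrow_vec_def
    by (rule cf_eqI) (use path_vec_closed[OF q] a in \<open>auto simp: coeff_cls cf_arr path_vec_def\<close>)
qed

lemma perfect_forbidden_cycle_iff: "perfect_forbidden_cycle Q I c \<longleftrightarrow> perfect_cycle c"
proof -
  have "c ! i \<in> arcs Q \<and> c ! (Suc i mod length c) \<in> arcs Q" if "set c \<subseteq> arcs Q" "i < length c" for i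
  proof -
    have "Suc i mod length c < length c" using that(2) by (intro mod_less_divisor) auto
    then show ?thesis using that by (auto dest: nth_mem)
  qed
  then show ?thesis
    unfolding perfect_forbidden_cycle_def forbidden_cycle_def oriented_cycle_def perfect_cycle_def Let_def ok_def
    by (intro iffI; (elim conjE)?; intro conjI; simp)
qed

lemma perfect_arrows_eq: "perfect_arrows Q I = {c. perfect c}"
  by (auto simp: perfect_arrows_def perfect_def perfect_forbidden_cycle_iff)

lemma arrow_endo_algebra_iso:
  assumes "indec_GP_representatives A \<G>"
  shows "algebra_iso (arrow_endo_algebra Q I (perfect_arrows Q I)) (CM_Auslander_algebra A \<G>)"
proof -
  let ?J = "insert None (Some ` {c. perfect c})"
  let ?L = "case_option (regular_module A) (\<lambda>c. principal_right_ideal A (arr c))"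
  have eq: "direct_sum ?J (case_option (regular_module A) (\<lambda>c. principal_right_ideal A (arrow_class Q I c))) = direct_sum ?J ?L"
    by (rule direct_sum_cong) (auto simp: arrow_class_eq perfect_arcs)
  have "finite {c. perfect c}" by (rule finite_subset[OF _ finite_arcs]) (auto simp: perfect_arcs)
  then have mod: "right_module A (direct_sum ?J ?L)"
    by (intro direct_sum_right_module)
      (auto simp: regular_right_module ring_axioms principal_right_module)
  have "algebra_iso (End_algebra A (direct_sum ?J ?L)) (End_algebra A (direct_sum \<G> (\<lambda>G. G)))"
    by (rule algebra_iso_End[OF mod perfect_sum_iso_representatives[OF assms]]) (simp add: smult_closed)
  then show ?thesis by (simp add: arrow_endo_algebra_def CM_Auslander_algebra_def Let_def perfect_arrows_eq eq)
qed

end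

theorem theorem1p3:
  fixes Q :: "('v, 'e) pre_digraph"
    and I :: "(('v, 'e) qpath \<Rightarrow> 'k::alg_closed_field) set"
    and \<G> :: "((('v, 'e) qpath \<Rightarrow> 'k) set, nat \<Rightarrow> (('v, 'e) qpath \<Rightarrow> 'k) set) rmodule set"
  assumes "sag_algebra Q I"
    and "indec_GP_representatives (bound_quiver_algebra Q I) \<G>"
  shows "algebra_iso (arrow_endo_algebra Q I (perfect_arrows Q I))
           (CM_Auslander_algebra (bound_quiver_algebra Q I) \<G>)"
  using sag_algebra.arrow_endo_algebra_iso[OF assms] .

end
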